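(* Let $R$ be a commutative ring with $1$ of characteristic zero (i.e. the natural map $R\to R\otimes\mathbb{Q}$ is injective), let $f=\sum_u a_ux^u\in R[x_1^{\pm1},\dots,x_n^{\pm1}]$ be a Laurent polynomial with Newton polytope $\Delta(f)$, and let $J$ be either the set $\Delta(f)\cap\mathbb{Z}^n$ of all integral points of $\Delta(f)$ or the set $\Delta(f)^\circ\cap\mathbb{Z}^n$ of integral points in its interior. Assume $J\ne\emptyset$ and let $g=\#J$. For $m\ge1$ let $\beta_m$ be the $g\times g$ matrix indexed by $J$ with $$(\beta_m)_{u,v}=\text{the coefficient of } x^{mv-u}\text{ in } f(x)^{m-1},\qquad u,v\in J$$ ($\beta_1$ is the identity). Define the $g$-tuple of formal power series $l(\tau)=(l_u(\tau))_{u\in J}$ in variables $\tau=(\tau_v)_{v\in J}$ by $$l_u(\tau)=\sum_{m=1}^\infty\frac1m\sum_{v\in J}(\beta_m)_{u,v}\,\tau_v^m,$$ and the $g$-dimensional formal group law $G_f(\tau,\tau')=l^{-1}(l(\tau)+l(\tau'))$ with coefficients in $R\otimes\mathbb{Q}$, where $l^{-1}$ is the compositional inverse of $l$. Let $p$ be a prime and $R_{(p)}=R\otimes\mathbb{Z}_{(p)}\subset R\otimes\mathbb{Q}$. If $R$ admits a Frobenius endomorphism for $p$, then $G_f\in R_{(p)}[[\tau,\tau']]$.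
   Context: The Newton polytope $\Delta(f)$ is the convex hull of $\{u\in\mathbb{Z}^n: a_u\ne0\}$. A ($p$th power) Frobenius endomorphism of $R$ is a ring endomorphism $\sigma:R\to R$ with $\sigma(r)\equiv r^p\bmod pR$ for all $r\in R$. *)

theory Defs
  imports
    "HOL-Analysis.Analysis"
    "HOL-Library.Poly_Mapping"
    "HOL-Computational_Algebra.Primes"
begin

section \<open>The ring \<open>R \<otimes> \<rat>\<close>\<close>

text \<open>
  \<open>R \<otimes> \<rat>\<close> is constructed as the ring of fractions \<open>r / m\<close> with \<open>r\<close> in \<open>R\<close> and \<open>m\<close> a non-zero
  integer. \<open>R\<close> is not assumed to be torsion-free here, hence the factor \<open>k\<close> in the relation.
  The sort constraint \<open>ring_char_0\<close> only says that \<open>1\<close> is not a torsion element, so that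
  \<open>0 \<noteq> 1\<close> in \<open>R \<otimes> \<rat>\<close>. The fact \<open>tens_universal\<close> below is the universal property of the
  tensor product over the integers.
\<close>

definition tensor_rel :: "'a::comm_ring_1 \<times> int \<Rightarrow> 'a \<times> int \<Rightarrow> bool" where
  "tensor_rel x y \<longleftrightarrow> snd x \<noteq> 0 \<and> snd y \<noteq> 0 \<and>
     (\<exists>k::int. k \<noteq> 0 \<and> of_int k * (fst x * of_int (snd y)) = of_int k * (fst y * of_int (snd x)))"

lemma part_equivp_tensor_rel: "part_equivp (tensor_rel :: 'a::comm_ring_1 \<times> int \<Rightarrow> _)"
proof (rule part_equivpI)
  show "\<exists>x :: 'a \<times> int. tensor_rel x x"
    by (rule exI[of _ "(0, 1)"]) (auto simp: tensor_rel_def intro: exI[of _ 1])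
  show "symp (tensor_rel :: 'a \<times> int \<Rightarrow> _)"
    by (auto simp: tensor_rel_def symp_def)
  show "transp (tensor_rel :: 'a \<times> int \<Rightarrow> _)"
  proof (rule transpI)
    fix x y z :: "'a \<times> int"
    assume "tensor_rel x y" and "tensor_rel y z"
    then obtain k l where nz: "snd x \<noteq> 0" "snd y \<noteq> 0" "snd z \<noteq> 0" "k \<noteq> 0" "l \<noteq> 0"
      and k: "of_int k * (fst x * of_int (snd y)) = of_int k * (fst y * of_int (snd x))"
      and l: "of_int l * (fst y * of_int (snd z)) = of_int l * (fst z * of_int (snd y))"
      by (auto simp: tensor_rel_def)
    have "of_int (k * l * snd y) * (fst x * of_int (snd z))
        = of_int (l * snd z) * (of_int k * (fst x * of_int (snd y)))"
      by (simp add: ac_simps)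
    also have "\<dots> = of_int (k * snd x) * (of_int l * (fst y * of_int (snd z)))"
      unfolding k by (simp add: ac_simps)
    also have "\<dots> = of_int (k * l * snd y) * (fst z * of_int (snd x))"
      unfolding l by (simp add: ac_simps)
    finally show "tensor_rel x z"
      using nz unfolding tensor_rel_def by (intro conjI exI[of _ "k * l * snd y"]) auto
  qed
qed

quotient_type (overloaded) 'a tensor_rat = "'a::{comm_ring_1,ring_char_0} \<times> int" / partial: tensor_rel
  by (rule part_equivp_tensor_rel)

lemma tensor_rel_refl: "snd x \<noteq> 0 \<Longrightarrow> tensor_rel x x"
  by (auto simp: tensor_rel_def intro: exI[of _ 1])

lemma tensor_relI:
  "snd x \<noteq> 0 \<Longrightarrow> snd y \<noteq> 0 \<Longrightarrow> fst x * of_int (snd y) = fst y * of_int (snd x) \<Longrightarrow> tensor_rel x y"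
  by (auto simp: tensor_rel_def intro: exI[of _ 1])

lift_definition frac_tensor :: "'a::{comm_ring_1,ring_char_0} \<Rightarrow> int \<Rightarrow> 'a tensor_rat"
  is "\<lambda>r m. if m = 0 then (0, 1) else (r, m)"
  by (auto intro: tensor_rel_refl)

lemma frac_tensor_cases [cases type: tensor_rat]:
  obtains r m where "x = frac_tensor r m" "m \<noteq> 0"
proof -
  have "\<exists>r m. x = frac_tensor r m \<and> m \<noteq> 0"
  proof (transfer fixing: )
    fix x :: "'a \<times> int" assume "tensor_rel x x"
    then show "\<exists>r m. tensor_rel x (if m = 0 then (0, 1) else (r, m)) \<and> m \<noteq> 0"
      by (intro exI[of _ "fst x"] exI[of _ "snd x"]) (auto simp: tensor_rel_def)
  qed
  then show ?thesis using that by blast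
qed

lemma eq_frac_tensor:
  assumes "m \<noteq> 0" "n \<noteq> 0"
  shows "frac_tensor r m = frac_tensor s n \<longleftrightarrow>
    (\<exists>k. k \<noteq> 0 \<and> of_int k * (r * of_int n) = of_int k * (s * of_int m))"
  using assms by transfer (auto simp: tensor_rel_def)

lemma frac_tensor_eqI:
  "m \<noteq> 0 \<Longrightarrow> n \<noteq> 0 \<Longrightarrow> r * of_int n = s * of_int m \<Longrightarrow> frac_tensor r m = frac_tensor s n"
  by (subst eq_frac_tensor) (auto intro: exI[of _ 1])

instantiation tensor_rat :: ("{comm_ring_1,ring_char_0}") comm_ring_1
begin

lift_definition zero_tensor_rat :: "'a tensor_rat" is "(0, 1)"
  by (auto intro: tensor_rel_refl)

lift_definition one_tensor_rat :: "'a tensor_rat" is "(1, 1)"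
  by (auto intro: tensor_rel_refl)

lift_definition plus_tensor_rat :: "'a tensor_rat \<Rightarrow> 'a tensor_rat \<Rightarrow> 'a tensor_rat"
  is "\<lambda>x y. (fst x * of_int (snd y) + fst y * of_int (snd x), snd x * snd y)"
proof -
  fix x x' y y' :: "'a \<times> int"
  assume "tensor_rel x x'" "tensor_rel y y'"
  then obtain k l where nz: "snd x \<noteq> 0" "snd y \<noteq> 0" "snd x' \<noteq> 0" "snd y' \<noteq> 0" "k \<noteq> 0" "l \<noteq> 0"
    and k: "of_int k * (fst x * of_int (snd x')) = of_int k * (fst x' * of_int (snd x))"
    and l: "of_int l * (fst y * of_int (snd y')) = of_int l * (fst y' * of_int (snd y))"
    by (auto simp: tensor_rel_def)
  have "of_int (k * l) * ((fst x * of_int (snd y) + fst y * of_int (snd x)) * of_int (snd x' * snd y'))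
    = of_int (l * snd y * snd y') * (of_int k * (fst x * of_int (snd x')))
      + of_int (k * snd x * snd x') * (of_int l * (fst y * of_int (snd y')))"
    by (simp add: algebra_simps)
  also have "\<dots> = of_int (k * l) *
      ((fst x' * of_int (snd y') + fst y' * of_int (snd x')) * of_int (snd x * snd y))"
    unfolding k l by (simp add: algebra_simps)
  finally show "tensor_rel (fst x * of_int (snd y) + fst y * of_int (snd x), snd x * snd y)
      (fst x' * of_int (snd y') + fst y' * of_int (snd x'), snd x' * snd y')"
    unfolding tensor_rel_def fst_conv snd_conv
    using nz by (intro conjI exI[of _ "k * l"]) auto
qed

lift_definition uminus_tensor_rat :: "'a tensor_rat \<Rightarrow> 'a tensor_rat"
  is "\<lambda>x. (- fst x, snd x)"
  by (auto simp: tensor_rel_def)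

definition minus_tensor_rat :: "'a tensor_rat \<Rightarrow> 'a tensor_rat \<Rightarrow> 'a tensor_rat" where
  "minus_tensor_rat x y = x + - y"

lift_definition times_tensor_rat :: "'a tensor_rat \<Rightarrow> 'a tensor_rat \<Rightarrow> 'a tensor_rat"
  is "\<lambda>x y. (fst x * fst y, snd x * snd y)"
proof -
  fix x x' y y' :: "'a \<times> int"
  assume "tensor_rel x x'" "tensor_rel y y'"
  then obtain k l where nz: "snd x \<noteq> 0" "snd y \<noteq> 0" "snd x' \<noteq> 0" "snd y' \<noteq> 0" "k \<noteq> 0" "l \<noteq> 0"
    and k: "of_int k * (fst x * of_int (snd x')) = of_int k * (fst x' * of_int (snd x))"
    and l: "of_int l * (fst y * of_int (snd y')) = of_int l * (fst y' * of_int (snd y))"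
    by (auto simp: tensor_rel_def)
  have "of_int (k * l) * (fst x * fst y * of_int (snd x' * snd y'))
    = (of_int k * (fst x * of_int (snd x'))) * (of_int l * (fst y * of_int (snd y')))"
    by (simp add: algebra_simps)
  also have "\<dots> = of_int (k * l) * (fst x' * fst y' * of_int (snd x * snd y))"
    unfolding k l by (simp add: algebra_simps)
  finally show "tensor_rel (fst x * fst y, snd x * snd y) (fst x' * fst y', snd x' * snd y')"
    unfolding tensor_rel_def fst_conv snd_conv
    using nz by (intro conjI exI[of _ "k * l"]) auto
qed

instance
proof
  fix x y z :: "'a tensor_rat"
  show "x + y + z = x + (y + z)"
    by transfer (rule tensor_relI; auto simp: tensor_rel_def algebra_simps)
  show "x + y = y + x"
    by transfer (rule tensor_relI; auto simp: tensor_rel_def algebra_simps)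
  show "0 + x = x"
    by transfer (rule tensor_relI; auto simp: tensor_rel_def)
  show "- x + x = 0"
    by transfer (rule tensor_relI; auto simp: tensor_rel_def)
  show "x - y = x + - y"
    by (rule minus_tensor_rat_def)
  show "x * y * z = x * (y * z)"
    by transfer (rule tensor_relI; auto simp: tensor_rel_def algebra_simps)
  show "x * y = y * x"
    by transfer (rule tensor_relI; auto simp: tensor_rel_def algebra_simps)
  show "1 * x = x"
    by transfer (rule tensor_relI; auto simp: tensor_rel_def)
  show "(x + y) * z = x * z + y * z"
    by transfer (rule tensor_relI; auto simp: tensor_rel_def algebra_simps)
  show "(0::'a tensor_rat) \<noteq> 1"
    by transfer (auto simp: tensor_rel_def)
qed

end

lemma zero_frac_tensor: "0 = frac_tensor 0 1"
  by transfer (auto intro: tensor_rel_refl)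

lemma one_frac_tensor: "1 = frac_tensor 1 1"
  by transfer (auto intro: tensor_rel_refl)

lemma add_frac_tensor:
  "m \<noteq> 0 \<Longrightarrow> n \<noteq> 0 \<Longrightarrow>
    frac_tensor r m + frac_tensor s n = frac_tensor (r * of_int n + s * of_int m) (m * n)"
  by transfer (auto intro: tensor_rel_refl)

lemma mult_frac_tensor:
  "m \<noteq> 0 \<Longrightarrow> n \<noteq> 0 \<Longrightarrow> frac_tensor r m * frac_tensor s n = frac_tensor (r * s) (m * n)"
  by transfer (auto intro: tensor_rel_refl)

text \<open>The pure tensor \<open>r \<otimes> q\<close>.\<close>

definition tens :: "'a::{comm_ring_1,ring_char_0} \<Rightarrow> rat \<Rightarrow> 'a tensor_rat" where
  "tens r q = frac_tensor (r * of_int (fst (quotient_of q))) (snd (quotient_of q))"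

definition to_tensor_rat :: "'a::{comm_ring_1,ring_char_0} \<Rightarrow> 'a tensor_rat" where
  "to_tensor_rat r = tens r 1"

lemma tens_of_int_divide:
  assumes "m \<noteq> 0"
  shows "tens r (of_int a / of_int m) = frac_tensor (r * of_int a) m"
proof -
  obtain b n where bn: "quotient_of (of_int a / of_int m) = (b, n)" by fastforce
  have n: "n > 0" using quotient_of_denom_pos[OF bn] .
  have "(of_int a / of_int m :: rat) = of_int b / of_int n"
    using quotient_of_div[OF bn] .
  then have "(of_int (a * n) :: rat) = of_int (b * m)"
    using assms n by (simp add: field_simps)
  then have "a * n = b * m" by (simp only: of_int_eq_iff)
  then have "(of_int b * of_int m :: 'a) = of_int a * of_int n"
    by (metis of_int_mult)
  then show ?thesis
    using assms n bn by (auto simp: tens_def mult.assoc intro!: frac_tensor_eqI)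
qed

lemma frac_tensor_eq_tens: "m \<noteq> 0 \<Longrightarrow> frac_tensor r m = tens r (1 / of_int m)"
  using tens_of_int_divide[of m r 1] by simp

lemma rat_as_fraction: obtains a m where "(q::rat) = of_int a / of_int m" "m \<noteq> 0"
  using quotient_of_div[of q] quotient_of_denom_pos[of q] by (metis prod.exhaust less_irrefl)

lemma tens_add_left: "tens (r + s) q = tens r q + tens s q"
proof -
  obtain a m where q: "q = of_int a / of_int m" "m \<noteq> 0" by (rule rat_as_fraction)
  show ?thesis unfolding q(1) tens_of_int_divide[OF q(2)] add_frac_tensor[OF q(2) q(2)]
    using q(2) by (intro frac_tensor_eqI) (auto simp: algebra_simps)
qed

lemma tens_add_right: "tens r (q + q') = tens r q + tens r q'"
proof -
  obtain a m where q: "q = of_int a / of_int m" "m \<noteq> 0" by (rule rat_as_fraction)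
  obtain b n where q': "q' = of_int b / of_int n" "n \<noteq> 0" by (rule rat_as_fraction)
  have "q + q' = of_int (a * n + b * m) / of_int (m * n)"
    using q q' by (simp add: field_simps)
  moreover have "m * n \<noteq> 0" using q q' by simp
  ultimately have "tens r (q + q') = frac_tensor (r * of_int (a * n + b * m)) (m * n)"
    using tens_of_int_divide by metis
  also have "\<dots> = tens r q + tens r q'"
    using q q' by (simp add: tens_of_int_divide add_frac_tensor algebra_simps)
  finally show ?thesis .
qed

lemma tens_mult: "tens r q * tens s q' = tens (r * s) (q * q')"
proof -
  obtain a m where q: "q = of_int a / of_int m" "m \<noteq> 0" by (rule rat_as_fraction)
  obtain b n where q': "q' = of_int b / of_int n" "n \<noteq> 0" by (rule rat_as_fraction)
  have "q * q' = of_int (a * b) / of_int (m * n)"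
    using q q' by simp
  moreover have "m * n \<noteq> 0" using q q' by simp
  ultimately have "tens (r * s) (q * q') = frac_tensor (r * s * of_int (a * b)) (m * n)"
    using tens_of_int_divide by metis
  also have "\<dots> = tens r q * tens s q'"
    using q q' by (simp add: tens_of_int_divide mult_frac_tensor algebra_simps)
  finally show ?thesis by simp
qed

lemma tens_one: "tens 1 1 = 1"
  by (simp add: tens_def one_frac_tensor)

theorem tens_universal:
  fixes \<phi> :: "'a::{comm_ring_1,ring_char_0} \<Rightarrow> rat \<Rightarrow> 'b::ab_group_add"
  assumes left: "\<And>r s q. \<phi> (r + s) q = \<phi> r q + \<phi> s q"
    and right: "\<And>r q q'. \<phi> r (q + q') = \<phi> r q + \<phi> r q'"
  shows "\<exists>!h. (\<forall>x y. h (x + y) = h x + h y) \<and> (\<forall>r q. h (tens r q) = \<phi> r q)"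
proof -
  have zero: "\<phi> 0 q = 0" "\<phi> r 0 = 0" for r q
    using left[of 0 0 q] right[of r 0 0] by simp_all
  have minus: "\<phi> (- r) q = - \<phi> r q" "\<phi> r (- q) = - \<phi> r q" for r q
    using left[of r "- r" q] right[of r q "- q"] by (simp_all add: zero eq_neg_iff_add_eq_0 add.commute)
  have nat: "\<phi> (r * of_nat k) q = \<phi> r (of_nat k * q)" for r k q
    by (induction k) (simp_all add: distrib_left distrib_right left right zero)
  have int: "\<phi> (r * of_int k) q = \<phi> r (of_int k * q)" for r k q
  proof (cases k rule: int_cases2)
    case (nonneg n) then show ?thesis using nat[of r n q] by simp
  next
    case (nonpos n) then show ?thesis using nat[of r n q] by (simp add: minus)
  qed
  have resp: "\<phi> r (1 / of_int m) = \<phi> s (1 / of_int n)"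
    if nz: "m \<noteq> 0" "n \<noteq> 0" and eq: "frac_tensor r m = frac_tensor s n" for r s m n
  proof -
    obtain k where k: "k \<noteq> 0" "of_int k * (r * of_int n) = of_int k * (s * of_int m)"
      using eq unfolding eq_frac_tensor[OF nz] by (elim exE conjE)
    have "\<phi> r (1 / of_int m) = \<phi> r (of_int (k * n) * (1 / of_int (k * m * n)))"
      using nz k(1) by simp
    also have "\<dots> = \<phi> (of_int k * (r * of_int n)) (1 / of_int (k * m * n))"
      by (subst int[symmetric]) (simp add: ac_simps)
    also have "\<dots> = \<phi> (s * of_int (k * m)) (1 / of_int (k * m * n))"
      unfolding k(2) by (simp add: ac_simps)
    also have "\<dots> = \<phi> s (1 / of_int n)"
      unfolding int using nz k(1) by simp
    finally show ?thesis .
  qed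
  define h where "h x = (THE y. \<exists>r m. m \<noteq> 0 \<and> x = frac_tensor r m \<and> y = \<phi> r (1 / of_int m))" for x
  have h: "h (frac_tensor r m) = \<phi> r (1 / of_int m)" if "m \<noteq> 0" for r m
    unfolding h_def using that by (intro the_equality) (blast, metis resp)
  have ht: "h (tens r q) = \<phi> r q" for r q
  proof -
    obtain a m where q: "q = of_int a / of_int m" "m \<noteq> 0" by (rule rat_as_fraction)
    show ?thesis unfolding q(1) tens_of_int_divide[OF q(2)] h[OF q(2)] int by simp
  qed
  have ha: "h (x + y) = h x + h y" for x y
  proof (cases x)
    case x: (1 r m)
    show ?thesis
    proof (cases y)
      case y: (1 s n)
      have "x + y = frac_tensor (r * of_int n + s * of_int m) (m * n)"
        using x y by (simp add: add_frac_tensor)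
      then have "h (x + y) = \<phi> (r * of_int n + s * of_int m) (1 / of_int (m * n))"
        using x y h by simp
      also have "\<dots> = \<phi> r (1 / of_int m) + \<phi> s (1 / of_int n)"
        unfolding left int using x y by simp
      also have "\<dots> = h x + h y" using x y h by simp
      finally show ?thesis .
    qed
  qed
  show ?thesis
  proof (rule ex1I[of _ h])
    show "(\<forall>x y. h (x + y) = h x + h y) \<and> (\<forall>r q. h (tens r q) = \<phi> r q)"
      using ha ht by blast
    fix g assume g: "(\<forall>x y. g (x + y) = g x + g y) \<and> (\<forall>r q. g (tens r q) = \<phi> r q)"
    show "g = h"
    proof
      fix x show "g x = h x"
        by (cases x) (use g ht frac_tensor_eq_tens in metis)
    qed
  qed
qed

text \<open>
  The subring \<open>R \<otimes> \<int>\<^sub>(\<^sub>p\<^sub>)\<close> of \<open>R \<otimes> \<rat>\<close>. By \<open>localized_at_closed\<close> it is not necessary to pass to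
  the additive span of the pure tensors.
\<close>

definition rat_localized_at :: "nat \<Rightarrow> rat set" where
  "rat_localized_at p = {q. \<not> int p dvd snd (quotient_of q)}"

definition localized_at :: "nat \<Rightarrow> 'a::{comm_ring_1,ring_char_0} tensor_rat set" where
  "localized_at p = {tens r q | r q. q \<in> rat_localized_at p}"

lemma localized_at_iff:
  assumes "prime p"
  shows "x \<in> localized_at p \<longleftrightarrow> (\<exists>r m. \<not> int p dvd m \<and> x = frac_tensor r m)"
proof
  assume "x \<in> localized_at p"
  then show "\<exists>r m. \<not> int p dvd m \<and> x = frac_tensor r m"
    by (auto simp: localized_at_def rat_localized_at_def tens_def)
next
  assume "\<exists>r m. \<not> int p dvd m \<and> x = frac_tensor r m"
  then obtain r m where m: "\<not> int p dvd m" "x = frac_tensor r m" by blast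
  then have m0: "m \<noteq> 0" by auto
  obtain b n where bn: "quotient_of (1 / of_int m) = (b, n)" by fastforce
  have n: "n > 0" using quotient_of_denom_pos[OF bn] .
  have "(1 / of_int m :: rat) = of_int b / of_int n"
    using quotient_of_div[OF bn] .
  then have "(of_int n :: rat) = of_int (b * m)"
    using m0 n by (simp add: field_simps)
  then have nbm: "n = b * m" by (simp only: of_int_eq_iff)
  have "coprime b n" using quotient_of_coprime[OF bn] .
  then have "is_unit b" using nbm by (metis coprime_mult_right_iff coprime_self)
  then have "\<not> int p dvd n" using m(1) nbm
    by (metis dvd_mult_unit_iff mult.commute)
  then have "1 / of_int m \<in> rat_localized_at p" using bn by (simp add: rat_localized_at_def)
  then show "x \<in> localized_at p"
    unfolding localized_at_def m(2) frac_tensor_eq_tens[OF m0] by blast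
qed

lemma localized_at_closed:
  assumes "prime p" "x \<in> localized_at p" "y \<in> localized_at p"
  shows "x + y \<in> localized_at p" "x * y \<in> localized_at p"
proof -
  obtain r m s n where *: "\<not> int p dvd m" "x = frac_tensor r m" "\<not> int p dvd n" "y = frac_tensor s n"
    using assms localized_at_iff by metis
  have "prime (int p)" using assms(1) by simp
  then have mn: "\<not> int p dvd m * n" using * by (simp add: prime_dvd_mult_iff)
  have "m \<noteq> 0" "n \<noteq> 0" using * by auto
  then show "x + y \<in> localized_at p" "x * y \<in> localized_at p"
    unfolding localized_at_iff[OF assms(1)] using * mn
    by (auto simp: add_frac_tensor mult_frac_tensor)
qed

section \<open>Formal power series in several variables\<close>

text \<open>
  Formal power series over \<open>'b\<close> in commuting variables indexed by \<open>'v\<close>; a monomial is a finitely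
  supported exponent function.
\<close>

typedef ('v, 'b) mfps = "UNIV :: (('v \<Rightarrow>\<^sub>0 nat) \<Rightarrow> 'b) set"
  morphisms mfps_coeff Abs_mfps ..

setup_lifting type_definition_mfps

lemma mfps_eqI: "(\<And>\<alpha>. mfps_coeff F \<alpha> = mfps_coeff G \<alpha>) \<Longrightarrow> F = G"
  by transfer auto

lemma finite_monomial_factors: "finite {(\<beta>, \<gamma>). \<beta> + \<gamma> = (\<alpha> :: 'v \<Rightarrow>\<^sub>0 nat)}"
proof -
  let ?B = "{b. \<exists>c. b + c = \<alpha>}"
  let ?M = "insert 0 (Poly_Mapping.lookup \<alpha> ` Poly_Mapping.keys \<alpha>)"
  have "Poly_Mapping.lookup ` ?B \<subseteq>
    {f. \<forall>x. (x \<in> Poly_Mapping.keys \<alpha> \<longrightarrow> f x \<in> {..Max ?M}) \<and> (x \<notin> Poly_Mapping.keys \<alpha> \<longrightarrow> f x = 0)}"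
  proof safe
    fix b c x assume \<alpha>: "\<alpha> = b + c" and x: "x \<in> Poly_Mapping.keys (b + c)"
    have "Poly_Mapping.lookup b x \<le> Poly_Mapping.lookup (b + c) x" by (simp add: lookup_add)
    also have "\<dots> \<le> Max (insert 0 (Poly_Mapping.lookup (b + c) ` Poly_Mapping.keys (b + c)))"
      using x by (intro Max_ge) auto
    finally show "Poly_Mapping.lookup b x \<le>
      Max (insert 0 (Poly_Mapping.lookup (b + c) ` Poly_Mapping.keys (b + c)))" .
  next
    fix b c :: "'v \<Rightarrow>\<^sub>0 nat" and x assume "x \<notin> Poly_Mapping.keys (b + c)"
    then have "Poly_Mapping.lookup b x + Poly_Mapping.lookup c x = 0"
      by (simp add: in_keys_iff lookup_add)
    then show "Poly_Mapping.lookup b x = 0" by simp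
  qed
  then have "finite (Poly_Mapping.lookup ` ?B)"
    by (rule finite_subset) (intro finite_set_of_finite_funs; simp)
  then have "finite ?B"
    by (rule finite_imageD) (auto intro: inj_onI poly_mapping_eqI)
  moreover have "?B = {c. \<exists>b. b + c = \<alpha>}" by (metis add.commute)
  ultimately have "finite (?B \<times> {c. \<exists>b. b + c = \<alpha>})" by simp
  then show ?thesis by (rule finite_subset[rotated]) auto
qed

instantiation mfps :: (type, comm_ring_1) comm_ring_1
begin

lift_definition zero_mfps :: "('a, 'b) mfps" is "\<lambda>_. 0" .
lift_definition one_mfps :: "('a, 'b) mfps" is "\<lambda>\<alpha>. if \<alpha> = 0 then 1 else 0" .
lift_definition plus_mfps :: "('a, 'b) mfps \<Rightarrow> ('a, 'b) mfps \<Rightarrow> ('a, 'b) mfps"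
  is "\<lambda>F G \<alpha>. F \<alpha> + G \<alpha>" .
lift_definition uminus_mfps :: "('a, 'b) mfps \<Rightarrow> ('a, 'b) mfps" is "\<lambda>F \<alpha>. - F \<alpha>" .
lift_definition minus_mfps :: "('a, 'b) mfps \<Rightarrow> ('a, 'b) mfps \<Rightarrow> ('a, 'b) mfps"
  is "\<lambda>F G \<alpha>. F \<alpha> - G \<alpha>" .
lift_definition times_mfps :: "('a, 'b) mfps \<Rightarrow> ('a, 'b) mfps \<Rightarrow> ('a, 'b) mfps"
  is "\<lambda>F G \<alpha>. \<Sum>(\<beta>, \<gamma>) | \<beta> + \<gamma> = \<alpha>. F \<beta> * G \<gamma>" .

instance
proof
  fix F G H :: "('a, 'b) mfps"
  show "F + G + H = F + (G + H)" by transfer (simp add: add.assoc)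
  show "F + G = G + F" by transfer (simp add: add.commute)
  show "0 + F = F" by transfer simp
  show "- F + F = 0" by transfer simp
  show "F - G = F + - G" by transfer simp
  show "F * G = G * F"
  proof (transfer, rule ext)
    fix F G :: "('a \<Rightarrow>\<^sub>0 nat) \<Rightarrow> 'b" and \<alpha>
    show "(\<Sum>(\<beta>, \<gamma>) | \<beta> + \<gamma> = \<alpha>. F \<beta> * G \<gamma>) = (\<Sum>(\<beta>, \<gamma>) | \<beta> + \<gamma> = \<alpha>. G \<beta> * F \<gamma>)"
      by (rule sum.reindex_bij_witness[of _ prod.swap prod.swap]) (auto simp: ac_simps)
  qed
  show "(F + G) * H = F * H + G * H"
    by transfer (auto simp: fun_eq_iff case_prod_unfold distrib_right sum.distrib)
  show "1 * F = F"
  proof (transfer, rule ext)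
    fix F :: "('a \<Rightarrow>\<^sub>0 nat) \<Rightarrow> 'b" and \<alpha>
    have "(\<Sum>(\<beta>, \<gamma>) | \<beta> + \<gamma> = \<alpha>. (if \<beta> = 0 then 1 else 0) * F \<gamma>) =
          (\<Sum>(\<beta>, \<gamma>) \<in> {(0 :: 'a \<Rightarrow>\<^sub>0 nat, \<alpha>)}. (if \<beta> = 0 then 1 else 0) * F \<gamma>)"
      by (rule sum.mono_neutral_right) (auto simp: finite_monomial_factors split: if_splits)
    then show "(\<Sum>(\<beta>, \<gamma>) | \<beta> + \<gamma> = \<alpha>. (if \<beta> = 0 then 1 else 0) * F \<gamma>) = F \<alpha>" by simp
  qed
  show "F * G * H = F * (G * H)"
  proof (transfer, rule ext)
    fix F G H :: "('a \<Rightarrow>\<^sub>0 nat) \<Rightarrow> 'b" and \<alpha>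
    let ?D = "\<lambda>\<alpha>. {(\<beta>, \<gamma>). \<beta> + \<gamma> = (\<alpha> :: 'a \<Rightarrow>\<^sub>0 nat)}"
    have "(\<Sum>(\<delta>, \<epsilon>) \<in> ?D \<alpha>. (\<Sum>(\<beta>, \<gamma>) \<in> ?D \<delta>. F \<beta> * G \<gamma>) * H \<epsilon>) =
      (\<Sum>z \<in> (SIGMA x : ?D \<alpha>. ?D (fst x)).
         F (fst (snd z)) * G (snd (snd z)) * H (snd (fst z)))"
      unfolding sum_distrib_right case_prod_unfold
      by (subst sum.Sigma) (auto simp: finite_monomial_factors[unfolded case_prod_unfold] split_beta)
    also have "\<dots> = (\<Sum>z \<in> (SIGMA x : ?D \<alpha>. ?D (snd x)).
         F (fst (fst z)) * (G (fst (snd z)) * H (snd (snd z))))"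
      by (rule sum.reindex_bij_witness[of _
          "\<lambda>((b, _), (g, h)). ((b + g, h), (b, g))" "\<lambda>((_, h), (b, g)). ((b, g + h), (g, h))"])
        (auto simp: ac_simps)
    also have "\<dots> = (\<Sum>(\<beta>, \<delta>) \<in> ?D \<alpha>. F \<beta> * (\<Sum>(\<gamma>, \<epsilon>) \<in> ?D \<delta>. G \<gamma> * H \<epsilon>))"
      unfolding sum_distrib_left case_prod_unfold
      by (subst sum.Sigma) (auto simp: finite_monomial_factors[unfolded case_prod_unfold] split_beta)
    finally show "(\<Sum>(\<delta>, \<epsilon>) \<in> ?D \<alpha>. (\<Sum>(\<beta>, \<gamma>) \<in> ?D \<delta>. F \<beta> * G \<gamma>) * H \<epsilon>) =
      (\<Sum>(\<beta>, \<delta>) \<in> ?D \<alpha>. F \<beta> * (\<Sum>(\<gamma>, \<epsilon>) \<in> ?D \<delta>. G \<gamma> * H \<epsilon>))" .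
  qed
  show "(0 :: ('a, 'b) mfps) \<noteq> 1"
    by transfer (auto simp: fun_eq_iff)
qed

end

lift_definition mfps_const :: "'b::zero \<Rightarrow> ('v, 'b) mfps" is "\<lambda>c \<alpha>. if \<alpha> = 0 then c else 0" .

lift_definition mfps_var :: "'v \<Rightarrow> ('v, 'b::zero_neq_one) mfps"
  is "\<lambda>v \<alpha>. if \<alpha> = Poly_Mapping.single v 1 then 1 else 0" .

text \<open>
  The sum of a possibly infinite family, meaningful whenever every monomial occurs in only finitely
  many members of the family.
\<close>

lift_definition mfps_sum :: "('k \<Rightarrow> ('v, 'b::comm_monoid_add) mfps) \<Rightarrow> 'k set \<Rightarrow> ('v, 'b) mfps"
  is "\<lambda>F K \<alpha>. \<Sum>k | k \<in> K \<and> F k \<alpha> \<noteq> 0. F k \<alpha>" .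

text \<open>
  Substitution of \<open>G v\<close> for the variable \<open>v\<close> in \<open>F\<close>, meaningful if \<open>F\<close> involves finitely many
  variables and the \<open>G v\<close> have zero constant term.
\<close>

definition mfps_subst ::
  "('v, 'b::comm_ring_1) mfps \<Rightarrow> ('v \<Rightarrow> ('w, 'b) mfps) \<Rightarrow> ('w, 'b) mfps" where
  "mfps_subst F G = mfps_sum
     (\<lambda>\<alpha>. mfps_const (mfps_coeff F \<alpha>) * (\<Prod>v\<in>Poly_Mapping.keys \<alpha>. G v ^ Poly_Mapping.lookup \<alpha> v)) UNIV"

text \<open>\<open>A[[\<tau>\<^sub>v : v \<in> V]]\<close> for a subset \<open>A\<close> of the coefficient ring.\<close>

definition mfps_over :: "'b::zero set \<Rightarrow> 'v set \<Rightarrow> ('v, 'b) mfps set" where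
  "mfps_over A V =
     {F. \<forall>\<alpha>. mfps_coeff F \<alpha> \<in> A \<and> (mfps_coeff F \<alpha> \<noteq> 0 \<longrightarrow> Poly_Mapping.keys \<alpha> \<subseteq> V)}"

text \<open>
  Tuples indexed by \<open>V\<close> of series in variables indexed by \<open>V\<close> without constant term; the components
  outside \<open>V\<close> are fixed to be \<open>0\<close>, so that a compositional inverse is unique as a function.
\<close>

definition mfps_tuples :: "'v set \<Rightarrow> ('v \<Rightarrow> ('v, 'b::comm_ring_1) mfps) set" where
  "mfps_tuples V = {h. (\<forall>v\<in>V. h v \<in> mfps_over UNIV V \<and> mfps_coeff (h v) 0 = 0) \<and>
     (\<forall>v. v \<notin> V \<longrightarrow> h v = 0)}"

definition comp_inverse ::
  "'v set \<Rightarrow> ('v \<Rightarrow> ('v, 'b::comm_ring_1) mfps) \<Rightarrow> 'v \<Rightarrow> ('v, 'b) mfps" where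
  "comp_inverse V l = (THE h. h \<in> mfps_tuples V \<and>
     (\<forall>v\<in>V. mfps_subst (l v) h = mfps_var v \<and> mfps_subst (h v) l = mfps_var v))"

text \<open>
  \<open>l\<^sup>-\<^sup>1(l(\<tau>) + l(\<tau>'))\<close>, where \<open>\<tau>\<^sub>v\<close> and \<open>\<tau>'\<^sub>v\<close> are the variables \<open>Inl v\<close> and \<open>Inr v\<close>.
\<close>

definition formal_group_of_log ::
  "'v set \<Rightarrow> ('v \<Rightarrow> ('v, 'b::comm_ring_1) mfps) \<Rightarrow> 'v \<Rightarrow> ('v + 'v, 'b) mfps" where
  "formal_group_of_log V l u = mfps_subst (comp_inverse V l u)
     (\<lambda>v. mfps_subst (l v) (\<lambda>w. mfps_var (Inl w)) + mfps_subst (l v) (\<lambda>w. mfps_var (Inr w)))"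

section \<open>Laurent polynomials and their formal groups\<close>

text \<open>The Laurent polynomial ring is the group ring of the lattice of exponent vectors.\<close>

type_synonym ('n, 'a) laurent_poly = "(int ^ 'n) \<Rightarrow>\<^sub>0 'a"

definition real_point :: "int ^ 'n \<Rightarrow> real ^ 'n" where
  "real_point u = (\<chi> i. of_int (u $ i))"

definition newton_polytope :: "('n::finite, 'a::zero) laurent_poly \<Rightarrow> (real ^ 'n) set" where
  "newton_polytope f = convex hull (real_point ` {u. Poly_Mapping.lookup f u \<noteq> 0})"

definition integral_points :: "(real ^ 'n) set \<Rightarrow> (int ^ 'n) set" where
  "integral_points S = {u. real_point u \<in> S}"

definition beta ::
  "('n::finite, 'a::comm_ring_1) laurent_poly \<Rightarrow> nat \<Rightarrow> int ^ 'n \<Rightarrow> int ^ 'n \<Rightarrow> 'a" where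
  "beta f m u v = Poly_Mapping.lookup (f ^ (m - 1)) (int m *s v - u)"

definition laurent_log ::
  "('n::finite, 'a::{comm_ring_1,ring_char_0}) laurent_poly \<Rightarrow> (int ^ 'n) set \<Rightarrow>
     int ^ 'n \<Rightarrow> (int ^ 'n, 'a tensor_rat) mfps" where
  "laurent_log f J u =
     mfps_sum (\<lambda>m. \<Sum>v\<in>J. mfps_const (tens (beta f m u v) (1 / of_nat m)) * mfps_var v ^ m) {1..}"

definition laurent_formal_group ::
  "('n::finite, 'a::{comm_ring_1,ring_char_0}) laurent_poly \<Rightarrow> (int ^ 'n) set \<Rightarrow>
     int ^ 'n \<Rightarrow> (int ^ 'n + int ^ 'n, 'a tensor_rat) mfps" where
  "laurent_formal_group f J = formal_group_of_log J (laurent_log f J)"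

definition frobenius_endomorphism :: "nat \<Rightarrow> ('a::comm_ring_1 \<Rightarrow> 'a) \<Rightarrow> bool" where
  "frobenius_endomorphism p \<sigma> \<longleftrightarrow>
     \<sigma> 1 = 1 \<and> (\<forall>r s. \<sigma> (r + s) = \<sigma> r + \<sigma> s) \<and> (\<forall>r s. \<sigma> (r * s) = \<sigma> r * \<sigma> s) \<and>
     (\<forall>r. of_nat p dvd \<sigma> r - r ^ p)"

end

theory Submission
  imports Defs
begin

text \<open>
  Let \<open>\<Phi>\<close> be the lift of \<open>\<sigma>\<close> to Laurent polynomials with \<open>x \<mapsto> x\<^sup>p\<close>, and define \<open>V\<^sub>1, V\<^sub>2, \<dots>\<close>
  recursively by \<open>f\<^bsup>p^s - 1\<^esup> = \<Sum>\<^bsub>1 \<le> i \<le> s\<^esub> V\<^sub>i \<Phi>\<^sup>i(f\<^bsup>p^(s-i) - 1\<^esup>)\<close>. Since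
  \<open>g\<^bsup>p^s\<^esup> \<equiv> \<Phi>\<^sup>i(g\<^bsup>p^(s-i)\<^esup>)\<close> modulo \<open>p\<^bsup>s-i+1\<^esup>\<close>, induction on \<open>s\<close> shows that \<open>p\<^bsup>i-1\<^esup>\<close> divides \<open>V\<^sub>i\<close>
  and that \<open>f\<^bsup>mp^s - 1\<^esup> \<equiv> \<Sum> V\<^sub>i \<Phi>\<^sup>i(f\<^bsup>mp^(s-i) - 1\<^esup>)\<close> modulo \<open>p\<^sup>s\<close>. As \<open>V\<^sub>i\<close> is supported in
  \<open>(p\<^sup>i - 1)\<Delta>(f)\<close>, comparing coefficients gives matrices \<open>\<gamma>\<^sub>i\<close> indexed by \<open>J\<close>, divisible by \<open>p\<^bsup>i-1\<^esup>\<close>,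
  with \<open>\<beta>\<^bsub>mp^s\<^esub> \<equiv> \<Sum> \<gamma>\<^sub>i \<sigma>\<^sup>i(\<beta>\<^bsub>mp^(s-i)\<^esub>)\<close> modulo \<open>p\<^sup>s\<close>. These congruences are a functional equation
  for the logarithm \<open>l\<close>, and as in Hazewinkel's functional equation lemma the coefficients of \<open>G\<^sub>f\<close> are
  then seen to be \<open>p\<close>-integral by induction on the degree.
\<close>

section \<open>Congruences modulo powers of a prime in a subring\<close>

text \<open>Two points carry the proof. First, the matrices stay indexed by J because of convexity:
  if \<open>V\<^sub>i\<close> has a nonzero coefficient at p^i w - u with u in J, then w is p^-i u
  plus (1 - p^-i) times a point of \<Delta>(f); the positive weight on u keeps w in the interior in
  the second case. Second, the powers of p balance exactly: p^-i times
  \<open>\<gamma>\<^sub>i\<close> may keep one factor p in the denominator, and it is always paid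
  for by the difference between H^(p^i) and the Frobenius lift of H, which is divisible by p for
  integral H. The obstacle is that the integrality of the group law is itself the claim. It is met
  by taking for H the truncation of the law below degree n, integral by induction: l(\<tau>) +
  l(\<tau>') - l(H) starts in degree n, its Frobenius lifts start above n, and its degree n part is
  that of the group law.\<close>

definition pow_multiples :: "nat \<Rightarrow> 'a::comm_ring_1 set \<Rightarrow> nat \<Rightarrow> 'a set" where
  "pow_multiples p S r = {of_nat p ^ r * s | s. s \<in> S}"

text \<open>A subset \<open>S\<close> of a ring rather than a type, because the target is R_(p)
  inside R tensor Q: there p is a unit, and divisibility by p^r has content only relative to
  \<open>S\<close>. With \<open>S = UNIV\<close> ordinary divisibility is recovered.\<close>

locale subring_set =
  fixes S :: "'a::comm_ring_1 set"
  assumes one_closed [simp]: "1 \<in> S"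
    and diff_closed: "x \<in> S \<Longrightarrow> y \<in> S \<Longrightarrow> x - y \<in> S"
    and mult_closed: "x \<in> S \<Longrightarrow> y \<in> S \<Longrightarrow> x * y \<in> S"
begin

lemma zero_closed [simp]: "0 \<in> S"
  using diff_closed[of 1 1] by simp

lemma uminus_closed: "x \<in> S \<Longrightarrow> - x \<in> S"
  using diff_closed[of 0 x] by simp

lemma add_closed: "x \<in> S \<Longrightarrow> y \<in> S \<Longrightarrow> x + y \<in> S"
  using diff_closed[of x "- y"] by (simp add: uminus_closed)

lemma sum_closed: "(\<And>i. i \<in> I \<Longrightarrow> g i \<in> S) \<Longrightarrow> sum g I \<in> S"
  by (induction I rule: infinite_finite_induct) (auto intro: add_closed)

lemma power_closed: "x \<in> S \<Longrightarrow> x ^ n \<in> S"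
  by (induction n) (auto intro: mult_closed)

lemma of_nat_closed: "of_nat n \<in> S"
  by (induction n) (auto intro: add_closed)

lemma pow_multiplesI: "s \<in> S \<Longrightarrow> x = of_nat p ^ r * s \<Longrightarrow> x \<in> pow_multiples p S r"
  by (auto simp: pow_multiples_def)

lemma pow_multiples_0: "pow_multiples p S 0 = S"
  by (auto simp: pow_multiples_def)

lemma pow_multiples_zero [simp]: "0 \<in> pow_multiples p S r"
  by (rule pow_multiplesI[of 0]) auto

lemma pow_multiples_add:
  "x \<in> pow_multiples p S r \<Longrightarrow> y \<in> pow_multiples p S r \<Longrightarrow> x + y \<in> pow_multiples p S r"
  by (auto simp: pow_multiples_def simp flip: distrib_left intro: add_closed)

lemma pow_multiples_diff:
  "x \<in> pow_multiples p S r \<Longrightarrow> y \<in> pow_multiples p S r \<Longrightarrow> x - y \<in> pow_multiples p S r"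
  by (auto simp: pow_multiples_def simp flip: right_diff_distrib intro: diff_closed)

lemma pow_multiples_sum:
  "(\<And>i. i \<in> I \<Longrightarrow> g i \<in> pow_multiples p S r) \<Longrightarrow> sum g I \<in> pow_multiples p S r"
  by (induction I rule: infinite_finite_induct) (auto intro: pow_multiples_add)

lemma pow_multiples_mult:
  assumes "x \<in> pow_multiples p S r" "y \<in> pow_multiples p S t"
  shows "x * y \<in> pow_multiples p S (r + t)"
proof -
  obtain a b where "a \<in> S" "b \<in> S" "x = of_nat p ^ r * a" "y = of_nat p ^ t * b"
    using assms by (auto simp: pow_multiples_def)
  then show ?thesis
    by (intro pow_multiplesI[of "a * b"]) (auto simp: power_add mult_closed ac_simps)
qed

lemma pow_multiples_mult_left: "x \<in> S \<Longrightarrow> y \<in> pow_multiples p S t \<Longrightarrow> x * y \<in> pow_multiples p S t"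
  using pow_multiples_mult[of x p 0 y t] by (simp add: pow_multiples_0)

lemma pow_multiples_mult_right: "x \<in> pow_multiples p S t \<Longrightarrow> y \<in> S \<Longrightarrow> x * y \<in> pow_multiples p S t"
  using pow_multiples_mult_left[of y x] by (simp add: mult.commute)

lemma pow_multiples_antimono:
  assumes "x \<in> pow_multiples p S r" "t \<le> r"
  shows "x \<in> pow_multiples p S t"
proof -
  obtain a where "a \<in> S" "x = of_nat p ^ r * a"
    using assms by (auto simp: pow_multiples_def)
  moreover have "of_nat p ^ r = (of_nat p ^ t * of_nat p ^ (r - t) :: 'a)"
    using assms(2) by (simp flip: power_add)
  ultimately show ?thesis
    by (intro pow_multiplesI[of "of_nat p ^ (r - t) * a"])
      (auto simp: mult_closed power_closed of_nat_closed ac_simps)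
qed

section \<open>Congruences under powers\<close>

lemma pow_multiples_power_cong:
  assumes "x - y \<in> pow_multiples p S r" "x \<in> S" "y \<in> S"
  shows "x ^ k - y ^ k \<in> pow_multiples p S r"
  unfolding power_diff_sumr2
  by (intro pow_multiples_mult_right assms sum_closed mult_closed power_closed)

text \<open>The cofactor of x - y in x^p - y^p is congruent to p y^(p-1) modulo p, hence divisible
  by p. The condition \<open>1 \<le> r\<close> makes x and y congruent modulo p in the first
  place.\<close>

lemma pow_multiples_power_prime_cong:
  assumes xy: "x - y \<in> pow_multiples p S r" "x \<in> S" "y \<in> S" and r: "1 \<le> r"
  shows "x ^ p - y ^ p \<in> pow_multiples p S (r + 1)"
proof -
  have "(\<Sum>i<p. y ^ (p - Suc i) * x ^ i) =
      (\<Sum>i<p. y ^ (p - Suc i) * (x ^ i - y ^ i)) + (\<Sum>i<p. y ^ (p - Suc i) * y ^ i)"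
    by (simp add: algebra_simps flip: sum.distrib)
  also have "(\<Sum>i<p. y ^ (p - Suc i) * y ^ i) = (\<Sum>i<p. y ^ (p - 1))"
    by (intro sum.cong) (auto simp flip: power_add)
  also have "(\<Sum>i<p. y ^ (p - 1)) = of_nat p ^ 1 * y ^ (p - 1)"
    by simp
  finally have "(\<Sum>i<p. y ^ (p - Suc i) * x ^ i) =
      (\<Sum>i<p. y ^ (p - Suc i) * (x ^ i - y ^ i)) + of_nat p ^ 1 * y ^ (p - 1)" .
  moreover have "x - y \<in> pow_multiples p S 1"
    using xy r by (blast intro: pow_multiples_antimono)
  moreover have "of_nat p ^ 1 * y ^ (p - 1) \<in> pow_multiples p S 1"
    using xy by (intro pow_multiplesI[OF _ refl] power_closed)
  ultimately have "(\<Sum>i<p. y ^ (p - Suc i) * x ^ i) \<in> pow_multiples p S 1"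
    using xy by (simp only:) (rule pow_multiples_add,
      intro pow_multiples_sum pow_multiples_mult_left pow_multiples_power_cong power_closed)
  then show ?thesis
    unfolding power_diff_sumr2 by (intro pow_multiples_mult xy)
qed

lemma pow_multiples_power_prime_power_cong:
  assumes xy: "x - y \<in> pow_multiples p S r" "x \<in> S" "y \<in> S" and r: "1 \<le> r"
  shows "x ^ (p ^ t) - y ^ (p ^ t) \<in> pow_multiples p S (r + t)"
proof (induction t)
  case 0
  then show ?case using xy by simp
next
  case (Suc t)
  have "(x ^ p ^ t) ^ p - (y ^ p ^ t) ^ p \<in> pow_multiples p S ((r + t) + 1)"
    using Suc xy r by (intro pow_multiples_power_prime_cong power_closed) auto
  then show ?case by (simp add: mult.commute flip: power_mult)
qed

text \<open>Each factor p of the exponent gains one power of p. It is applied later with p^t the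
  exact p-part of k, where the gain cancels the denominator of 1/k.\<close>

lemma pow_multiples_power_dvd_cong:
  assumes xy: "x - y \<in> pow_multiples p S r" "x \<in> S" "y \<in> S" and r: "1 \<le> r" and "p ^ t dvd k"
  shows "x ^ k - y ^ k \<in> pow_multiples p S (r + t)"
proof -
  obtain c where "k = p ^ t * c" using assms(5) by (elim dvdE)
  moreover have "(x ^ p ^ t) ^ c - (y ^ p ^ t) ^ c \<in> pow_multiples p S (r + t)"
    using xy r by (intro pow_multiples_power_cong pow_multiples_power_prime_power_cong power_closed)
  ultimately show ?thesis by (simp flip: power_mult)
qed

section \<open>Powers of sums and Frobenius congruences modulo p\<close>

lemma prime_power_add_cong:
  assumes "prime p" "x \<in> S" "y \<in> S"
  shows "(x + y) ^ p - (x ^ p + y ^ p) \<in> pow_multiples p S 1"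
proof -
  let ?g = "\<lambda>k. of_nat (p choose k) * x ^ k * y ^ (p - k)"
  have p: "0 < p" using assms(1) by (simp add: prime_gt_0_nat)
  have "(x + y) ^ p = (\<Sum>k\<in>{0, p} \<union> {1..<p}. ?g k)"
    unfolding binomial_ring using p by (intro sum.cong) auto
  also have "\<dots> = (\<Sum>k\<in>{0, p}. ?g k) + (\<Sum>k\<in>{1..<p}. ?g k)"
    by (intro sum.union_disjoint) auto
  also have "(\<Sum>k\<in>{0, p}. ?g k) = x ^ p + y ^ p"
    using p by simp
  finally have "(x + y) ^ p - (x ^ p + y ^ p) = (\<Sum>k\<in>{1..<p}. ?g k)"
    by simp
  also have "\<dots> \<in> pow_multiples p S 1"
  proof (intro pow_multiples_sum)
    fix k assume "k \<in> {1..<p}"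
    then have "p dvd p choose k" using assms(1) by (intro dvd_choose_prime) auto
    then obtain c where c: "p choose k = p * c" by (elim dvdE)
    show "?g k \<in> pow_multiples p S 1"
      by (rule pow_multiplesI[of "of_nat c * x ^ k * y ^ (p - k)"])
        (auto simp: c assms mult_closed power_closed of_nat_closed)
  qed
  finally show ?thesis .
qed

lemma prime_power_sum_cong:
  assumes "prime p" "finite I" "\<And>i. i \<in> I \<Longrightarrow> g i \<in> S"
  shows "(\<Sum>i\<in>I. g i) ^ p - (\<Sum>i\<in>I. g i ^ p) \<in> pow_multiples p S 1"
  using assms(2,3)
proof (induction I)
  case empty
  then show ?case using prime_gt_0_nat[OF assms(1)] by (simp add: power_0_left)
next
  case (insert j I)
  have "(g j + sum g I) ^ p - (g j ^ p + sum g I ^ p) \<in> pow_multiples p S 1"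
    using insert by (intro prime_power_add_cong assms(1) sum_closed) auto
  moreover have "sum g I ^ p - (\<Sum>i\<in>I. g i ^ p) \<in> pow_multiples p S 1"
    using insert by auto
  ultimately have "(g j + sum g I) ^ p - (g j ^ p + sum g I ^ p) +
      (sum g I ^ p - (\<Sum>i\<in>I. g i ^ p)) \<in> pow_multiples p S 1"
    by (rule pow_multiples_add)
  then show ?case using insert by (simp add: algebra_simps)
qed

lemma prime_power_power_sum_cong:
  assumes "prime p" "finite I" "\<And>i. i \<in> I \<Longrightarrow> g i \<in> S"
  shows "(\<Sum>i\<in>I. g i) ^ (p ^ t) - (\<Sum>i\<in>I. g i ^ (p ^ t)) \<in> pow_multiples p S 1"
proof (induction t)
  case 0
  then show ?case by simp
next
  case (Suc t)
  let ?a = "(\<Sum>i\<in>I. g i) ^ (p ^ t)" and ?b = "\<Sum>i\<in>I. g i ^ (p ^ t)"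
  have "?a ^ p - ?b ^ p \<in> pow_multiples p S 1"
    using Suc assms by (intro pow_multiples_power_cong power_closed sum_closed) auto
  moreover have "?b ^ p - (\<Sum>i\<in>I. (g i ^ (p ^ t)) ^ p) \<in> pow_multiples p S 1"
    using assms by (intro prime_power_sum_cong power_closed) auto
  ultimately have "?a ^ p - ?b ^ p + (?b ^ p - (\<Sum>i\<in>I. (g i ^ (p ^ t)) ^ p)) \<in> pow_multiples p S 1"
    by (rule pow_multiples_add)
  then show ?case by (simp add: mult.commute flip: power_mult)
qed

lemma frobenius_funpow_cong:
  assumes "\<And>x. x \<in> S \<Longrightarrow> \<sigma> x \<in> S" "\<And>x. x \<in> S \<Longrightarrow> \<sigma> x - x ^ p \<in> pow_multiples p S 1" "x \<in> S"
  shows "(\<sigma> ^^ t) x \<in> S \<and> x ^ (p ^ t) - (\<sigma> ^^ t) x \<in> pow_multiples p S 1"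
proof (induction t)
  case 0
  then show ?case using assms(3) by simp
next
  case (Suc t)
  let ?y = "(\<sigma> ^^ t) x"
  have "(x ^ p ^ t) ^ p - ?y ^ p \<in> pow_multiples p S 1"
    using Suc assms(3) by (intro pow_multiples_power_cong power_closed) auto
  moreover have "\<sigma> ?y - ?y ^ p \<in> pow_multiples p S 1"
    using Suc assms(2) by auto
  ultimately have "(x ^ p ^ t) ^ p - ?y ^ p - (\<sigma> ?y - ?y ^ p) \<in> pow_multiples p S 1"
    by (rule pow_multiples_diff)
  then show ?case using Suc assms(1) by (simp add: mult.commute flip: power_mult)
qed

end

lemma subring_set_UNIV: "subring_set UNIV"
  by unfold_locales auto

lemma pow_multiples_UNIV: "x \<in> pow_multiples p UNIV r \<longleftrightarrow> of_nat p ^ r dvd x"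
  by (auto simp: pow_multiples_def dvd_def)

section \<open>Monomials and the order filtration\<close>

definition monom_deg :: "('v \<Rightarrow>\<^sub>0 nat) \<Rightarrow> nat" where
  "monom_deg \<alpha> = (\<Sum>v\<in>Poly_Mapping.keys \<alpha>. Poly_Mapping.lookup \<alpha> v)"

lemma monom_deg_superset:
  assumes "finite V" "Poly_Mapping.keys \<alpha> \<subseteq> V"
  shows "monom_deg \<alpha> = (\<Sum>v\<in>V. Poly_Mapping.lookup \<alpha> v)"
  unfolding monom_deg_def using assms
  by (intro sum.mono_neutral_left) (auto simp: in_keys_iff)

lemma keys_add_nat:
  "Poly_Mapping.keys (\<alpha> + \<beta> :: 'v \<Rightarrow>\<^sub>0 nat) = Poly_Mapping.keys \<alpha> \<union> Poly_Mapping.keys \<beta>"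
  by (auto simp: in_keys_iff lookup_add)

lemma monom_deg_add: "monom_deg (\<alpha> + \<beta>) = monom_deg \<alpha> + monom_deg \<beta>"
proof -
  let ?V = "Poly_Mapping.keys \<alpha> \<union> Poly_Mapping.keys \<beta>"
  show ?thesis
    using monom_deg_superset[of ?V \<alpha>] monom_deg_superset[of ?V \<beta>] monom_deg_superset[of ?V "\<alpha> + \<beta>"]
    by (simp add: keys_add_nat lookup_add sum.distrib)
qed

lemma monom_deg_0 [simp]: "monom_deg 0 = 0"
  by (simp add: monom_deg_def)

lemma monom_deg_single [simp]: "monom_deg (Poly_Mapping.single v k) = k"
  by (simp add: monom_deg_def)

lemma lookup_le_monom_deg: "Poly_Mapping.lookup \<alpha> v \<le> monom_deg \<alpha>"
proof (cases "v \<in> Poly_Mapping.keys \<alpha>")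
  case True
  then show ?thesis unfolding monom_deg_def by (intro member_le_sum) auto
qed (simp add: in_keys_iff)

lemma monom_deg_eq_0_iff: "monom_deg \<alpha> = 0 \<longleftrightarrow> \<alpha> = 0"
proof
  assume "monom_deg \<alpha> = 0"
  then have "Poly_Mapping.lookup \<alpha> v = 0" for v
    using lookup_le_monom_deg[of \<alpha> v] by simp
  then show "\<alpha> = 0" by (intro poly_mapping_eqI) simp
qed simp

lemma exists_single_add:
  assumes "v \<in> Poly_Mapping.keys (\<alpha> :: 'v \<Rightarrow>\<^sub>0 nat)"
  obtains \<beta> where "\<alpha> = Poly_Mapping.single v 1 + \<beta>"
proof
  show "\<alpha> = Poly_Mapping.single v 1 + (\<alpha> - Poly_Mapping.single v 1)"
    using assms by (intro poly_mapping_eqI)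
      (auto simp: lookup_add lookup_minus lookup_single in_keys_iff when_def)
qed

text \<open>Finite index sets that replace all exponents when a coefficient of a substitution is
  computed.\<close>

definition monoms_upto :: "'v set \<Rightarrow> nat \<Rightarrow> ('v \<Rightarrow>\<^sub>0 nat) set" where
  "monoms_upto V N = {\<alpha>. Poly_Mapping.keys \<alpha> \<subseteq> V \<and> monom_deg \<alpha> \<le> N}"

lemma finite_monoms_upto:
  assumes "finite V"
  shows "finite (monoms_upto V N)"
proof -
  have "Poly_Mapping.lookup ` monoms_upto V N \<subseteq>
      {f. \<forall>x. (x \<in> V \<longrightarrow> f x \<in> {..N}) \<and> (x \<notin> V \<longrightarrow> f x = 0)}"
    by (auto simp: monoms_upto_def in_keys_iff intro: order.trans[OF lookup_le_monom_deg])
  then have "finite (Poly_Mapping.lookup ` monoms_upto V N)"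
    by (rule finite_subset) (intro finite_set_of_finite_funs; simp add: assms)
  then show ?thesis
    by (rule finite_imageD) (auto intro: inj_onI poly_mapping_eqI)
qed

section \<open>Coefficients of the basic operations\<close>

lemma mfps_coeff_simps [simp]:
  "mfps_coeff 0 \<alpha> = 0"
  "mfps_coeff (F + G) \<alpha> = mfps_coeff F \<alpha> + mfps_coeff G \<alpha>"
  "mfps_coeff (F - G) \<alpha> = mfps_coeff F \<alpha> - mfps_coeff G \<alpha>"
  "mfps_coeff (- F) \<alpha> = - mfps_coeff F \<alpha>"
  by (simp_all add: zero_mfps.rep_eq plus_mfps.rep_eq minus_mfps.rep_eq uminus_mfps.rep_eq)

lemma mfps_coeff_one: "mfps_coeff 1 \<alpha> = (if \<alpha> = 0 then 1 else 0)"
  by (simp add: one_mfps.rep_eq)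

lemma mfps_coeff_const: "mfps_coeff (mfps_const c) \<alpha> = (if \<alpha> = 0 then c else 0)"
  by (simp add: mfps_const.rep_eq)

lemma mfps_coeff_var: "mfps_coeff (mfps_var v) \<alpha> = (if \<alpha> = Poly_Mapping.single v 1 then 1 else 0)"
  by (simp add: mfps_var.rep_eq)

lemma mfps_coeff_mult:
  "mfps_coeff (F * G) \<alpha> = (\<Sum>(\<beta>, \<gamma>) | \<beta> + \<gamma> = \<alpha>. mfps_coeff F \<beta> * mfps_coeff G \<gamma>)"
  by (simp add: times_mfps.rep_eq)

lemma mfps_coeff_sum [simp]: "mfps_coeff (sum F I) \<alpha> = (\<Sum>i\<in>I. mfps_coeff (F i) \<alpha>)"
  by (induction I rule: infinite_finite_induct) auto

lemma mfps_coeff_Abs [simp]: "mfps_coeff (Abs_mfps g) = g"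
  by (simp add: Abs_mfps_inverse)

lemma mfps_coeff_const_mult [simp]:
  fixes F :: "('a, 'b::comm_ring_1) mfps"
  shows "mfps_coeff (mfps_const c * F) \<alpha> = c * mfps_coeff F \<alpha>"
proof -
  have "(\<Sum>(\<beta>, \<gamma>) | \<beta> + \<gamma> = \<alpha>. mfps_coeff (mfps_const c) \<beta> * mfps_coeff F \<gamma>) =
        (\<Sum>(\<beta>, \<gamma>) \<in> {(0 :: 'a \<Rightarrow>\<^sub>0 nat, \<alpha>)}. mfps_coeff (mfps_const c) \<beta> * mfps_coeff F \<gamma>)"
    by (rule sum.mono_neutral_right)
      (auto simp: finite_monomial_factors mfps_coeff_const split: if_splits)
  then show ?thesis by (simp add: mfps_coeff_mult mfps_coeff_const)
qed

lemma mfps_const_add: "mfps_const (a + b) = mfps_const a + mfps_const (b :: 'b::comm_ring_1)"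
  by (rule mfps_eqI) (simp add: mfps_coeff_const)

lemma mfps_const_mult: "mfps_const (a * b) = mfps_const a * mfps_const (b :: 'b::comm_ring_1)"
  by (rule mfps_eqI) (simp add: mfps_coeff_const)

lemma mfps_const_0 [simp]: "mfps_const 0 = 0"
  by (rule mfps_eqI) (simp add: mfps_coeff_const)

lemma mfps_const_1 [simp]: "mfps_const 1 = 1"
  by (rule mfps_eqI) (simp add: mfps_coeff_const mfps_coeff_one)

lemma mfps_const_sum: "mfps_const (sum g I) = (\<Sum>i\<in>I. mfps_const (g i :: 'b::comm_ring_1))"
  by (induction I rule: infinite_finite_induct) (auto simp: mfps_const_add)

lemma mfps_const_of_nat: "mfps_const (of_nat n) = (of_nat n :: ('v, 'b::comm_ring_1) mfps)"
  by (induction n) (auto simp: mfps_const_add)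

lemma mfps_const_power: "mfps_const (a ^ n) = mfps_const (a :: 'b::comm_ring_1) ^ n"
  by (induction n) (auto simp: mfps_const_mult)

section \<open>The filtration of power series by order\<close>

definition mfps_ord :: "nat \<Rightarrow> ('v, 'b::zero) mfps set" where
  "mfps_ord n = {F. \<forall>\<alpha>. monom_deg \<alpha> < n \<longrightarrow> mfps_coeff F \<alpha> = 0}"

lemma mfps_ordI: "(\<And>\<alpha>. monom_deg \<alpha> < n \<Longrightarrow> mfps_coeff F \<alpha> = 0) \<Longrightarrow> F \<in> mfps_ord n"
  by (simp add: mfps_ord_def)

lemma mfps_ordD: "F \<in> mfps_ord n \<Longrightarrow> monom_deg \<alpha> < n \<Longrightarrow> mfps_coeff F \<alpha> = 0"
  by (simp add: mfps_ord_def)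

lemma mfps_ord_antimono: "F \<in> mfps_ord n \<Longrightarrow> m \<le> n \<Longrightarrow> F \<in> mfps_ord m"
  by (auto simp: mfps_ord_def)

lemma mfps_ord_0 [simp]: "F \<in> mfps_ord 0"
  by (simp add: mfps_ord_def)

lemma mfps_ord_1_iff: "F \<in> mfps_ord 1 \<longleftrightarrow> mfps_coeff F 0 = 0"
  by (auto simp: mfps_ord_def monom_deg_eq_0_iff)

lemma
  fixes F G :: "('v, 'b::comm_ring_1) mfps"
  shows mfps_ord_zero: "0 \<in> (mfps_ord n :: ('v, 'b::comm_ring_1) mfps set)"
    and mfps_ord_add: "F \<in> mfps_ord n \<Longrightarrow> G \<in> mfps_ord n \<Longrightarrow> F + G \<in> mfps_ord n"
    and mfps_ord_diff: "F \<in> mfps_ord n \<Longrightarrow> G \<in> mfps_ord n \<Longrightarrow> F - G \<in> mfps_ord n"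
    and mfps_ord_uminus: "F \<in> mfps_ord n \<Longrightarrow> - F \<in> mfps_ord n"
  by (auto simp: mfps_ord_def)

lemma mfps_ord_sum:
  "(\<And>i. i \<in> I \<Longrightarrow> F i \<in> mfps_ord n) \<Longrightarrow> sum F I \<in> (mfps_ord n :: ('v, 'b::comm_ring_1) mfps set)"
  by (induction I rule: infinite_finite_induct) (auto intro: mfps_ord_zero mfps_ord_add)

lemma mfps_ord_mult:
  fixes F G :: "('v, 'b::comm_ring_1) mfps"
  assumes "F \<in> mfps_ord m" "G \<in> mfps_ord n"
  shows "F * G \<in> mfps_ord (m + n)"
proof (rule mfps_ordI)
  fix \<alpha> :: "'v \<Rightarrow>\<^sub>0 nat" assume \<alpha>: "monom_deg \<alpha> < m + n"
  show "mfps_coeff (F * G) \<alpha> = 0"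
    unfolding mfps_coeff_mult
  proof (rule sum.neutral, clarify)
    fix \<beta> \<gamma> :: "'v \<Rightarrow>\<^sub>0 nat" assume "\<alpha> = \<beta> + \<gamma>"
    then have "monom_deg \<beta> < m \<or> monom_deg \<gamma> < n" using \<alpha> by (auto simp: monom_deg_add)
    then show "mfps_coeff F \<beta> * mfps_coeff G \<gamma> = 0" using assms by (auto dest: mfps_ordD)
  qed
qed

lemma mfps_ord_mult_left: "G \<in> mfps_ord n \<Longrightarrow> F * G \<in> (mfps_ord n :: ('v, 'b::comm_ring_1) mfps set)"
  using mfps_ord_mult[of F 0 G n] by simp

lemma mfps_ord_power:
  "F \<in> mfps_ord m \<Longrightarrow> F ^ k \<in> (mfps_ord (k * m) :: ('v, 'b::comm_ring_1) mfps set)"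
  by (induction k) (auto intro: mfps_ord_mult)

lemma mfps_ord_power_1:
  "F \<in> mfps_ord 1 \<Longrightarrow> F ^ k \<in> (mfps_ord k :: ('v, 'b::comm_ring_1) mfps set)"
  using mfps_ord_power[of F 1 k] by simp

lemma mfps_eqI_ord:
  fixes F G :: "('v, 'b::comm_ring_1) mfps"
  assumes "\<And>n. F - G \<in> mfps_ord n"
  shows "F = G"
proof (rule mfps_eqI)
  fix \<alpha> show "mfps_coeff F \<alpha> = mfps_coeff G \<alpha>"
    using mfps_ordD[OF assms[of "Suc (monom_deg \<alpha>)"], of \<alpha>] by simp
qed

section \<open>Series with restricted coefficients and variables\<close>

lemma mfps_over_iff:
  "F \<in> mfps_over UNIV V \<longleftrightarrow> (\<forall>\<alpha>. mfps_coeff F \<alpha> \<noteq> 0 \<longrightarrow> Poly_Mapping.keys \<alpha> \<subseteq> V)"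
  by (simp add: mfps_over_def)

lemma mfps_const_over [simp]: "mfps_const c \<in> mfps_over UNIV V"
  by (auto simp: mfps_over_iff mfps_coeff_const)

lemma mfps_var_over: "v \<in> V \<Longrightarrow> mfps_var v \<in> mfps_over UNIV V"
  by (auto simp: mfps_over_iff mfps_coeff_var)

lemma mfps_var_ord: "mfps_var v \<in> mfps_ord 1"
  by (auto simp: mfps_ord_def mfps_coeff_var)

lemma subring_set_mfps_over:
  assumes "subring_set A"
  shows "subring_set (mfps_over A V :: ('v, 'b::comm_ring_1) mfps set)"
proof -
  interpret subring_set A by fact
  show ?thesis
  proof
    show "(1 :: ('v, 'b) mfps) \<in> mfps_over A V" by (auto simp: mfps_over_def mfps_coeff_one)
    fix F G :: "('v, 'b) mfps" assume FG: "F \<in> mfps_over A V" "G \<in> mfps_over A V"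
    show "F - G \<in> mfps_over A V"
      unfolding mfps_over_def
    proof (intro CollectI allI conjI impI)
      fix \<alpha> :: "'v \<Rightarrow>\<^sub>0 nat"
      show "mfps_coeff (F - G) \<alpha> \<in> A"
        using FG by (simp add: mfps_over_def diff_closed)
      assume "mfps_coeff (F - G) \<alpha> \<noteq> 0"
      then have "mfps_coeff F \<alpha> \<noteq> 0 \<or> mfps_coeff G \<alpha> \<noteq> 0" by auto
      then show "Poly_Mapping.keys \<alpha> \<subseteq> V"
        using FG unfolding mfps_over_def by blast
    qed
    show "F * G \<in> mfps_over A V"
      unfolding mfps_over_def
    proof (intro CollectI allI conjI impI subsetI)
      fix \<alpha> :: "'v \<Rightarrow>\<^sub>0 nat"
      show "mfps_coeff (F * G) \<alpha> \<in> A"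
        using FG by (auto simp: mfps_over_def mfps_coeff_mult intro!: sum_closed mult_closed)
      fix v assume "mfps_coeff (F * G) \<alpha> \<noteq> 0" and v: "v \<in> Poly_Mapping.keys \<alpha>"
      then obtain \<beta> \<gamma> where *: "\<beta> + \<gamma> = \<alpha>" "mfps_coeff F \<beta> * mfps_coeff G \<gamma> \<noteq> 0"
        unfolding mfps_coeff_mult by (elim sum.not_neutral_contains_not_neutral) auto
      then have "mfps_coeff F \<beta> \<noteq> 0" "mfps_coeff G \<gamma> \<noteq> 0" by auto
      then have "Poly_Mapping.keys \<beta> \<subseteq> V" "Poly_Mapping.keys \<gamma> \<subseteq> V"
        using FG unfolding mfps_over_def by blast+
      then show "v \<in> V" using v * by (auto simp: keys_add_nat)
    qed
  qed
qed

interpretation mfps_over_UNIV: subring_set "mfps_over UNIV V :: ('v, 'b::comm_ring_1) mfps set" for V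
  by (intro subring_set_mfps_over subring_set_UNIV)

section \<open>Monomials as power series\<close>

definition mfps_monom :: "'b::zero \<Rightarrow> ('v \<Rightarrow>\<^sub>0 nat) \<Rightarrow> ('v, 'b) mfps" where
  "mfps_monom c \<alpha> = Abs_mfps (\<lambda>\<beta>. if \<beta> = \<alpha> then c else 0)"

lemma mfps_coeff_monom: "mfps_coeff (mfps_monom c \<alpha>) \<beta> = (if \<beta> = \<alpha> then c else 0)"
  by (simp add: mfps_monom_def)

lemma mfps_monom_mult:
  "mfps_monom c \<alpha> * mfps_monom d \<beta> = mfps_monom (c * d) (\<alpha> + \<beta> :: 'v \<Rightarrow>\<^sub>0 nat)"
  for c d :: "'b::comm_ring_1"
proof (rule mfps_eqI)
  fix \<delta>
  have "(\<Sum>(\<beta>', \<gamma>) | \<beta>' + \<gamma> = \<delta>. mfps_coeff (mfps_monom c \<alpha>) \<beta>' * mfps_coeff (mfps_monom d \<beta>) \<gamma>) =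
    (\<Sum>(\<beta>', \<gamma>) \<in> (if \<delta> = \<alpha> + \<beta> then {(\<alpha>, \<beta>)} else {}).
      mfps_coeff (mfps_monom c \<alpha>) \<beta>' * mfps_coeff (mfps_monom d \<beta>) \<gamma>)"
    by (rule sum.mono_neutral_right)
      (auto simp: finite_monomial_factors mfps_coeff_monom split: if_splits)
  then show "mfps_coeff (mfps_monom c \<alpha> * mfps_monom d \<beta>) \<delta> = mfps_coeff (mfps_monom (c * d) (\<alpha> + \<beta>)) \<delta>"
    by (simp add: mfps_coeff_mult mfps_coeff_monom)
qed

lemma mfps_const_eq_monom: "mfps_const c = mfps_monom c 0"
  by (rule mfps_eqI) (simp add: mfps_coeff_const mfps_coeff_monom)

lemma mfps_var_eq_monom: "mfps_var v = mfps_monom 1 (Poly_Mapping.single v 1)"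
  by (rule mfps_eqI) (simp add: mfps_coeff_var mfps_coeff_monom)

lemma mfps_one_eq_monom: "1 = mfps_monom 1 0"
  by (rule mfps_eqI) (simp add: mfps_coeff_one mfps_coeff_monom)

lemma mfps_var_power:
  "mfps_var v ^ k = (mfps_monom 1 (Poly_Mapping.single v k) :: ('v, 'b::comm_ring_1) mfps)"
  by (induction k) (auto simp: mfps_one_eq_monom mfps_var_eq_monom mfps_monom_mult simp flip: single_add)

section \<open>Substitution\<close>

definition mfps_eval_monom :: "('v \<Rightarrow> ('w, 'b::comm_ring_1) mfps) \<Rightarrow> ('v \<Rightarrow>\<^sub>0 nat) \<Rightarrow> ('w, 'b) mfps" where
  "mfps_eval_monom G \<alpha> = (\<Prod>v\<in>Poly_Mapping.keys \<alpha>. G v ^ Poly_Mapping.lookup \<alpha> v)"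

lemma mfps_eval_monom_superset:
  assumes "finite V" "Poly_Mapping.keys \<alpha> \<subseteq> V"
  shows "mfps_eval_monom G \<alpha> = (\<Prod>v\<in>V. G v ^ Poly_Mapping.lookup \<alpha> v)"
  unfolding mfps_eval_monom_def using assms
  by (intro prod.mono_neutral_left) (auto simp: in_keys_iff)

lemma mfps_eval_monom_add:
  "mfps_eval_monom G (\<alpha> + \<beta>) = mfps_eval_monom G \<alpha> * mfps_eval_monom G \<beta>"
proof -
  let ?V = "Poly_Mapping.keys \<alpha> \<union> Poly_Mapping.keys \<beta>"
  show ?thesis
    using mfps_eval_monom_superset[of ?V \<alpha> G] mfps_eval_monom_superset[of ?V \<beta> G]
      mfps_eval_monom_superset[of ?V "\<alpha> + \<beta>" G]
    by (simp add: keys_add_nat lookup_add power_add prod.distrib)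
qed

lemma mfps_eval_monom_0 [simp]: "mfps_eval_monom G 0 = 1"
  by (simp add: mfps_eval_monom_def)

lemma mfps_eval_monom_single [simp]: "mfps_eval_monom G (Poly_Mapping.single v k) = G v ^ k"
  by (cases "k = 0") (simp_all add: mfps_eval_monom_def)

lemma monom_induct [case_names zero single_add]:
  fixes P :: "('v \<Rightarrow>\<^sub>0 nat) \<Rightarrow> bool"
  assumes "P 0" "\<And>v \<beta>. P \<beta> \<Longrightarrow> P (Poly_Mapping.single v 1 + \<beta>)"
  shows "P \<alpha>"
proof (induction "monom_deg \<alpha>" arbitrary: \<alpha>)
  case 0
  then show ?case using assms(1) by (simp add: monom_deg_eq_0_iff)
next
  case (Suc n)
  then have "\<alpha> \<noteq> 0" by auto
  then obtain v where "v \<in> Poly_Mapping.keys \<alpha>" by (metis ex_in_conv keys_eq_empty)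
  then obtain \<beta> where \<beta>: "\<alpha> = Poly_Mapping.single v 1 + \<beta>" by (rule exists_single_add)
  then have "n = monom_deg \<beta>" using Suc(2) by (simp add: monom_deg_add)
  then show ?case using Suc(1) assms(2) \<beta> by blast
qed

lemma mfps_eval_monom_var: "mfps_eval_monom mfps_var \<alpha> = mfps_monom 1 \<alpha>"
  by (induction \<alpha> rule: monom_induct)
    (simp_all add: mfps_eval_monom_add mfps_one_eq_monom mfps_var_eq_monom mfps_monom_mult)

lemma mfps_eval_monom_cong:
  "(\<And>v. v \<in> Poly_Mapping.keys \<alpha> \<Longrightarrow> G v = H v) \<Longrightarrow> mfps_eval_monom G \<alpha> = mfps_eval_monom H \<alpha>"
  by (simp add: mfps_eval_monom_def)

lemma mfps_eval_monom_ord: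
  assumes "Poly_Mapping.keys \<alpha> \<subseteq> V" "\<And>v. v \<in> V \<Longrightarrow> G v \<in> mfps_ord 1"
  shows "mfps_eval_monom G \<alpha> \<in> mfps_ord (monom_deg \<alpha>)"
  using assms(1)
proof (induction \<alpha> rule: monom_induct)
  case (single_add v \<beta>)
  then show ?case
    using assms(2)[of v] by (auto simp: mfps_eval_monom_add monom_deg_add keys_add_nat
        intro!: mfps_ord_mult[of _ 1, simplified])
qed auto

lemma mfps_eval_monom_over:
  assumes "Poly_Mapping.keys \<alpha> \<subseteq> V" "\<And>v. v \<in> V \<Longrightarrow> G v \<in> mfps_over UNIV W"
  shows "mfps_eval_monom G \<alpha> \<in> mfps_over UNIV W"
  using assms(1)
proof (induction \<alpha> rule: monom_induct)
  case (single_add v \<beta>)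
  then show ?case
    using assms(2)[of v]
    by (auto simp: mfps_eval_monom_add keys_add_nat intro!: mfps_over_UNIV.mult_closed)
qed auto

text \<open>In a product of d factors, replace \<open>G\<close> by \<open>H\<close> one factor at a
  time: each change contributes a difference of order n times d - 1 factors of order 1. For the zero
  exponent the difference is 0, so the truncated subtraction does no harm.\<close>

lemma mfps_eval_monom_diff_ord:
  assumes "Poly_Mapping.keys \<alpha> \<subseteq> V" "\<And>v. v \<in> V \<Longrightarrow> G v \<in> mfps_ord 1" "\<And>v. v \<in> V \<Longrightarrow> H v \<in> mfps_ord 1"
    and "\<And>v. v \<in> V \<Longrightarrow> G v - H v \<in> mfps_ord n"
  shows "mfps_eval_monom G \<alpha> - mfps_eval_monom H \<alpha> \<in> mfps_ord (n + monom_deg \<alpha> - 1)"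
  using assms(1)
proof (induction \<alpha> rule: monom_induct)
  case zero
  then show ?case by (simp add: mfps_ord_zero)
next
  case (single_add v \<beta>)
  let ?g = "mfps_eval_monom G \<beta>" and ?h = "mfps_eval_monom H \<beta>"
  have v: "v \<in> V" and \<beta>: "Poly_Mapping.keys \<beta> \<subseteq> V"
    using single_add by (auto simp: keys_add_nat)
  have eq: "mfps_eval_monom G (Poly_Mapping.single v 1 + \<beta>) - mfps_eval_monom H (Poly_Mapping.single v 1 + \<beta>)
      = (G v - H v) * ?g + H v * (?g - ?h)"
    by (simp add: mfps_eval_monom_add algebra_simps)
  have 1: "(G v - H v) * ?g \<in> mfps_ord (n + monom_deg \<beta>)"
    using assms(2,4) v \<beta> by (intro mfps_ord_mult mfps_eval_monom_ord) auto
  have 2: "H v * (?g - ?h) \<in> mfps_ord (n + monom_deg \<beta>)"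
  proof -
    have "H v * (?g - ?h) \<in> mfps_ord (1 + (n + monom_deg \<beta> - 1))"
      using assms(3) v \<beta> single_add by (intro mfps_ord_mult) auto
    then show ?thesis by (rule mfps_ord_antimono) auto
  qed
  show ?case
    unfolding eq using mfps_ord_add[OF 1 2] by (simp add: monom_deg_add)
qed

text \<open>A monomial of degree d evaluates to a series of order d, so only exponents up to the
  degree of \<open>\<delta>\<close> matter. The free bound \<open>N\<close> allows several
  \<open>\<delta>\<close> to share one index set.\<close>

lemma mfps_coeff_subst:
  assumes "finite V" "F \<in> mfps_over UNIV V" "\<And>v. v \<in> V \<Longrightarrow> G v \<in> mfps_ord 1" "monom_deg \<delta> \<le> N"
  shows "mfps_coeff (mfps_subst F G) \<delta> =
    (\<Sum>\<alpha>\<in>monoms_upto V N. mfps_coeff F \<alpha> * mfps_coeff (mfps_eval_monom G \<alpha>) \<delta>)"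
proof -
  let ?t = "\<lambda>\<alpha>. mfps_coeff F \<alpha> * mfps_coeff (mfps_eval_monom G \<alpha>) \<delta>"
  have "mfps_coeff (mfps_subst F G) \<delta> = (\<Sum>\<alpha> | ?t \<alpha> \<noteq> 0. ?t \<alpha>)"
    by (simp add: mfps_subst_def mfps_sum.rep_eq flip: mfps_eval_monom_def)
  also have "\<dots> = (\<Sum>\<alpha>\<in>monoms_upto V N. ?t \<alpha>)"
  proof (rule sum.mono_neutral_left)
    show "{\<alpha>. ?t \<alpha> \<noteq> 0} \<subseteq> monoms_upto V N"
    proof (clarify)
      fix \<alpha> assume t: "?t \<alpha> \<noteq> 0"
      then have \<alpha>: "Poly_Mapping.keys \<alpha> \<subseteq> V" using assms(2) by (force simp: mfps_over_iff)
      have "\<not> monom_deg \<delta> < monom_deg \<alpha>"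
        using mfps_ordD[where \<alpha>=\<delta>, OF mfps_eval_monom_ord[OF \<alpha> assms(3)]] t by auto
      then show "\<alpha> \<in> monoms_upto V N" using \<alpha> assms(4) by (simp add: monoms_upto_def)
    qed
  qed (auto simp: finite_monoms_upto assms(1))
  finally show ?thesis .
qed

lemma mfps_subst_over:
  fixes G :: "'v \<Rightarrow> ('w, 'b::comm_ring_1) mfps"
  assumes "F \<in> mfps_over UNIV V" "\<And>v. v \<in> V \<Longrightarrow> G v \<in> mfps_over UNIV W"
  shows "mfps_subst F G \<in> mfps_over UNIV W"
  unfolding mfps_over_iff
proof (intro allI impI)
  fix \<delta> :: "'w \<Rightarrow>\<^sub>0 nat"
  let ?t = "\<lambda>\<alpha>. mfps_coeff F \<alpha> * mfps_coeff (mfps_eval_monom G \<alpha>) \<delta>"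
  assume "mfps_coeff (mfps_subst F G) \<delta> \<noteq> 0"
  also have "mfps_coeff (mfps_subst F G) \<delta> = (\<Sum>\<alpha> | ?t \<alpha> \<noteq> 0. ?t \<alpha>)"
    by (simp add: mfps_subst_def mfps_sum.rep_eq flip: mfps_eval_monom_def)
  finally obtain \<alpha> where t: "?t \<alpha> \<noteq> 0"
    by (elim sum.not_neutral_contains_not_neutral) auto
  then have "Poly_Mapping.keys \<alpha> \<subseteq> V" using assms(1) by (force simp: mfps_over_iff)
  then have "mfps_eval_monom G \<alpha> \<in> mfps_over UNIV W"
    using assms(2) by (rule mfps_eval_monom_over)
  moreover have "mfps_coeff (mfps_eval_monom G \<alpha>) \<delta> \<noteq> 0" using t by auto
  ultimately show "Poly_Mapping.keys \<delta> \<subseteq> W" by (auto simp: mfps_over_iff)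
qed

lemma mfps_subst_cong:
  assumes "F \<in> mfps_over UNIV V" "\<And>v. v \<in> V \<Longrightarrow> G v = H v"
  shows "mfps_subst F G = mfps_subst F H"
proof -
  have "mfps_const (mfps_coeff F \<alpha>) * mfps_eval_monom G \<alpha> = mfps_const (mfps_coeff F \<alpha>) * mfps_eval_monom H \<alpha>" for \<alpha>
  proof (cases "mfps_coeff F \<alpha> = 0")
    case False
    then have "Poly_Mapping.keys \<alpha> \<subseteq> V" using assms(1) by (auto simp: mfps_over_iff)
    then show ?thesis using assms(2) mfps_eval_monom_cong[of \<alpha> G H] by (auto simp: subset_iff)
  qed simp
  then show ?thesis by (simp add: mfps_subst_def flip: mfps_eval_monom_def)
qed

context
  fixes V :: "'v set" and G :: "'v \<Rightarrow> ('w, 'b::comm_ring_1) mfps"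
  assumes V: "finite V" and G: "\<And>v. v \<in> V \<Longrightarrow> G v \<in> mfps_ord 1"
begin

lemma mfps_subst_add:
  assumes "F \<in> mfps_over UNIV V" "F' \<in> mfps_over UNIV V"
  shows "mfps_subst (F + F') G = mfps_subst F G + mfps_subst F' G"
  by (rule mfps_eqI)
    (simp add: mfps_coeff_subst[OF V _ G order.refl] assms mfps_over_UNIV.add_closed
      distrib_right sum.distrib)

lemma mfps_subst_diff:
  assumes "F \<in> mfps_over UNIV V" "F' \<in> mfps_over UNIV V"
  shows "mfps_subst (F - F') G = mfps_subst F G - mfps_subst F' G"
  by (rule mfps_eqI)
    (simp add: mfps_coeff_subst[OF V _ G order.refl] assms mfps_over_UNIV.diff_closed
      left_diff_distrib sum_subtractf)

lemma mfps_subst_const [simp]: "mfps_subst (mfps_const c) G = mfps_const c"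
proof (rule mfps_eqI)
  fix \<delta> :: "'w \<Rightarrow>\<^sub>0 nat"
  have "mfps_coeff (mfps_subst (mfps_const c) G) \<delta> =
    (\<Sum>\<alpha>\<in>monoms_upto V (monom_deg \<delta>). mfps_coeff (mfps_const c) \<alpha> * mfps_coeff (mfps_eval_monom G \<alpha>) \<delta>)"
    by (intro mfps_coeff_subst V G) auto
  also have "\<dots> = (\<Sum>\<alpha>\<in>{0}. mfps_coeff (mfps_const c) \<alpha> * mfps_coeff (mfps_eval_monom G \<alpha>) \<delta>)"
    by (intro sum.mono_neutral_right finite_monoms_upto V)
      (auto simp: monoms_upto_def mfps_coeff_const)
  finally show "mfps_coeff (mfps_subst (mfps_const c) G) \<delta> = mfps_coeff (mfps_const c) \<delta>"
    by (simp add: mfps_coeff_const mfps_coeff_one)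
qed

lemma mfps_subst_sum:
  assumes "\<And>i. i \<in> I \<Longrightarrow> F i \<in> mfps_over UNIV V"
  shows "mfps_subst (\<Sum>i\<in>I. F i) G = (\<Sum>i\<in>I. mfps_subst (F i) G)"
  using assms
proof (induction I rule: infinite_finite_induct)
  case (insert x I)
  then show ?case by (simp add: mfps_subst_add mfps_over_UNIV.sum_closed)
qed (use mfps_subst_const[of 0] in simp_all)

text \<open>Both sides become the same finite sum over pairs of exponents of \<open>F\<close> and
  \<open>F'\<close>. The left side yields the pairs of total degree at most N, the right side all
  pairs with each degree at most N; the additional pairs contribute nothing in degree N.\<close>

lemma mfps_subst_mult:
  assumes F: "F \<in> mfps_over UNIV V" "F' \<in> mfps_over UNIV V"
  shows "mfps_subst (F * F') G = mfps_subst F G * mfps_subst F' G"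
proof (rule mfps_eqI)
  fix \<delta> :: "'w \<Rightarrow>\<^sub>0 nat"
  let ?N = "monom_deg \<delta>"
  let ?M = "monoms_upto V ?N"
  let ?e = "\<lambda>\<alpha>. mfps_coeff (mfps_eval_monom G \<alpha>)"
  let ?t = "\<lambda>(\<beta>, \<gamma>). mfps_coeff F \<beta> * mfps_coeff F' \<gamma> * ?e (\<beta> + \<gamma>) \<delta>"
  let ?Q = "{(\<epsilon>, \<eta>). \<epsilon> + \<eta> = \<delta>}"
  let ?P = "\<lambda>\<alpha>. {(\<beta>, \<gamma>). \<beta> + \<gamma> = (\<alpha> :: 'v \<Rightarrow>\<^sub>0 nat)}"
  have fin: "finite ?M" by (intro finite_monoms_upto V)
  have "mfps_coeff (mfps_subst (F * F') G) \<delta> = (\<Sum>\<alpha>\<in>?M. mfps_coeff (F * F') \<alpha> * ?e \<alpha> \<delta>)"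
    using F by (intro mfps_coeff_subst V G mfps_over_UNIV.mult_closed) auto
  also have "\<dots> = (\<Sum>\<alpha>\<in>?M. \<Sum>z\<in>?P \<alpha>. ?t z)"
    unfolding mfps_coeff_mult sum_distrib_right by (intro sum.cong) auto
  also have "\<dots> = (\<Sum>z\<in>(SIGMA \<alpha>:?M. ?P \<alpha>). ?t (snd z))"
    by (subst sum.Sigma)
      (auto simp: fin finite_monomial_factors[unfolded case_prod_unfold] case_prod_unfold)
  also have "\<dots> = (\<Sum>z | z \<in> ?M \<times> ?M \<and> monom_deg (fst z) + monom_deg (snd z) \<le> ?N. ?t z)"
    by (rule sum.reindex_bij_witness[of _ "\<lambda>z. (fst z + snd z, z)" snd])
      (auto simp: monoms_upto_def monom_deg_add keys_add_nat)
  \<comment> \<open>From the triangle to the full square: evaluated monomials of total degree above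
    N have no coefficient at \<open>\<delta>\<close>.\<close>
  also have "\<dots> = (\<Sum>z\<in>?M \<times> ?M. ?t z)"
  proof (rule sum.mono_neutral_left)
    show "\<forall>z\<in>?M \<times> ?M - {z. z \<in> ?M \<times> ?M \<and> monom_deg (fst z) + monom_deg (snd z) \<le> ?N}. ?t z = 0"
    proof
      fix z assume z: "z \<in> ?M \<times> ?M - {z. z \<in> ?M \<times> ?M \<and> monom_deg (fst z) + monom_deg (snd z) \<le> ?N}"
      obtain \<beta> \<gamma> where \<beta>\<gamma>: "z = (\<beta>, \<gamma>)" by fastforce
      with z have *: "\<beta> \<in> ?M" "\<gamma> \<in> ?M" "\<not> monom_deg \<beta> + monom_deg \<gamma> \<le> ?N" by auto
      then have "mfps_eval_monom G (\<beta> + \<gamma>) \<in> mfps_ord (monom_deg (\<beta> + \<gamma>))"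
        by (intro mfps_eval_monom_ord[of _ V] G) (auto simp: monoms_upto_def keys_add_nat)
      then have "?e (\<beta> + \<gamma>) \<delta> = 0" using * by (intro mfps_ordD) (auto simp: monom_deg_add)
      then show "?t z = 0" by (simp add: \<beta>\<gamma>)
    qed
  qed (auto simp: fin)
  also have "\<dots> = (\<Sum>\<beta>\<in>?M. \<Sum>\<gamma>\<in>?M. mfps_coeff F \<beta> * mfps_coeff F' \<gamma> *
      (\<Sum>(\<epsilon>, \<eta>)\<in>?Q. ?e \<beta> \<epsilon> * ?e \<gamma> \<eta>))"
    by (simp add: sum.cartesian_product case_prod_unfold mfps_eval_monom_add mfps_coeff_mult)
  also have "\<dots> = (\<Sum>\<beta>\<in>?M. \<Sum>\<gamma>\<in>?M. \<Sum>(\<epsilon>, \<eta>)\<in>?Q.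
      (mfps_coeff F \<beta> * ?e \<beta> \<epsilon>) * (mfps_coeff F' \<gamma> * ?e \<gamma> \<eta>))"
    by (simp add: sum_distrib_left case_prod_unfold ac_simps)
  also have "\<dots> = (\<Sum>\<beta>\<in>?M. \<Sum>(\<epsilon>, \<eta>)\<in>?Q. \<Sum>\<gamma>\<in>?M.
      (mfps_coeff F \<beta> * ?e \<beta> \<epsilon>) * (mfps_coeff F' \<gamma> * ?e \<gamma> \<eta>))"
    unfolding case_prod_unfold by (intro sum.cong refl sum.swap)
  also have "\<dots> = (\<Sum>(\<epsilon>, \<eta>)\<in>?Q. \<Sum>\<beta>\<in>?M. \<Sum>\<gamma>\<in>?M.
      (mfps_coeff F \<beta> * ?e \<beta> \<epsilon>) * (mfps_coeff F' \<gamma> * ?e \<gamma> \<eta>))"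
    unfolding case_prod_unfold by (rule sum.swap)
  also have "\<dots> = (\<Sum>(\<epsilon>, \<eta>)\<in>?Q. (\<Sum>\<beta>\<in>?M. mfps_coeff F \<beta> * ?e \<beta> \<epsilon>) * (\<Sum>\<gamma>\<in>?M. mfps_coeff F' \<gamma> * ?e \<gamma> \<eta>))"
    by (simp add: sum_product)
  also have "\<dots> = (\<Sum>(\<epsilon>, \<eta>)\<in>?Q. mfps_coeff (mfps_subst F G) \<epsilon> * mfps_coeff (mfps_subst F' G) \<eta>)"
  proof (intro sum.cong refl)
    fix z assume z: "z \<in> ?Q"
    obtain \<epsilon> \<eta> where \<epsilon>\<eta>: "z = (\<epsilon>, \<eta>)" by fastforce
    with z have "monom_deg \<epsilon> \<le> ?N" "monom_deg \<eta> \<le> ?N"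
      by (auto simp: monom_deg_add)
    then have "(\<Sum>\<beta>\<in>?M. mfps_coeff F \<beta> * ?e \<beta> \<epsilon>) = mfps_coeff (mfps_subst F G) \<epsilon>"
      "(\<Sum>\<gamma>\<in>?M. mfps_coeff F' \<gamma> * ?e \<gamma> \<eta>) = mfps_coeff (mfps_subst F' G) \<eta>"
      using F by (intro mfps_coeff_subst[symmetric] V G; simp)+
    then show "(case z of (\<epsilon>, \<eta>) \<Rightarrow> (\<Sum>\<beta>\<in>?M. mfps_coeff F \<beta> * ?e \<beta> \<epsilon>) * (\<Sum>\<gamma>\<in>?M. mfps_coeff F' \<gamma> * ?e \<gamma> \<eta>)) =
      (case z of (\<epsilon>, \<eta>) \<Rightarrow> mfps_coeff (mfps_subst F G) \<epsilon> * mfps_coeff (mfps_subst F' G) \<eta>)"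
      by (simp add: \<epsilon>\<eta>)
  qed
  finally show "mfps_coeff (mfps_subst (F * F') G) \<delta> = mfps_coeff (mfps_subst F G * mfps_subst F' G) \<delta>"
    by (simp add: mfps_coeff_mult)
qed

lemma mfps_subst_one [simp]: "mfps_subst 1 G = 1"
  using mfps_subst_const[of 1] by simp

lemma mfps_subst_power:
  "F \<in> mfps_over UNIV V \<Longrightarrow> mfps_subst (F ^ k) G = mfps_subst F G ^ k"
  by (induction k) (simp_all add: mfps_subst_mult mfps_over_UNIV.power_closed)

lemma mfps_subst_var: "v \<in> V \<Longrightarrow> mfps_subst (mfps_var v) G = G v"
proof (rule mfps_eqI)
  fix \<delta> :: "'w \<Rightarrow>\<^sub>0 nat" assume v: "v \<in> V"
  let ?v = "Poly_Mapping.single v (1::nat)"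
  let ?t = "\<lambda>\<alpha>. mfps_coeff (mfps_var v) \<alpha> * mfps_coeff (mfps_eval_monom G \<alpha>) \<delta>"
  \<comment> \<open>The bound is one above the degree of \<open>\<delta>\<close>, so that the
    monomial of degree 1 is in range even for \<open>\<delta> = 0\<close>.\<close>
  have "mfps_coeff (mfps_subst (mfps_var v) G) \<delta> = (\<Sum>\<alpha>\<in>monoms_upto V (Suc (monom_deg \<delta>)). ?t \<alpha>)"
    using v by (intro mfps_coeff_subst V G mfps_var_over) auto
  also have "\<dots> = (\<Sum>\<alpha>\<in>{?v}. ?t \<alpha>)"
    using v by (intro sum.mono_neutral_right finite_monoms_upto V)
      (auto simp: monoms_upto_def mfps_coeff_var)
  finally show "mfps_coeff (mfps_subst (mfps_var v) G) \<delta> = mfps_coeff (G v) \<delta>"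
    by (simp add: mfps_coeff_var del: One_nat_def)
qed

lemma mfps_subst_ord:
  assumes "F \<in> mfps_over UNIV V" "F \<in> mfps_ord n"
  shows "mfps_subst F G \<in> mfps_ord n"
proof (rule mfps_ordI)
  fix \<delta> :: "'w \<Rightarrow>\<^sub>0 nat" assume \<delta>: "monom_deg \<delta> < n"
  have "mfps_coeff (mfps_subst F G) \<delta> =
    (\<Sum>\<alpha>\<in>monoms_upto V (monom_deg \<delta>). mfps_coeff F \<alpha> * mfps_coeff (mfps_eval_monom G \<alpha>) \<delta>)"
    by (intro mfps_coeff_subst V G assms) auto
  also have "\<dots> = 0"
    using \<delta> by (intro sum.neutral ballI) (auto simp: monoms_upto_def mfps_ordD[OF assms(2)])
  finally show "mfps_coeff (mfps_subst F G) \<delta> = 0" .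
qed

lemma mfps_subst_eval_monom:
  assumes "Poly_Mapping.keys \<alpha> \<subseteq> U" "\<And>u. u \<in> U \<Longrightarrow> F u \<in> mfps_over UNIV V"
  shows "mfps_subst (mfps_eval_monom F \<alpha>) G = mfps_eval_monom (\<lambda>u. mfps_subst (F u) G) \<alpha>"
  using assms(1)
proof (induction \<alpha> rule: monom_induct)
  case (single_add u \<beta>)
  then have "u \<in> U" "Poly_Mapping.keys \<beta> \<subseteq> U" by (auto simp: keys_add_nat)
  then show ?case
    using single_add assms(2)
    by (simp add: mfps_eval_monom_add mfps_subst_mult mfps_eval_monom_over del: One_nat_def)
qed simp

text \<open>Truncating both substitutions at the degree of \<open>\<delta>\<close> makes all sums
  finite; after exchanging them, the inner sum is \<open>G\<close> substituted into an evaluated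
  monomial, which \<open>mfps_subst_eval_monom\<close> resolves.\<close>

lemma mfps_subst_assoc:
  assumes U: "finite U" and E: "E \<in> mfps_over UNIV U"
    and F: "\<And>u. u \<in> U \<Longrightarrow> F u \<in> mfps_over UNIV V" "\<And>u. u \<in> U \<Longrightarrow> F u \<in> mfps_ord 1"
  shows "mfps_subst (mfps_subst E F) G = mfps_subst E (\<lambda>u. mfps_subst (F u) G)"
proof (rule mfps_eqI)
  fix \<delta> :: "'w \<Rightarrow>\<^sub>0 nat"
  let ?N = "monom_deg \<delta>"
  let ?M = "monoms_upto V ?N" and ?L = "monoms_upto U ?N"
  have "mfps_coeff (mfps_subst (mfps_subst E F) G) \<delta> =
      (\<Sum>\<beta>\<in>?M. mfps_coeff (mfps_subst E F) \<beta> * mfps_coeff (mfps_eval_monom G \<beta>) \<delta>)"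
    by (intro mfps_coeff_subst V G mfps_subst_over[OF E F(1)]) auto
  also have "\<dots> = (\<Sum>\<beta>\<in>?M. (\<Sum>\<alpha>\<in>?L. mfps_coeff E \<alpha> * mfps_coeff (mfps_eval_monom F \<alpha>) \<beta>) *
      mfps_coeff (mfps_eval_monom G \<beta>) \<delta>)"
    by (intro sum.cong refl, subst mfps_coeff_subst[where N="?N", OF U E F(2)]) (auto simp: monoms_upto_def)
  also have "\<dots> = (\<Sum>\<alpha>\<in>?L. mfps_coeff E \<alpha> * (\<Sum>\<beta>\<in>?M. mfps_coeff (mfps_eval_monom F \<alpha>) \<beta> *
      mfps_coeff (mfps_eval_monom G \<beta>) \<delta>))"
    unfolding sum_distrib_left sum_distrib_right by (subst sum.swap) (simp add: ac_simps)
  also have "\<dots> = (\<Sum>\<alpha>\<in>?L. mfps_coeff E \<alpha> *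
      mfps_coeff (mfps_eval_monom (\<lambda>u. mfps_subst (F u) G) \<alpha>) \<delta>)"
  proof (intro sum.cong refl)
    fix \<alpha> assume "\<alpha> \<in> ?L"
    then have \<alpha>: "Poly_Mapping.keys \<alpha> \<subseteq> U" by (simp add: monoms_upto_def)
    have "(\<Sum>\<beta>\<in>?M. mfps_coeff (mfps_eval_monom F \<alpha>) \<beta> * mfps_coeff (mfps_eval_monom G \<beta>) \<delta>) =
      mfps_coeff (mfps_subst (mfps_eval_monom F \<alpha>) G) \<delta>"
      by (intro mfps_coeff_subst[symmetric] V G mfps_eval_monom_over[OF \<alpha> F(1)]) auto
    then show "mfps_coeff E \<alpha> * (\<Sum>\<beta>\<in>?M. mfps_coeff (mfps_eval_monom F \<alpha>) \<beta> * mfps_coeff (mfps_eval_monom G \<beta>) \<delta>) =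
      mfps_coeff E \<alpha> * mfps_coeff (mfps_eval_monom (\<lambda>u. mfps_subst (F u) G) \<alpha>) \<delta>"
      using mfps_subst_eval_monom[OF \<alpha> F(1)] by simp
  qed
  also have "\<dots> = mfps_coeff (mfps_subst E (\<lambda>u. mfps_subst (F u) G)) \<delta>"
    using F by (intro mfps_coeff_subst[symmetric] U E mfps_subst_ord) auto
  finally show "mfps_coeff (mfps_subst (mfps_subst E F) G) \<delta> =
    mfps_coeff (mfps_subst E (\<lambda>u. mfps_subst (F u) G)) \<delta>" .
qed

text \<open>For k = 2 substitution into \<open>F\<close> is a contraction for the order filtration.
  This drives the iteration for compositional inverses and later isolates the linear part of the
  logarithm.\<close>

lemma mfps_subst_diff_ord:
  assumes F: "F \<in> mfps_over UNIV V" "F \<in> mfps_ord k"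
    and H: "\<And>v. v \<in> V \<Longrightarrow> H v \<in> mfps_ord 1" "\<And>v. v \<in> V \<Longrightarrow> G v - H v \<in> mfps_ord n"
  shows "mfps_subst F G - mfps_subst F H \<in> mfps_ord (n + k - 1)"
proof (rule mfps_ordI)
  fix \<delta> :: "'w \<Rightarrow>\<^sub>0 nat" assume \<delta>: "monom_deg \<delta> < n + k - 1"
  let ?M = "monoms_upto V (monom_deg \<delta>)"
  have "mfps_coeff (mfps_subst F G - mfps_subst F H) \<delta> =
    (\<Sum>\<alpha>\<in>?M. mfps_coeff F \<alpha> * mfps_coeff (mfps_eval_monom G \<alpha> - mfps_eval_monom H \<alpha>) \<delta>)"
    using mfps_coeff_subst[where \<delta>=\<delta>, OF V F(1) G order.refl]
      mfps_coeff_subst[where \<delta>=\<delta>, OF V F(1) H(1) order.refl]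
    by (simp add: right_diff_distrib sum_subtractf)
  also have "\<dots> = 0"
  proof (intro sum.neutral ballI)
    fix \<alpha> assume "\<alpha> \<in> ?M"
    then have \<alpha>: "Poly_Mapping.keys \<alpha> \<subseteq> V" by (simp add: monoms_upto_def)
    show "mfps_coeff F \<alpha> * mfps_coeff (mfps_eval_monom G \<alpha> - mfps_eval_monom H \<alpha>) \<delta> = 0"
    proof (cases "monom_deg \<alpha> < k")
      case True
      then show ?thesis using mfps_ordD[OF F(2)] by simp
    next
      case False
      then show ?thesis
        using mfps_ordD[where \<alpha>=\<delta>, OF mfps_eval_monom_diff_ord[OF \<alpha> G H]] \<delta> by simp
    qed
  qed
  finally show "mfps_coeff (mfps_subst F G - mfps_subst F H) \<delta> = 0" .
qed

end

lemma mfps_subst_id: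
  fixes F :: "('v, 'b::comm_ring_1) mfps"
  assumes "finite V" "F \<in> mfps_over UNIV V"
  shows "mfps_subst F mfps_var = F"
proof (rule mfps_eqI)
  fix \<delta> :: "'v \<Rightarrow>\<^sub>0 nat"
  let ?M = "monoms_upto V (monom_deg \<delta>)"
  have "mfps_coeff (mfps_subst F mfps_var) \<delta> = (\<Sum>\<alpha>\<in>?M. if \<alpha> = \<delta> then mfps_coeff F \<alpha> else 0)"
    by (subst mfps_coeff_subst[OF assms mfps_var_ord order.refl], intro sum.cong)
      (auto simp: mfps_eval_monom_var mfps_coeff_monom)
  also have "\<dots> = (if \<delta> \<in> ?M then mfps_coeff F \<delta> else 0)"
    using assms(1) by (simp add: finite_monoms_upto)
  also have "\<dots> = mfps_coeff F \<delta>"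
    using assms(2) by (auto simp: monoms_upto_def mfps_over_iff)
  finally show "mfps_coeff (mfps_subst F mfps_var) \<delta> = mfps_coeff F \<delta>" .
qed

section \<open>Compositional inverses\<close>

text \<open>Tuples whose linear part is the identity. The constructed right inverses have this
  property again, so inversion can be applied twice.\<close>

definition unit_tuple :: "'v set \<Rightarrow> ('v \<Rightarrow> ('v, 'b::comm_ring_1) mfps) \<Rightarrow> bool" where
  "unit_tuple V l \<longleftrightarrow> (\<forall>v\<in>V. l v \<in> mfps_over UNIV V \<and> l v - mfps_var v \<in> mfps_ord 2)"

lemma unit_tuple_ord: "unit_tuple V l \<Longrightarrow> v \<in> V \<Longrightarrow> l v \<in> mfps_ord 1"
  using mfps_ord_add[OF mfps_ord_antimono[of "l v - mfps_var v" 2 1] mfps_var_ord[of v]]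
  by (simp add: unit_tuple_def)

context
  fixes V :: "'v set" and l :: "'v \<Rightarrow> ('v, 'b::comm_ring_1) mfps"
  assumes V: "finite V" and l: "unit_tuple V l"
begin

private definition r where "r v = l v - mfps_var v"

text \<open>Fixed point iteration: with l = \<tau> + r, the equation l(h) = \<tau> reads h = \<tau>
  - r(h). As r has order 2, each round settles one more degree. The value 0 outside \<open>V\<close>
  is the one demanded by \<open>mfps_tuples\<close>.\<close>

private primrec iter :: "nat \<Rightarrow> 'v \<Rightarrow> ('v, 'b) mfps" where
  "iter 0 = (\<lambda>v. 0)"
| "iter (Suc k) = (\<lambda>v. if v \<in> V then mfps_var v - mfps_subst (r v) (iter k) else 0)"

private lemma r: "v \<in> V \<Longrightarrow> r v \<in> mfps_over UNIV V" "v \<in> V \<Longrightarrow> r v \<in> mfps_ord 2"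
  using l by (auto simp: r_def unit_tuple_def intro: mfps_over_UNIV.diff_closed mfps_var_over)

private lemma iter: "iter k v \<in> mfps_over UNIV V \<and> iter k v \<in> mfps_ord 1"
proof (induction k arbitrary: v)
  case 0
  then show ?case by (simp add: mfps_ord_zero)
next
  case (Suc k)
  show ?case
  proof (cases "v \<in> V")
    case True
    have "mfps_subst (r v) (iter k) \<in> mfps_ord 2"
      using Suc True by (intro mfps_subst_ord[OF V] r) auto
    then have "mfps_var v - mfps_subst (r v) (iter k) \<in> mfps_ord 1"
      by (intro mfps_ord_diff mfps_var_ord) (rule mfps_ord_antimono, auto)
    moreover have "mfps_var v - mfps_subst (r v) (iter k) \<in> mfps_over UNIV V"
      using Suc True by (intro mfps_over_UNIV.diff_closed mfps_var_over mfps_subst_over[OF r(1)]) auto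
    ultimately show ?thesis using True by simp
  qed (simp add: mfps_ord_zero)
qed

private lemma iter_Suc_diff: "iter (Suc k) v - iter k v \<in> mfps_ord (Suc k)"
proof (induction k arbitrary: v)
  case 0
  then show ?case using iter[of "Suc 0" v] by simp
next
  case (Suc k)
  show ?case
  proof (cases "v \<in> V")
    case True
    have "mfps_subst (r v) (iter k) - mfps_subst (r v) (iter (Suc k)) \<in> mfps_ord (Suc k + 2 - 1)"
    proof (intro mfps_subst_diff_ord[OF V])
      fix v show "iter k v - iter (Suc k) v \<in> mfps_ord (Suc k)"
        using mfps_ord_uminus[OF Suc[of v]] by simp
    qed (use iter r True in \<open>auto simp del: iter.simps\<close>)
    then show ?thesis using True by (simp add: algebra_simps)
  qed (simp add: mfps_ord_zero)
qed

private lemma iter_diff: "iter (k + j) v - iter k v \<in> mfps_ord (Suc k)"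
proof (induction j)
  case (Suc j)
  have "(iter (Suc (k + j)) v - iter (k + j) v) + (iter (k + j) v - iter k v) \<in> mfps_ord (Suc k)"
    using iter_Suc_diff[of "k + j" v] Suc by (intro mfps_ord_add) (auto intro: mfps_ord_antimono)
  then show ?case by simp
qed (simp add: mfps_ord_zero)

lemma right_inverse_exists:
  obtains h where "unit_tuple V h" "h \<in> mfps_tuples V" "\<And>v. v \<in> V \<Longrightarrow> mfps_subst (l v) h = mfps_var v"
proof
  \<comment> \<open>The coefficients of degree d no longer change from iteration d on, so this
    diagonal choice is the limit of the iterates.\<close>
  define h where "h v = Abs_mfps (\<lambda>\<alpha>. mfps_coeff (iter (monom_deg \<alpha>) v) \<alpha>)" for v
  have h_iter: "h v - iter k v \<in> mfps_ord (Suc k)" for k v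
  proof (rule mfps_ordI)
    fix \<alpha> :: "'v \<Rightarrow>\<^sub>0 nat" assume "monom_deg \<alpha> < Suc k"
    then have "mfps_coeff (iter k v - iter (monom_deg \<alpha>) v) \<alpha> = 0"
      using mfps_ordD[OF iter_diff[of "monom_deg \<alpha>" "k - monom_deg \<alpha>" v], of \<alpha>] by simp
    then show "mfps_coeff (h v - iter k v) \<alpha> = 0" by (simp add: h_def)
  qed
  have h_over: "h v \<in> mfps_over UNIV V" for v
    using iter by (simp add: h_def mfps_over_iff)
  have h_ord: "h v \<in> mfps_ord 1" for v
    using h_iter[of v 0] by simp
  have fix_eq: "h v = mfps_var v - mfps_subst (r v) h" if v: "v \<in> V" for v
  proof (rule mfps_eqI_ord)
    fix n
    \<comment> \<open>Agreement of h with \<open>iter n\<close> through degree n gives agreement of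
      r(h) with r(\<open>iter n\<close>) one degree further; letting n grow turns the recursion into
      the fixed point equation.\<close>
    have "mfps_subst (r v) h - mfps_subst (r v) (iter n) \<in> mfps_ord (Suc n + 2 - 1)"
      using v iter h_ord h_iter r by (intro mfps_subst_diff_ord[OF V]) auto
    then have "(h v - iter (Suc n) v) + (mfps_subst (r v) h - mfps_subst (r v) (iter n)) \<in> mfps_ord n"
      using h_iter[of v "Suc n"] by (intro mfps_ord_add) (auto intro: mfps_ord_antimono)
    then show "h v - (mfps_var v - mfps_subst (r v) h) \<in> mfps_ord n"
      using v by (simp add: algebra_simps)
  qed
  show "unit_tuple V h"
    unfolding unit_tuple_def
  proof (intro ballI conjI h_over)
    fix v assume v: "v \<in> V"
    have "mfps_subst (r v) h \<in> mfps_ord 2"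
      using h_ord v by (intro mfps_subst_ord[OF V] r) auto
    then show "h v - mfps_var v \<in> mfps_ord 2"
      by (subst fix_eq[OF v]) (simp add: mfps_ord_uminus)
  qed
  have "iter k v = 0" if "v \<notin> V" for k v
    using that by (cases k) auto
  then show "h \<in> mfps_tuples V"
    using h_over h_ord
    by (auto simp: mfps_tuples_def h_def mfps_ord_1_iff simp del: One_nat_def intro!: mfps_eqI)
  fix v assume v: "v \<in> V"
  have "mfps_subst (mfps_var v + r v) h = mfps_subst (mfps_var v) h + mfps_subst (r v) h"
    using h_ord r v by (intro mfps_subst_add[OF V]) (auto intro: mfps_var_over)
  also have "\<dots> = mfps_var v"
    using mfps_subst_var[OF V h_ord v] fix_eq[OF v] by (simp add: algebra_simps)
  finally show "mfps_subst (l v) h = mfps_var v" by (simp add: r_def)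
qed

end

text \<open>A right inverse h of l has a right inverse k of its own, and k = l(h(k)) = l by
  associativity, so h is two-sided. Any other inverse g satisfies g = g(l(h)) = h. This justifies
  the definite description in \<open>comp_inverse\<close>.\<close>

lemma comp_inverse_props:
  fixes l :: "'v \<Rightarrow> ('v, 'b::comm_ring_1) mfps"
  assumes V: "finite V" and l: "unit_tuple V l"
  shows "comp_inverse V l \<in> mfps_tuples V"
    and "v \<in> V \<Longrightarrow> mfps_subst (l v) (comp_inverse V l) = mfps_var v"
proof -
  have tuple_ord: "h v \<in> mfps_ord 1" "h v \<in> mfps_over UNIV V"
    if "h \<in> mfps_tuples V" "v \<in> V" for h :: "'v \<Rightarrow> ('v, 'b) mfps" and v
    using that by (auto simp: mfps_tuples_def mfps_ord_1_iff simp del: One_nat_def)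
  obtain h where h: "unit_tuple V h" "h \<in> mfps_tuples V" "\<And>v. v \<in> V \<Longrightarrow> mfps_subst (l v) h = mfps_var v"
    using right_inverse_exists[OF V l] by blast
  obtain k where k: "unit_tuple V k" "\<And>v. v \<in> V \<Longrightarrow> mfps_subst (h v) k = mfps_var v"
    using right_inverse_exists[OF V h(1)] by blast
  have over: "l v \<in> mfps_over UNIV V" "h v \<in> mfps_over UNIV V" "k v \<in> mfps_over UNIV V" if "v \<in> V" for v
    using that l h(1) k(1) by (auto simp: unit_tuple_def)
  note ord = unit_tuple_ord[OF l] unit_tuple_ord[OF h(1)] unit_tuple_ord[OF k(1)]
  have "k v = l v" if v: "v \<in> V" for v
  proof -
    have "k v = mfps_subst (mfps_subst (l v) h) k"
      using mfps_subst_var[OF V ord(3) v] h(3)[OF v] by simp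
    also have "\<dots> = mfps_subst (l v) (\<lambda>u. mfps_subst (h u) k)"
      using v over ord by (intro mfps_subst_assoc[OF V _ V])
    also have "\<dots> = mfps_subst (l v) mfps_var"
      using k(2) v over by (intro mfps_subst_cong[of _ V]) auto
    also have "\<dots> = l v"
      using v over by (intro mfps_subst_id[OF V])
    finally show ?thesis .
  qed
  then have hl: "mfps_subst (h v) l = mfps_var v" if "v \<in> V" for v
    using mfps_subst_cong[of "h v" V k l] over k(2) that by simp
  have "\<exists>!h. h \<in> mfps_tuples V \<and> (\<forall>v\<in>V. mfps_subst (l v) h = mfps_var v \<and> mfps_subst (h v) l = mfps_var v)"
  proof (rule ex1I[of _ h])
    show "h \<in> mfps_tuples V \<and> (\<forall>v\<in>V. mfps_subst (l v) h = mfps_var v \<and> mfps_subst (h v) l = mfps_var v)"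
      using h hl by blast
    fix g assume g: "g \<in> mfps_tuples V \<and> (\<forall>v\<in>V. mfps_subst (l v) g = mfps_var v \<and> mfps_subst (g v) l = mfps_var v)"
    show "g = h"
    proof
      fix v show "g v = h v"
      proof (cases "v \<in> V")
        case True
        have "g v = mfps_subst (g v) mfps_var"
          using g True tuple_ord by (intro mfps_subst_id[OF V, symmetric]) auto
        also have "\<dots> = mfps_subst (g v) (\<lambda>u. mfps_subst (l u) h)"
          using g True tuple_ord h(3) by (intro mfps_subst_cong[of _ V]) auto
        also have "\<dots> = mfps_subst (mfps_subst (g v) l) h"
          using g True tuple_ord over ord by (intro mfps_subst_assoc[OF V _ V, symmetric]) auto
        also have "\<dots> = h v"
          using g True mfps_subst_var[OF V ord(2) True] by simp
        finally show ?thesis .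
      next
        case False
        then show ?thesis using g h(2) by (simp add: mfps_tuples_def)
      qed
    qed
  qed
  from theI'[OF this] show "comp_inverse V l \<in> mfps_tuples V"
    and "v \<in> V \<Longrightarrow> mfps_subst (l v) (comp_inverse V l) = mfps_var v"
    unfolding comp_inverse_def by blast+
qed

section \<open>Frobenius lifts on power series\<close>

definition ring_hom_fun :: "('a::comm_ring_1 \<Rightarrow> 'b::comm_ring_1) \<Rightarrow> bool" where
  "ring_hom_fun \<phi> \<longleftrightarrow> \<phi> 1 = 1 \<and> (\<forall>x y. \<phi> (x + y) = \<phi> x + \<phi> y) \<and> (\<forall>x y. \<phi> (x * y) = \<phi> x * \<phi> y)"

context
  fixes \<phi> :: "'a::comm_ring_1 \<Rightarrow> 'b::comm_ring_1"
  assumes hom: "ring_hom_fun \<phi>"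
begin

lemma ring_hom_fun_one: "\<phi> 1 = 1"
  and ring_hom_fun_add: "\<phi> (x + y) = \<phi> x + \<phi> y"
  and ring_hom_fun_mult: "\<phi> (x * y) = \<phi> x * \<phi> y"
  using hom by (auto simp: ring_hom_fun_def)

lemma ring_hom_fun_zero: "\<phi> 0 = 0"
  using ring_hom_fun_add[of 0 0] by simp

lemma ring_hom_fun_diff: "\<phi> (x - y) = \<phi> x - \<phi> y"
  using ring_hom_fun_add[of "x - y" y] by (simp add: algebra_simps)

lemma ring_hom_fun_sum: "\<phi> (sum g I) = (\<Sum>i\<in>I. \<phi> (g i))"
  by (induction I rule: infinite_finite_induct) (auto simp: ring_hom_fun_zero ring_hom_fun_add)

lemma ring_hom_fun_power: "\<phi> (x ^ n) = \<phi> x ^ n"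
  by (induction n) (auto simp: ring_hom_fun_one ring_hom_fun_mult)

lemma ring_hom_fun_of_nat: "\<phi> (of_nat n) = of_nat n"
  by (induction n) (auto simp: ring_hom_fun_zero ring_hom_fun_one ring_hom_fun_add)

end

lemma ring_hom_fun_funpow: "ring_hom_fun \<sigma> \<Longrightarrow> ring_hom_fun (\<sigma> ^^ n)" for \<sigma> :: "'a::comm_ring_1 \<Rightarrow> 'a"
  by (induction n) (auto simp: ring_hom_fun_def)

section \<open>Scaling of exponents and the Frobenius lift\<close>

definition monom_scale :: "nat \<Rightarrow> ('v \<Rightarrow>\<^sub>0 nat) \<Rightarrow> 'v \<Rightarrow>\<^sub>0 nat" where
  "monom_scale q \<alpha> = Poly_Mapping.map ((*) q) \<alpha>"

lemma lookup_monom_scale: "Poly_Mapping.lookup (monom_scale q \<alpha>) v = q * Poly_Mapping.lookup \<alpha> v"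
  by (simp add: monom_scale_def map.rep_eq when_def)

lemma monom_scale_add: "monom_scale q (\<alpha> + \<beta>) = monom_scale q \<alpha> + monom_scale q \<beta>"
  by (intro poly_mapping_eqI) (simp add: lookup_monom_scale lookup_add distrib_left)

lemma monom_scale_Suc: "monom_scale (Suc q) \<alpha> = \<alpha> + monom_scale q \<alpha>"
  by (intro poly_mapping_eqI) (simp add: lookup_monom_scale lookup_add)

lemma monom_scale_0 [simp]: "monom_scale 0 \<alpha> = 0" "monom_scale q 0 = 0"
  by (intro poly_mapping_eqI; simp add: lookup_monom_scale)+

lemma monom_scale_single: "monom_scale q (Poly_Mapping.single v k) = Poly_Mapping.single v (q * k)"
  by (intro poly_mapping_eqI) (simp add: lookup_monom_scale lookup_single when_def)

lemma monom_deg_scale: "monom_deg (monom_scale q \<alpha>) = q * monom_deg \<alpha>"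
  by (induction q) (simp_all add: monom_scale_Suc monom_deg_add)

lemma monom_scale_inject: "0 < q \<Longrightarrow> monom_scale q \<alpha> = monom_scale q \<beta> \<longleftrightarrow> \<alpha> = \<beta>"
  by (auto simp: poly_mapping_eq_iff fun_eq_iff lookup_monom_scale)

lemma mfps_monom_power:
  "mfps_monom c \<alpha> ^ q = mfps_monom (c ^ q) (monom_scale q \<alpha>)" for c :: "'b::comm_ring_1"
  by (induction q) (simp_all add: mfps_one_eq_monom mfps_monom_mult monom_scale_Suc)

text \<open>The ring endomorphism that acts by \<open>\<sigma>\<close> on coefficients and sends
  every variable to its q-th power. For positive \<open>q\<close> an exponent has at most one
  quotient by \<open>q\<close>, so the description under \<open>THE\<close> is unique.\<close>

definition mfps_frob :: "nat \<Rightarrow> ('b::comm_ring_1 \<Rightarrow> 'b) \<Rightarrow> ('v, 'b) mfps \<Rightarrow> ('v, 'b) mfps" where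
  "mfps_frob q \<sigma> F = Abs_mfps (\<lambda>\<delta>. if \<exists>\<beta>. \<delta> = monom_scale q \<beta>
     then \<sigma> (mfps_coeff F (THE \<beta>. \<delta> = monom_scale q \<beta>)) else 0)"

context
  fixes q :: nat and \<sigma> :: "'b::comm_ring_1 \<Rightarrow> 'b"
  assumes q: "0 < q" and \<sigma>: "ring_hom_fun \<sigma>"
begin

lemma mfps_coeff_frob_scale: "mfps_coeff (mfps_frob q \<sigma> F) (monom_scale q \<beta>) = \<sigma> (mfps_coeff F \<beta>)"
  by (auto simp: mfps_frob_def monom_scale_inject[OF q])

lemma mfps_coeff_frob_eq_0:
  "(\<And>\<beta>. \<delta> \<noteq> monom_scale q \<beta>) \<Longrightarrow> mfps_coeff (mfps_frob q \<sigma> F) \<delta> = 0"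
  by (auto simp: mfps_frob_def)

lemma mfps_frob_monom: "mfps_frob q \<sigma> (mfps_monom c \<alpha>) = mfps_monom (\<sigma> c) (monom_scale q \<alpha>)"
proof (rule mfps_eqI)
  fix \<delta>
  show "mfps_coeff (mfps_frob q \<sigma> (mfps_monom c \<alpha>)) \<delta> = mfps_coeff (mfps_monom (\<sigma> c) (monom_scale q \<alpha>)) \<delta>"
    by (cases "\<exists>\<beta>. \<delta> = monom_scale q \<beta>")
      (auto simp: mfps_coeff_frob_scale mfps_coeff_monom monom_scale_inject[OF q]
        ring_hom_fun_zero[OF \<sigma>] mfps_coeff_frob_eq_0)
qed

lemma mfps_frob_const: "mfps_frob q \<sigma> (mfps_const c) = mfps_const (\<sigma> c)"
  by (simp add: mfps_const_eq_monom mfps_frob_monom)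

lemma mfps_frob_var: "mfps_frob q \<sigma> (mfps_var v) = mfps_var v ^ q"
  unfolding mfps_var_power
  by (simp add: mfps_var_eq_monom mfps_frob_monom monom_scale_single ring_hom_fun_one[OF \<sigma>])

text \<open>This growth of the order later pushes the Frobenius terms of the functional equation
  beyond the degree under consideration.\<close>

lemma mfps_frob_ord:
  fixes F :: "('v, 'b) mfps"
  assumes "F \<in> mfps_ord n"
  shows "mfps_frob q \<sigma> F \<in> mfps_ord (q * n)"
proof (rule mfps_ordI)
  fix \<delta> :: "'v \<Rightarrow>\<^sub>0 nat" assume "monom_deg \<delta> < q * n"
  then show "mfps_coeff (mfps_frob q \<sigma> F) \<delta> = 0"
    by (cases "\<exists>\<beta>. \<delta> = monom_scale q \<beta>")
      (auto simp: mfps_coeff_frob_scale mfps_coeff_frob_eq_0 monom_deg_scale mfps_ordD[OF assms]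
        ring_hom_fun_zero[OF \<sigma>])
qed

text \<open>For products: a factorisation of the monomial \<open>\<delta>\<close> contributes only
  if both exponents are multiples of \<open>q\<close>. Such factorisations correspond bijectively to
  those of the quotient of \<open>\<delta>\<close> by \<open>q\<close>, and there are none when
  \<open>\<delta>\<close> is not a multiple.\<close>

lemma ring_hom_fun_mfps_frob: "ring_hom_fun (mfps_frob q \<sigma> :: ('v, 'b) mfps \<Rightarrow> _)"
  unfolding ring_hom_fun_def
proof (intro conjI allI)
  show "mfps_frob q \<sigma> (1 :: ('v, 'b) mfps) = 1"
    using mfps_frob_const[of 1] by (simp add: ring_hom_fun_one[OF \<sigma>])
  fix F G :: "('v, 'b) mfps"
  show "mfps_frob q \<sigma> (F + G) = mfps_frob q \<sigma> F + mfps_frob q \<sigma> G"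
  proof (rule mfps_eqI)
    fix \<delta>
    show "mfps_coeff (mfps_frob q \<sigma> (F + G)) \<delta> = mfps_coeff (mfps_frob q \<sigma> F + mfps_frob q \<sigma> G) \<delta>"
      by (cases "\<exists>\<beta>. \<delta> = monom_scale q \<beta>")
        (auto simp: mfps_coeff_frob_scale mfps_coeff_frob_eq_0 ring_hom_fun_add[OF \<sigma>])
  qed
  show "mfps_frob q \<sigma> (F * G) = mfps_frob q \<sigma> F * mfps_frob q \<sigma> G"
  proof (rule mfps_eqI)
    fix \<delta> :: "'v \<Rightarrow>\<^sub>0 nat"
    let ?t = "\<lambda>(\<epsilon>, \<eta>). mfps_coeff (mfps_frob q \<sigma> F) \<epsilon> * mfps_coeff (mfps_frob q \<sigma> G) \<eta>"
    have t: "\<exists>\<beta> \<gamma>. z = (monom_scale q \<beta>, monom_scale q \<gamma>)" if "?t z \<noteq> 0" for z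
    proof -
      obtain \<epsilon> \<eta> where z: "z = (\<epsilon>, \<eta>)" by fastforce
      then have "mfps_coeff (mfps_frob q \<sigma> F) \<epsilon> \<noteq> 0" "mfps_coeff (mfps_frob q \<sigma> G) \<eta> \<noteq> 0"
        using that by auto
      then obtain \<beta> \<gamma> where "\<epsilon> = monom_scale q \<beta>" "\<eta> = monom_scale q \<gamma>"
        using mfps_coeff_frob_eq_0[of \<epsilon> F] mfps_coeff_frob_eq_0[of \<eta> G] by metis
      then show ?thesis using z by auto
    qed
    have frob: "mfps_coeff (mfps_frob q \<sigma> F * mfps_frob q \<sigma> G) \<delta> = (\<Sum>z | fst z + snd z = \<delta>. ?t z)"
      by (simp add: mfps_coeff_mult case_prod_unfold)
    show "mfps_coeff (mfps_frob q \<sigma> (F * G)) \<delta> = mfps_coeff (mfps_frob q \<sigma> F * mfps_frob q \<sigma> G) \<delta>"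
    proof (cases "\<exists>\<alpha>. \<delta> = monom_scale q \<alpha>")
      case True
      then obtain \<alpha> where \<alpha>: "\<delta> = monom_scale q \<alpha>" by blast
      let ?h = "\<lambda>(\<beta>, \<gamma>). (monom_scale q \<beta>, monom_scale q \<gamma>)"
      have "(\<Sum>z | fst z + snd z = \<delta>. ?t z) = (\<Sum>z \<in> ?h ` {(\<beta>, \<gamma>). \<beta> + \<gamma> = \<alpha>}. ?t z)"
      proof (rule sum.mono_neutral_right)
        show "finite {z. fst z + snd z = \<delta>}"
          using finite_monomial_factors[of \<delta>] by (simp add: case_prod_unfold)
        show "?h ` {(\<beta>, \<gamma>). \<beta> + \<gamma> = \<alpha>} \<subseteq> {z. fst z + snd z = \<delta>}"
          unfolding \<alpha> by (auto simp only: monom_scale_add fst_conv snd_conv)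
        show "\<forall>z\<in>{z. fst z + snd z = \<delta>} - ?h ` {(\<beta>, \<gamma>). \<beta> + \<gamma> = \<alpha>}. ?t z = 0"
        proof
          fix z assume z: "z \<in> {z. fst z + snd z = \<delta>} - ?h ` {(\<beta>, \<gamma>). \<beta> + \<gamma> = \<alpha>}"
          show "?t z = 0"
          proof (rule ccontr)
            assume "?t z \<noteq> 0"
            then obtain \<beta> \<gamma> where \<beta>\<gamma>: "z = (monom_scale q \<beta>, monom_scale q \<gamma>)" using t by blast
            have "fst z + snd z = \<delta>" "z \<notin> ?h ` {(\<beta>, \<gamma>). \<beta> + \<gamma> = \<alpha>}" using z by auto
            then have "monom_scale q (\<beta> + \<gamma>) = monom_scale q \<alpha>"
              unfolding \<beta>\<gamma> \<alpha> monom_scale_add by simp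
            then have "\<beta> + \<gamma> = \<alpha>" unfolding monom_scale_inject[OF q] .
            then have "z \<in> ?h ` {(\<beta>, \<gamma>). \<beta> + \<gamma> = \<alpha>}"
              by (intro image_eqI[of _ _ "(\<beta>, \<gamma>)"]) (auto simp: \<beta>\<gamma>)
            with \<open>z \<notin> _\<close> show False by contradiction
          qed
        qed
      qed
      also have "\<dots> = (\<Sum>z \<in> {(\<beta>, \<gamma>). \<beta> + \<gamma> = \<alpha>}. ?t (?h z))"
        by (intro sum.reindex_cong[OF _ refl refl] inj_onI) (auto simp: monom_scale_inject[OF q])
      also have "\<dots> = \<sigma> (mfps_coeff (F * G) \<alpha>)"
        unfolding mfps_coeff_mult ring_hom_fun_sum[OF \<sigma>]
        by (intro sum.cong) (auto simp: mfps_coeff_frob_scale ring_hom_fun_mult[OF \<sigma>])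
      also have "\<dots> = mfps_coeff (mfps_frob q \<sigma> (F * G)) \<delta>"
        unfolding \<alpha> by (rule mfps_coeff_frob_scale[symmetric])
      finally show ?thesis unfolding frob by (rule sym)
    next
      case False
      have "(\<Sum>z | fst z + snd z = \<delta>. ?t z) = 0"
      proof (intro sum.neutral ballI)
        fix z assume z: "z \<in> {z. fst z + snd z = \<delta>}"
        show "?t z = 0"
        proof (rule ccontr)
          assume "?t z \<noteq> 0"
          then obtain \<beta> \<gamma> where "z = (monom_scale q \<beta>, monom_scale q \<gamma>)" using t by blast
          then have "\<delta> = monom_scale q (\<beta> + \<gamma>)" using z by (simp add: monom_scale_add)
          then show False using False by blast
        qed
      qed
      then show ?thesis unfolding frob using False by (simp add: mfps_coeff_frob_eq_0)
    qed
  qed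
qed

end

text \<open>Division by p^t m, with m a unit of \<open>S\<close>, costs t powers of p. The inverse
  \<open>c\<close> itself may lie only in the ambient ring.\<close>

lemma (in subring_set) pow_multiples_recip:
  assumes y: "y \<in> pow_multiples p S (r + t)" and c: "of_nat (p ^ t * m) * c = 1"
    and d: "d \<in> S" "of_nat m * d = 1"
  shows "c * y \<in> pow_multiples p S r"
proof -
  obtain s where s: "s \<in> S" "y = of_nat p ^ (r + t) * s" using y by (auto simp: pow_multiples_def)
  have "c * y = (c * of_nat p ^ t) * (of_nat m * d) * of_nat p ^ r * s"
    using s d by (simp add: power_add ac_simps)
  also have "\<dots> = (of_nat (p ^ t * m) * c) * (of_nat p ^ r * (d * s))"
    by (simp add: ac_simps)
  also have "\<dots> = of_nat p ^ r * (d * s)" by (simp only: c mult_1)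
  finally show ?thesis using s d by (intro pow_multiplesI[of "d * s"]) (auto intro: mult_closed)
qed

lemma mfps_const_pow_multiples:
  assumes "subring_set A" "a \<in> pow_multiples p A r"
  shows "mfps_const a \<in> pow_multiples p (mfps_over A UNIV) r"
proof -
  interpret subring_set A by fact
  obtain s where "s \<in> A" "a = of_nat p ^ r * s" using assms(2) by (auto simp: pow_multiples_def)
  then show ?thesis
    by (auto simp: pow_multiples_def mfps_const_mult mfps_const_power mfps_const_of_nat
        mfps_over_def mfps_coeff_const intro!: exI[of _ "mfps_const s"])
qed

section \<open>A functional equation lemma\<close>

text \<open>
  A version of Hazewinkel's functional equation lemma for the logarithm
  \<open>l\<^sub>u(\<tau>) = \<Sum>\<^sub>m 1/m \<Sum>\<^sub>v b\<^sub>m(u, v) \<tau>\<^sub>v\<^sup>m\<close>, where \<open>recip m\<close> is \<open>1/m\<close>. The congruences say that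
  \<open>l(\<tau>) - \<Sum>\<^sub>i p\<^sup>-\<^sup>i \<gamma>\<^sub>i \<sigma>\<^sup>i(l)(\<tau>\<^sup>p\<^sup>^\<^sup>i)\<close> has coefficients in \<open>A\<close>.
\<close>

locale functional_equation =
  fixes p :: nat and A :: "'k::comm_ring_1 set" and \<sigma> :: "'k \<Rightarrow> 'k" and recip :: "nat \<Rightarrow> 'k"
    and J :: "'v set" and b \<gamma> :: "nat \<Rightarrow> 'v \<Rightarrow> 'v \<Rightarrow> 'k" and l :: "'v \<Rightarrow> ('v, 'k) mfps"
  assumes p: "prime p" and A: "subring_set A"
    and \<sigma>: "ring_hom_fun \<sigma>" "\<And>a. a \<in> A \<Longrightarrow> \<sigma> a \<in> A" "\<And>a. a \<in> A \<Longrightarrow> \<sigma> a - a ^ p \<in> pow_multiples p A 1"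
    and recip: "\<And>n. 0 < n \<Longrightarrow> of_nat n * recip n = 1" "\<And>n. \<not> p dvd n \<Longrightarrow> recip n \<in> A"
    and J: "finite J"
    and b_closed: "\<And>m u v. u \<in> J \<Longrightarrow> v \<in> J \<Longrightarrow> b m u v \<in> A"
    and b_1: "\<And>u v. u \<in> J \<Longrightarrow> v \<in> J \<Longrightarrow> b 1 u v = (if u = v then 1 else 0)"
    and \<gamma>: "\<And>i u w. 0 < i \<Longrightarrow> u \<in> J \<Longrightarrow> w \<in> J \<Longrightarrow> \<gamma> i u w \<in> pow_multiples p A (i - 1)"
    and b_cong: "\<And>m s u v. 0 < m \<Longrightarrow> u \<in> J \<Longrightarrow> v \<in> J \<Longrightarrow>
      b (m * p ^ s) u v - (\<Sum>i=1..s. \<Sum>w\<in>J. \<gamma> i u w * (\<sigma> ^^ i) (b (m * p ^ (s - i)) w v))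
        \<in> pow_multiples p A s"
    and l_over: "\<And>u. u \<in> J \<Longrightarrow> l u \<in> mfps_over UNIV J"
    and l_trunc: "\<And>u N. u \<in> J \<Longrightarrow>
      l u - (\<Sum>m=1..N. \<Sum>v\<in>J. mfps_const (recip m * b m u v) * mfps_var v ^ m) \<in> mfps_ord (Suc N)"
begin

sublocale A: subring_set A by (rule A)

abbreviation integral_mfps :: "('w, 'k) mfps set" where
  "integral_mfps \<equiv> mfps_over A UNIV"

sublocale S: subring_set "integral_mfps :: ('w, 'k) mfps set"
  by (intro subring_set_mfps_over A)

lemma recip_unique: "0 < n \<Longrightarrow> of_nat n * x = 1 \<Longrightarrow> x = recip n"
  using recip(1)[of n] by (metis mult.assoc mult.commute mult_1)

lemma recip_mult: "0 < m \<Longrightarrow> 0 < n \<Longrightarrow> recip (m * n) = recip m * recip n"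
proof (rule recip_unique[symmetric])
  assume mn: "0 < m" "0 < n"
  have "of_nat (m * n) * (recip m * recip n) = (of_nat m * recip m) * (of_nat n * recip n)"
    by (simp add: ac_simps)
  then show "of_nat (m * n) * (recip m * recip n) = 1" using mn by (simp add: recip(1))
qed simp

lemma recip_1: "recip 1 = 1"
  using recip_unique[of 1 1] by simp

lemma hom_recip:
  assumes "ring_hom_fun \<phi>" "0 < n"
  shows "\<phi> (recip n) = recip n"
proof (rule recip_unique[OF assms(2)])
  have "of_nat n * \<phi> (recip n) = \<phi> (of_nat n * recip n)"
    by (simp add: ring_hom_fun_mult[OF assms(1)] ring_hom_fun_of_nat[OF assms(1)])
  then show "of_nat n * \<phi> (recip n) = 1"
    by (simp add: recip(1)[OF assms(2)] ring_hom_fun_one[OF assms(1)])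
qed

lemma unit_tuple_l: "unit_tuple J l"
  unfolding unit_tuple_def
proof (intro ballI conjI l_over)
  fix u assume u: "u \<in> J"
  have "(\<Sum>v\<in>J. mfps_const (recip 1 * b 1 u v) * mfps_var v ^ 1) =
      (\<Sum>v\<in>J. if v = u then mfps_var u else 0)"
    using u by (intro sum.cong) (auto simp: b_1 recip_1 simp del: One_nat_def)
  also have "\<dots> = mfps_var u" using u J by simp
  finally show "l u - mfps_var u \<in> mfps_ord 2"
    using l_trunc[OF u, of 1] by (simp add: numeral_2_eq_2)
qed

text \<open>Makes the infinite series \<open>l(G)\<close> accessible, degree by degree, through
  finite sums of powers of the \<open>G v\<close>.\<close>

lemma subst_l_trunc:
  fixes G :: "'v \<Rightarrow> ('w, 'k) mfps"
  assumes u: "u \<in> J" and G: "\<And>v. v \<in> J \<Longrightarrow> G v \<in> mfps_ord 1"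
  shows "mfps_subst (l u) G - (\<Sum>m=1..N. \<Sum>v\<in>J. mfps_const (recip m * b m u v) * G v ^ m)
    \<in> mfps_ord (Suc N)"
proof -
  let ?t = "\<Sum>m=1..N. \<Sum>v\<in>J. mfps_const (recip m * b m u v) * mfps_var v ^ m"
  have over: "mfps_const c * mfps_var v ^ m \<in> mfps_over UNIV J" if "v \<in> J" for c :: 'k and v m
    using that by (intro mfps_over_UNIV.mult_closed mfps_over_UNIV.power_closed mfps_var_over) auto
  have t: "?t \<in> mfps_over UNIV J"
    by (intro mfps_over_UNIV.sum_closed over)
  have "mfps_subst ?t G = (\<Sum>m=1..N. \<Sum>v\<in>J. mfps_const (recip m * b m u v) * G v ^ m)"
  proof -
    have "mfps_subst (mfps_const c * mfps_var v ^ m) G = mfps_const c * G v ^ m" if v: "v \<in> J" for c v m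
      using v by (simp add: mfps_subst_mult[OF J G] mfps_subst_power[OF J G] mfps_subst_var[OF J G]
          mfps_subst_const[OF J G] mfps_var_over mfps_over_UNIV.power_closed)
    then show ?thesis
      by (simp add: mfps_subst_sum[OF J G] over mfps_over_UNIV.sum_closed)
  qed
  moreover have "mfps_subst (l u - ?t) G = mfps_subst (l u) G - mfps_subst ?t G"
    by (intro mfps_subst_diff[OF J G] l_over t u)
  moreover have "mfps_subst (l u - ?t) G \<in> mfps_ord (Suc N)"
    by (intro mfps_subst_ord[OF J G] mfps_over_UNIV.diff_closed l_over t u l_trunc)
  ultimately show ?thesis by simp
qed

text \<open>Only the p-part of n costs anything: the cofactor prime to p is a unit of
  \<open>A\<close>.\<close>

lemma recip_mfps:
  fixes y :: "('w, 'k) mfps"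
  assumes "0 < n" "y \<in> pow_multiples p integral_mfps (r + multiplicity p n)"
  shows "mfps_const (recip n) * y \<in> pow_multiples p integral_mfps r"
proof -
  have "n \<noteq> 0" "\<not> is_unit p" using assms(1) p by (auto simp: not_prime_unit)
  from multiplicity_decompose'[OF this]
  obtain m where m: "n = p ^ multiplicity p n * m" "\<not> p dvd m" .
  then have "0 < m" using assms(1) by (auto intro: gr0I)
  have "of_nat (p ^ multiplicity p n * m) * mfps_const (recip n) = (1 :: ('w, 'k) mfps)"
    unfolding m(1)[symmetric] mfps_const_of_nat[symmetric] mfps_const_mult[symmetric]
    by (simp add: recip(1)[OF assms(1)])
  moreover have "mfps_const (recip m) \<in> integral_mfps"
    using recip(2)[OF m(2)] by (auto simp: mfps_over_def mfps_coeff_const)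
  moreover have "of_nat m * mfps_const (recip m) = (1 :: ('w, 'k) mfps)"
    unfolding mfps_const_of_nat[symmetric] mfps_const_mult[symmetric]
    by (simp add: recip(1)[OF \<open>0 < m\<close>])
  ultimately show ?thesis by (rule S.pow_multiples_recip[OF assms(2)])
qed

text \<open>Modulo p the power p^i distributes over the sum of monomials, and on a single monomial
  it differs from the lift only by c^(p^i) against \<sigma>^i(c). The series has to be a finite sum
  here, which is why truncations are used below.\<close>

lemma frob_cong:
  fixes H :: "('w, 'k) mfps"
  assumes "finite I" "H = (\<Sum>\<alpha>\<in>I. mfps_monom (c \<alpha>) \<alpha>)" "\<And>\<alpha>. \<alpha> \<in> I \<Longrightarrow> c \<alpha> \<in> A"
  shows "H ^ (p ^ i) - mfps_frob (p ^ i) (\<sigma> ^^ i) H \<in> pow_multiples p integral_mfps 1"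
    and "H \<in> integral_mfps" and "mfps_frob (p ^ i) (\<sigma> ^^ i) H \<in> integral_mfps"
proof -
  let ?q = "p ^ i" and ?s = "\<sigma> ^^ i"
  have q: "0 < ?q" using p by (simp add: prime_gt_0_nat)
  have s: "ring_hom_fun ?s" by (intro ring_hom_fun_funpow \<sigma>)
  have monom: "mfps_monom a \<alpha> \<in> integral_mfps" if "a \<in> A" for a and \<alpha> :: "'w \<Rightarrow>\<^sub>0 nat"
    using that by (auto simp: mfps_over_def mfps_coeff_monom)
  have s_closed: "?s a \<in> A \<and> a ^ ?q - ?s a \<in> pow_multiples p A 1" if "a \<in> A" for a
    using that \<sigma> by (intro A.frobenius_funpow_cong) auto
  have frob: "mfps_frob ?q ?s H = (\<Sum>\<alpha>\<in>I. mfps_monom (?s (c \<alpha>)) (monom_scale ?q \<alpha>))"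
    unfolding assms(2) by (simp add: ring_hom_fun_sum[OF ring_hom_fun_mfps_frob[OF q s]] mfps_frob_monom[OF q s])
  show "H \<in> integral_mfps"
    unfolding assms(2) by (intro S.sum_closed monom assms(3))
  show "mfps_frob ?q ?s H \<in> integral_mfps"
    unfolding frob using s_closed assms(3) by (intro S.sum_closed monom) auto
  have "H ^ ?q - (\<Sum>\<alpha>\<in>I. mfps_monom (c \<alpha>) \<alpha> ^ ?q) \<in> pow_multiples p integral_mfps 1"
    unfolding assms(2) using assms(1,3) p by (intro S.prime_power_power_sum_cong monom) auto
  moreover have "(\<Sum>\<alpha>\<in>I. mfps_monom (c \<alpha>) \<alpha> ^ ?q) - mfps_frob ?q ?s H \<in> pow_multiples p integral_mfps 1"
  proof -
    have "(\<Sum>\<alpha>\<in>I. mfps_monom (c \<alpha>) \<alpha> ^ ?q) - mfps_frob ?q ?s H =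
      (\<Sum>\<alpha>\<in>I. mfps_const (c \<alpha> ^ ?q - ?s (c \<alpha>)) * mfps_monom 1 (monom_scale ?q \<alpha>))"
      by (simp add: frob mfps_monom_power mfps_const_eq_monom mfps_monom_mult flip: sum_subtractf)
        (auto intro!: sum.cong mfps_eqI simp: mfps_coeff_monom)
    also have "\<dots> \<in> pow_multiples p integral_mfps 1"
      using s_closed assms(3)
      by (intro S.pow_multiples_sum S.pow_multiples_mult_right monom A.one_closed
          mfps_const_pow_multiples[OF A]) auto
    finally show ?thesis .
  qed
  ultimately have "H ^ ?q - (\<Sum>\<alpha>\<in>I. mfps_monom (c \<alpha>) \<alpha> ^ ?q) +
      ((\<Sum>\<alpha>\<in>I. mfps_monom (c \<alpha>) \<alpha> ^ ?q) - mfps_frob ?q ?s H) \<in> pow_multiples p integral_mfps 1"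
    by (rule S.pow_multiples_add)
  then show "H ^ ?q - mfps_frob ?q ?s H \<in> pow_multiples p integral_mfps 1" by simp
qed

text \<open>The terms of l(X) + l(Y) - l(H) with m up to \<open>N\<close>. It measures how far
  \<open>H\<close> is from being the formal sum of \<open>X\<close> and \<open>Y\<close>.\<close>

definition log_defect ::
  "('v \<Rightarrow> ('w, 'k) mfps) \<Rightarrow> ('v \<Rightarrow> ('w, 'k) mfps) \<Rightarrow> ('v \<Rightarrow> ('w, 'k) mfps) \<Rightarrow> nat \<Rightarrow> 'v \<Rightarrow> ('w, 'k) mfps"
  where "log_defect X Y H N u =
    (\<Sum>m=1..N. \<Sum>v\<in>J. mfps_const (recip m * b m u v) * (X v ^ m + Y v ^ m - H v ^ m))"

text \<open>If p^s is the p-part of m, the indices i with p^i dividing m are 1, ..., s, and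
  \<open>b_cong\<close> provides precisely the p^s in the denominator of 1/m.\<close>

lemma b_recursion_integral:
  assumes m: "m \<in> {1..N}" and uv: "u \<in> J" "v \<in> J"
  shows "mfps_const (recip m * (b m u v - (\<Sum>i | i \<in> {1..N} \<and> p ^ i dvd m.
    \<Sum>w\<in>J. \<gamma> i u w * (\<sigma> ^^ i) (b (m div p ^ i) w v)))) \<in> integral_mfps"
proof -
  let ?s = "multiplicity p m"
  have m0: "m \<noteq> 0" and unit: "\<not> is_unit p" using m p by (auto simp: not_prime_unit)
  from multiplicity_decompose'[OF this]
  obtain m' where m': "m = p ^ ?s * m'" "\<not> p dvd m'" .
  then have "0 < m'" using m0 by (auto intro: gr0I)
  \<comment> \<open>The range of i is cut at \<open>N\<close> uniformly in m so that sums can be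
    exchanged later. Nothing is lost, since s < p^s \<le> m \<le> N.\<close>
  have "?s < p ^ ?s" using prime_gt_1_nat[OF p] by (intro power_gt_expt) simp
  also have "p ^ ?s \<le> m" using m0 by (intro dvd_imp_le multiplicity_dvd) auto
  finally have s: "?s \<le> N" using m by simp
  have set_eq: "{i. i \<in> {1..N} \<and> p ^ i dvd m} = {1..?s}"
    using s m0 unit by (auto simp: power_dvd_iff_le_multiplicity)
  have "(\<Sum>i | i \<in> {1..N} \<and> p ^ i dvd m. \<Sum>w\<in>J. \<gamma> i u w * (\<sigma> ^^ i) (b (m div p ^ i) w v)) =
    (\<Sum>i=1..?s. \<Sum>w\<in>J. \<gamma> i u w * (\<sigma> ^^ i) (b (m' * p ^ (?s - i)) w v))"
    unfolding set_eq
  proof (intro sum.cong refl)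
    fix i w assume "i \<in> {1..?s}"
    then have "p ^ ?s = p ^ i * p ^ (?s - i)" by (simp flip: power_add)
    then have "m div p ^ i = m' * p ^ (?s - i)"
      using prime_gt_0_nat[OF p] by (subst m'(1)) (simp add: mult.assoc mult.commute)
    then show "\<gamma> i u w * (\<sigma> ^^ i) (b (m div p ^ i) w v) = \<gamma> i u w * (\<sigma> ^^ i) (b (m' * p ^ (?s - i)) w v)"
      by simp
  qed
  then have "b m u v - (\<Sum>i | i \<in> {1..N} \<and> p ^ i dvd m.
      \<Sum>w\<in>J. \<gamma> i u w * (\<sigma> ^^ i) (b (m div p ^ i) w v)) \<in> pow_multiples p A ?s"
    using b_cong[OF \<open>0 < m'\<close> uv, of ?s] m'(1) by (simp add: mult.commute)
  then have "mfps_const (recip m) * mfps_const (b m u v - (\<Sum>i | i \<in> {1..N} \<and> p ^ i dvd m.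
      \<Sum>w\<in>J. \<gamma> i u w * (\<sigma> ^^ i) (b (m div p ^ i) w v))) \<in> pow_multiples p integral_mfps 0"
    using m0 by (intro recip_mfps) (auto intro: mfps_const_pow_multiples[OF A])
  then show ?thesis by (simp only: S.pow_multiples_0 mfps_const_mult)
qed

text \<open>The lift sends \<open>X\<close> and \<open>Y\<close> to their p^i-th powers, so their
  contributions cancel. What remains is the difference of the k-th powers of H^(p^i) and of the lift
  of H, divisible by p to the power 1 + v(k), where v is the p-adic valuation. Together with the i -
  1 powers in \<open>g\<close> this covers the i + v(k) powers in the denominator k p^i.\<close>

lemma frob_term_integral:
  fixes X Y H :: "('w, 'k) mfps"
  assumes H: "finite I" "H = (\<Sum>\<alpha>\<in>I. mfps_monom (c \<alpha>) \<alpha>)" "\<And>\<alpha>. \<alpha> \<in> I \<Longrightarrow> c \<alpha> \<in> A"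
    and X: "mfps_frob (p ^ i) (\<sigma> ^^ i) X = X ^ (p ^ i)" and Y: "mfps_frob (p ^ i) (\<sigma> ^^ i) Y = Y ^ (p ^ i)"
    and i: "0 < i" and k: "0 < k" and a: "a \<in> A" and g: "g \<in> pow_multiples p A (i - 1)"
  shows "mfps_const (g * recip (k * p ^ i) * a) * (X ^ (k * p ^ i) + Y ^ (k * p ^ i) - H ^ (k * p ^ i)) -
    mfps_const (g * recip (p ^ i)) * (mfps_const (recip k * a) * mfps_frob (p ^ i) (\<sigma> ^^ i) (X ^ k + Y ^ k - H ^ k))
      \<in> integral_mfps"
proof -
  let ?q = "p ^ i"
  let ?F = "mfps_frob ?q (\<sigma> ^^ i) :: ('w, 'k) mfps \<Rightarrow> _"
  have q: "0 < ?q" using p by (simp add: prime_gt_0_nat)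
  have s: "ring_hom_fun (\<sigma> ^^ i)" by (intro ring_hom_fun_funpow \<sigma>)
  note F = ring_hom_fun_mfps_frob[OF q s]
  have frob: "?F (X ^ k + Y ^ k - H ^ k) = (X ^ ?q) ^ k + (Y ^ ?q) ^ k - ?F H ^ k"
    by (simp add: ring_hom_fun_add[OF F] ring_hom_fun_diff[OF F] ring_hom_fun_power[OF F] X Y)
  have pow: "Z ^ (k * ?q) = (Z ^ ?q) ^ k" for Z :: "('w, 'k) mfps"
    by (simp add: mult.commute flip: power_mult)
  let ?D = "(H ^ ?q) ^ k - ?F H ^ k"
  have "?D \<in> pow_multiples p integral_mfps (1 + multiplicity p k)"
    by (intro S.pow_multiples_power_dvd_cong frob_cong[OF H] S.power_closed multiplicity_dvd order.refl)
  then have "mfps_const (recip k) * ?D \<in> pow_multiples p integral_mfps 1"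
    by (rule recip_mfps[OF k])
  moreover have "mfps_const g \<in> pow_multiples p integral_mfps (i - 1)"
    by (intro mfps_const_pow_multiples[OF A] g)
  ultimately have "mfps_const g * (mfps_const (recip k) * ?D) \<in> pow_multiples p integral_mfps (i - 1 + 1)"
    by (rule S.pow_multiples_mult[rotated])
  moreover have "multiplicity p ?q = i"
    using p by (simp add: multiplicity_same_power not_prime_unit prime_gt_0_nat[THEN gr_implies_not0])
  ultimately have "mfps_const (recip ?q) * (mfps_const g * (mfps_const (recip k) * ?D)) \<in> pow_multiples p integral_mfps 0"
    using i q by (intro recip_mfps) auto
  then have "mfps_const a * (mfps_const (recip ?q) * (mfps_const g * (mfps_const (recip k) * ?D))) \<in> integral_mfps"
    unfolding S.pow_multiples_0 using a
    by (intro S.mult_closed[of "mfps_const a"]) (auto simp: mfps_over_def mfps_coeff_const)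
  then have "- (mfps_const a * (mfps_const (recip ?q) * (mfps_const g * (mfps_const (recip k) * ?D)))) \<in> integral_mfps"
    by (rule S.uminus_closed)
  also have "- (mfps_const a * (mfps_const (recip ?q) * (mfps_const g * (mfps_const (recip k) * ?D)))) =
    mfps_const (g * recip (k * p ^ i) * a) * (X ^ (k * p ^ i) + Y ^ (k * p ^ i) - H ^ (k * p ^ i)) -
    mfps_const (g * recip (p ^ i)) * (mfps_const (recip k * a) * ?F (X ^ k + Y ^ k - H ^ k))"
    unfolding frob pow recip_mult[OF k q] mfps_const_mult by (simp add: algebra_simps)
  finally show ?thesis .
qed

text \<open>Split each matrix \<open>b m\<close> into its recursive part and a remainder. The
  remainder is integral after division by m; the recursive part, rearranged by m = k p^i, agrees
  term by term up to integral series with the Frobenius lifts of the shorter defects.\<close>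

lemma log_defect_functional_equation:
  fixes X Y H :: "'v \<Rightarrow> ('w, 'k) mfps"
  assumes I: "finite I" and H: "\<And>v. v \<in> J \<Longrightarrow> H v = (\<Sum>\<alpha>\<in>I. mfps_monom (c v \<alpha>) \<alpha>)"
    and c: "\<And>v \<alpha>. v \<in> J \<Longrightarrow> \<alpha> \<in> I \<Longrightarrow> c v \<alpha> \<in> A"
    and X: "\<And>v i. v \<in> J \<Longrightarrow> mfps_frob (p ^ i) (\<sigma> ^^ i) (X v) = X v ^ (p ^ i)" "\<And>v. v \<in> J \<Longrightarrow> X v \<in> integral_mfps"
    and Y: "\<And>v i. v \<in> J \<Longrightarrow> mfps_frob (p ^ i) (\<sigma> ^^ i) (Y v) = Y v ^ (p ^ i)" "\<And>v. v \<in> J \<Longrightarrow> Y v \<in> integral_mfps"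
    and u: "u \<in> J"
  shows "log_defect X Y H N u - (\<Sum>i=1..N. \<Sum>w\<in>J. mfps_const (\<gamma> i u w * recip (p ^ i)) *
      mfps_frob (p ^ i) (\<sigma> ^^ i) (log_defect X Y H (N div p ^ i) w)) \<in> integral_mfps"
proof -
  define d where "d m v = X v ^ m + Y v ^ m - H v ^ m" for m v
  \<comment> \<open>\<open>e\<close> is the remainder of the recursion for \<open>b\<close>;
    \<open>g\<close> is a recursive term as it occurs in the defect, and \<open>g'\<close> its
    counterpart with the Frobenius lift.\<close>
  define e where "e m v = b m u v - (\<Sum>i | i \<in> {1..N} \<and> p ^ i dvd m.
    \<Sum>w\<in>J. \<gamma> i u w * (\<sigma> ^^ i) (b (m div p ^ i) w v))" for m v
  define g where "g i m v w = mfps_const (\<gamma> i u w * recip m * (\<sigma> ^^ i) (b (m div p ^ i) w v)) * d m v" for i m v w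
  define g' where "g' i k v w = mfps_const (\<gamma> i u w * recip (p ^ i)) *
    (mfps_const (recip k * (\<sigma> ^^ i) (b k w v)) * mfps_frob (p ^ i) (\<sigma> ^^ i) (d k v))" for i k v w
  let ?E = "\<Sum>m=1..N. \<Sum>v\<in>J. mfps_const (recip m * e m v) * d m v"
  have q: "0 < p ^ i" for i using p by (simp add: prime_gt_0_nat)
  have s: "ring_hom_fun (\<sigma> ^^ i)" for i by (intro ring_hom_fun_funpow \<sigma>)
  have H_integral: "H v \<in> integral_mfps" if "v \<in> J" for v
    using frob_cong(2)[OF I H[OF that] c[OF that]] .
  have d_integral: "d m v \<in> integral_mfps" if "v \<in> J" for m v
    unfolding d_def using that X(2) Y(2) H_integral
    by (intro S.diff_closed S.add_closed S.power_closed)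
  have "log_defect X Y H N u = (\<Sum>m=1..N. \<Sum>v\<in>J. mfps_const (recip m * e m v) * d m v +
      (\<Sum>i | i \<in> {1..N} \<and> p ^ i dvd m. \<Sum>w\<in>J. g i m v w))"
    unfolding log_defect_def
  proof (intro sum.cong refl)
    fix m v
    have "b m u v = e m v + (\<Sum>i | i \<in> {1..N} \<and> p ^ i dvd m.
      \<Sum>w\<in>J. \<gamma> i u w * (\<sigma> ^^ i) (b (m div p ^ i) w v))" by (simp add: e_def)
    then have "(mfps_const (recip m * b m u v) :: ('w, 'k) mfps) = mfps_const (recip m * e m v) +
      (\<Sum>i | i \<in> {1..N} \<and> p ^ i dvd m. \<Sum>w\<in>J. mfps_const (\<gamma> i u w * recip m * (\<sigma> ^^ i) (b (m div p ^ i) w v)))"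
      by (simp add: distrib_left mfps_const_add sum_distrib_left mfps_const_sum ac_simps)
    then show "mfps_const (recip m * b m u v) * (X v ^ m + Y v ^ m - H v ^ m) =
      mfps_const (recip m * e m v) * d m v + (\<Sum>i | i \<in> {1..N} \<and> p ^ i dvd m. \<Sum>w\<in>J. g i m v w)"
      by (simp only: distrib_right sum_distrib_right d_def g_def)
  qed
  also have "\<dots> = ?E + (\<Sum>m=1..N. \<Sum>v\<in>J. \<Sum>i | i \<in> {1..N} \<and> p ^ i dvd m. \<Sum>w\<in>J. g i m v w)"
    by (simp add: sum.distrib)
  also have "(\<Sum>m=1..N. \<Sum>v\<in>J. \<Sum>i | i \<in> {1..N} \<and> p ^ i dvd m. \<Sum>w\<in>J. g i m v w) =
      (\<Sum>m=1..N. \<Sum>i | i \<in> {1..N} \<and> p ^ i dvd m. \<Sum>v\<in>J. \<Sum>w\<in>J. g i m v w)"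
    by (intro sum.cong refl sum.swap)
  also have "\<dots> = (\<Sum>i=1..N. \<Sum>m | m \<in> {1..N} \<and> p ^ i dvd m. \<Sum>v\<in>J. \<Sum>w\<in>J. g i m v w)"
    by (rule sum.swap_restrict) auto
  \<comment> \<open>Substitution m = k p^i; the condition m \<le> N becomes k \<le> N div p^i, the
    bound of the lifted defects in the statement.\<close>
  also have "\<dots> = (\<Sum>i=1..N. \<Sum>k=1..N div p ^ i. \<Sum>v\<in>J. \<Sum>w\<in>J. g i (k * p ^ i) v w)"
  proof (rule sum.cong[OF refl])
    fix i
    have "k * p ^ i \<le> N" if "k \<le> N div p ^ i" for k
      using that q[of i] by (simp add: less_eq_div_iff_mult_less_eq)
    then show "(\<Sum>m | m \<in> {1..N} \<and> p ^ i dvd m. \<Sum>v\<in>J. \<Sum>w\<in>J. g i m v w) =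
      (\<Sum>k=1..N div p ^ i. \<Sum>v\<in>J. \<Sum>w\<in>J. g i (k * p ^ i) v w)"
      using q[of i]
      by (intro sum.reindex_bij_witness[of _ "\<lambda>k. k * p ^ i" "\<lambda>m. m div p ^ i"])
        (auto simp: div_le_mono Suc_le_eq div_greater_zero_iff dvd_imp_le)
  qed
  finally have lhs: "log_defect X Y H N u =
    ?E + (\<Sum>i=1..N. \<Sum>k=1..N div p ^ i. \<Sum>v\<in>J. \<Sum>w\<in>J. g i (k * p ^ i) v w)" .
  have rhs: "(\<Sum>i=1..N. \<Sum>w\<in>J. mfps_const (\<gamma> i u w * recip (p ^ i)) *
      mfps_frob (p ^ i) (\<sigma> ^^ i) (log_defect X Y H (N div p ^ i) w)) =
    (\<Sum>i=1..N. \<Sum>k=1..N div p ^ i. \<Sum>v\<in>J. \<Sum>w\<in>J. g' i k v w)"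
  proof (rule sum.cong[OF refl])
    fix i
    note F = ring_hom_fun_mfps_frob[OF q s[of i], of i]
    have "mfps_const (\<gamma> i u w * recip (p ^ i)) *
        mfps_frob (p ^ i) (\<sigma> ^^ i) (log_defect X Y H (N div p ^ i) w) =
      (\<Sum>k=1..N div p ^ i. \<Sum>v\<in>J. g' i k v w)" for w
    proof -
      have "mfps_frob (p ^ i) (\<sigma> ^^ i) (log_defect X Y H (N div p ^ i) w) =
        (\<Sum>k=1..N div p ^ i. \<Sum>v\<in>J. mfps_const (recip k * (\<sigma> ^^ i) (b k w v)) *
          mfps_frob (p ^ i) (\<sigma> ^^ i) (d k v))"
        unfolding log_defect_def ring_hom_fun_sum[OF F] ring_hom_fun_mult[OF F] mfps_frob_const[OF q s]
          ring_hom_fun_mult[OF s] d_def[symmetric]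
        by (intro sum.cong refl) (simp add: hom_recip[OF s])
      then show ?thesis by (simp add: g'_def sum_distrib_left)
    qed
    then have "(\<Sum>w\<in>J. mfps_const (\<gamma> i u w * recip (p ^ i)) *
        mfps_frob (p ^ i) (\<sigma> ^^ i) (log_defect X Y H (N div p ^ i) w)) =
      (\<Sum>w\<in>J. \<Sum>k=1..N div p ^ i. \<Sum>v\<in>J. g' i k v w)" by simp
    also have "\<dots> = (\<Sum>k=1..N div p ^ i. \<Sum>w\<in>J. \<Sum>v\<in>J. g' i k v w)" by (rule sum.swap)
    also have "\<dots> = (\<Sum>k=1..N div p ^ i. \<Sum>v\<in>J. \<Sum>w\<in>J. g' i k v w)"
      by (intro sum.cong refl sum.swap)
    finally show "(\<Sum>w\<in>J. mfps_const (\<gamma> i u w * recip (p ^ i)) *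
        mfps_frob (p ^ i) (\<sigma> ^^ i) (log_defect X Y H (N div p ^ i) w)) =
      (\<Sum>k=1..N div p ^ i. \<Sum>v\<in>J. \<Sum>w\<in>J. g' i k v w)" .
  qed
  have "g i (k * p ^ i) v w - g' i k v w \<in> integral_mfps"
    if "0 < i" "0 < k" "v \<in> J" "w \<in> J" for i k v w
  proof -
    have "(\<sigma> ^^ i) (b k w v) \<in> A"
      using A.frobenius_funpow_cong[of \<sigma> p "b k w v" i] \<sigma> b_closed that by blast
    moreover have "k * p ^ i div p ^ i = k" using q[of i] by simp
    ultimately show ?thesis
      unfolding g_def g'_def d_def using that u
      by (simp only:) (intro frob_term_integral[OF I H c] X Y \<gamma>; assumption)
  qed
  then have "(\<Sum>i=1..N. \<Sum>k=1..N div p ^ i. \<Sum>v\<in>J. \<Sum>w\<in>J. g i (k * p ^ i) v w - g' i k v w) \<in> integral_mfps"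
    by (intro S.sum_closed) auto
  moreover have "?E \<in> integral_mfps"
    unfolding e_def using u by (intro S.sum_closed S.mult_closed d_integral b_recursion_integral)
  ultimately have "?E + (\<Sum>i=1..N. \<Sum>k=1..N div p ^ i. \<Sum>v\<in>J. \<Sum>w\<in>J. g i (k * p ^ i) v w - g' i k v w) \<in> integral_mfps"
    by (intro S.add_closed)
  then show ?thesis
    unfolding lhs rhs by (simp add: sum_subtractf algebra_simps)
qed

text \<open>Strong induction on n, the degree of \<open>\<delta>\<close>. In degree n the functional
  equation for the truncation \<open>H\<close> loses all its Frobenius terms, so the coefficient of
  the defect is integral there, and that coefficient is the one of \<open>G u\<close>.\<close>

lemma integral_of_log_eq:
  fixes G :: "'v \<Rightarrow> ('w, 'k) mfps"
  assumes W: "finite W" and G: "\<And>v. v \<in> J \<Longrightarrow> G v \<in> mfps_over UNIV W" "\<And>v. v \<in> J \<Longrightarrow> G v \<in> mfps_ord 1"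
    and eq: "\<And>u. u \<in> J \<Longrightarrow> mfps_subst (l u) G =
      mfps_subst (l u) (\<lambda>v. mfps_var (x v)) + mfps_subst (l u) (\<lambda>v. mfps_var (y v))"
    and u: "u \<in> J"
  shows "mfps_coeff (G u) \<delta> \<in> A"
  using u
proof (induction "monom_deg \<delta>" arbitrary: u \<delta> rule: less_induct)
  case (less \<delta> u)
  let ?n = "monom_deg \<delta>"
  let ?X = "\<lambda>v. mfps_var (x v) :: ('w, 'k) mfps" and ?Y = "\<lambda>v. mfps_var (y v) :: ('w, 'k) mfps"
  show ?case
  proof (cases "?n = 0")
    case True
    then show ?thesis using mfps_ordD[OF G(2)[OF \<open>u \<in> J\<close>], of \<delta>] by simp
  next
    case False
    \<comment> \<open>The degree is positive here, so \<open>?n - 1\<close> really cuts below n and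
      the induction hypothesis covers every coefficient of \<open>H\<close>.\<close>
    define I where "I = monoms_upto W (?n - 1)"
    define H where "H v = (\<Sum>\<alpha>\<in>I. mfps_monom (mfps_coeff (G v) \<alpha>) \<alpha>)" for v
    have I: "finite I" unfolding I_def by (intro finite_monoms_upto W)
    have H_coeff: "mfps_coeff (H v) \<alpha> = (if \<alpha> \<in> I then mfps_coeff (G v) \<alpha> else 0)" for v \<alpha>
      using I by (simp add: H_def mfps_coeff_monom if_distrib cong: if_cong)
    have G_H: "G v - H v \<in> mfps_ord ?n" if "v \<in> J" for v
    proof (rule mfps_ordI)
      fix \<alpha> :: "'w \<Rightarrow>\<^sub>0 nat" assume \<alpha>: "monom_deg \<alpha> < ?n"
      show "mfps_coeff (G v - H v) \<alpha> = 0"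
      proof (cases "mfps_coeff (G v) \<alpha> = 0")
        case False
        then have "\<alpha> \<in> I" using G(1)[OF that] \<alpha> by (auto simp: I_def monoms_upto_def mfps_over_iff)
        then show ?thesis by (simp add: H_coeff)
      qed (simp add: H_coeff)
    qed
    have H_ord: "H v \<in> mfps_ord 1" if "v \<in> J" for v
      using mfps_ord_diff[OF G(2)[OF that] mfps_ord_antimono[OF G_H[OF that], of 1]] False by simp
    \<comment> \<open>Through degree n only the linear part of l sees G - H: the rest has order 2
      and moves the difference to degree n + 1 or higher.\<close>
    have diff: "mfps_subst (l v) G - mfps_subst (l v) H - (G v - H v) \<in> mfps_ord (Suc ?n)" if v: "v \<in> J" for v
    proof -
      have r: "l v - mfps_var v \<in> mfps_over UNIV J" "l v - mfps_var v \<in> mfps_ord 2"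
        using unit_tuple_l v by (auto simp: unit_tuple_def intro: mfps_over_UNIV.diff_closed mfps_var_over)
      have "mfps_subst (l v - mfps_var v) G - mfps_subst (l v - mfps_var v) H \<in> mfps_ord (?n + 2 - 1)"
        using G(2) H_ord G_H r by (intro mfps_subst_diff_ord[OF J])
      moreover have "mfps_subst (l v - mfps_var v) G = mfps_subst (l v) G - G v"
        using mfps_subst_diff[OF J G(2) l_over[OF v] mfps_var_over[OF v]] mfps_subst_var[OF J G(2) v] by simp
      moreover have "mfps_subst (l v - mfps_var v) H = mfps_subst (l v) H - H v"
        using mfps_subst_diff[OF J H_ord l_over[OF v] mfps_var_over[OF v]] mfps_subst_var[OF J H_ord v] by simp
      ultimately show ?thesis by (simp add: algebra_simps)
    qed
    \<comment> \<open>By the hypothesis on \<open>G\<close>, l(X) + l(Y) can be replaced by l(G), so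
      the defect compares \<open>G\<close> with \<open>H\<close>.\<close>
    have defect: "log_defect ?X ?Y H N v - (mfps_subst (l v) G - mfps_subst (l v) H) \<in> mfps_ord (Suc N)"
      if v: "v \<in> J" for N v
    proof -
      let ?t = "\<lambda>Z. \<Sum>m=1..N. \<Sum>w\<in>J. mfps_const (recip m * b m v w) * (Z w ^ m :: ('w, 'k) mfps)"
      have "log_defect ?X ?Y H N v = ?t ?X + ?t ?Y - ?t H"
        by (simp add: log_defect_def distrib_left right_diff_distrib sum.distrib sum_subtractf)
      then have "log_defect ?X ?Y H N v - (mfps_subst (l v) G - mfps_subst (l v) H) =
        (mfps_subst (l v) H - ?t H) - (mfps_subst (l v) ?X - ?t ?X) - (mfps_subst (l v) ?Y - ?t ?Y)"
        by (simp add: eq[OF v])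
      also have "\<dots> \<in> mfps_ord (Suc N)"
        by (intro mfps_ord_diff subst_l_trunc v H_ord mfps_var_ord)
      finally show ?thesis .
    qed
    have low: "log_defect ?X ?Y H N v \<in> mfps_ord (Suc N)" if v: "v \<in> J" and N: "N < ?n" for N v
    proof -
      have "mfps_subst (l v) G - mfps_subst (l v) H \<in> mfps_ord ?n"
        using mfps_ord_add[OF mfps_ord_antimono[OF diff[OF v], of ?n] G_H[OF v]] by simp
      then have "mfps_subst (l v) G - mfps_subst (l v) H \<in> mfps_ord (Suc N)"
        using N by (auto intro: mfps_ord_antimono)
      then show ?thesis using mfps_ord_add[OF defect[OF v, of N]] by force
    qed
    let ?f = "\<lambda>i w. mfps_const (\<gamma> i u w * recip (p ^ i)) *
      mfps_frob (p ^ i) (\<sigma> ^^ i) (log_defect ?X ?Y H (?n div p ^ i) w)"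
    have s: "ring_hom_fun (\<sigma> ^^ i)" for i by (intro ring_hom_fun_funpow \<sigma>)
    have q: "0 < p ^ i" for i using p by (simp add: prime_gt_0_nat)
    have "log_defect ?X ?Y H ?n u - (\<Sum>i=1..?n. \<Sum>w\<in>J. ?f i w) \<in> integral_mfps"
    proof (rule log_defect_functional_equation[OF I])
      fix v \<alpha> assume "v \<in> J" "\<alpha> \<in> I"
      then show "mfps_coeff (G v) \<alpha> \<in> A" using less(1)[of \<alpha> v] False by (auto simp: I_def monoms_upto_def)
    qed (auto simp: H_def less(2) mfps_over_def mfps_coeff_var mfps_frob_var[OF q s])
    then have "mfps_coeff (log_defect ?X ?Y H ?n u) \<delta> - (\<Sum>i=1..?n. \<Sum>w\<in>J. mfps_coeff (?f i w) \<delta>) \<in> A"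
      by (simp add: mfps_over_def)
    \<comment> \<open>The defect with bound n div p^i has order at least n div p^i + 1, and the lift
      multiplies this order by p^i, which exceeds n.\<close>
    moreover have "mfps_coeff (?f i w) \<delta> = 0" if "i \<in> {1..?n}" "w \<in> J" for i w
    proof -
      have "1 < p ^ i" using that prime_gt_1_nat[OF p] by (intro one_less_power) auto
      then have "?n div p ^ i < ?n" using False by (intro div_less_dividend) auto
      then have "mfps_frob (p ^ i) (\<sigma> ^^ i) (log_defect ?X ?Y H (?n div p ^ i) w)
          \<in> mfps_ord (p ^ i * Suc (?n div p ^ i))"
        using that by (intro mfps_frob_ord[OF q s] low)
      then have "?f i w \<in> mfps_ord (p ^ i * Suc (?n div p ^ i))" by (rule mfps_ord_mult_left)
      moreover have "?n < p ^ i * Suc (?n div p ^ i)"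
        using dividend_less_times_div[OF q[of i], of ?n] by simp
      ultimately show ?thesis by (rule mfps_ordD)
    qed
    ultimately have "mfps_coeff (log_defect ?X ?Y H ?n u) \<delta> \<in> A" by simp
    \<comment> \<open>Through degree n the defect is \<open>G u - H u\<close>, and
      \<open>H u\<close> has no term of degree n.\<close>
    moreover have "mfps_coeff (log_defect ?X ?Y H ?n u) \<delta> = mfps_coeff (G u) \<delta>"
    proof -
      have "log_defect ?X ?Y H ?n u - (mfps_subst (l u) G - mfps_subst (l u) H) +
          (mfps_subst (l u) G - mfps_subst (l u) H - (G u - H u)) \<in> mfps_ord (Suc ?n)"
        by (intro mfps_ord_add defect diff less(2))
      then have "mfps_coeff (log_defect ?X ?Y H ?n u - (G u - H u)) \<delta> = 0"
        by (intro mfps_ordD) (auto simp: algebra_simps)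
      moreover have "mfps_coeff (H u) \<delta> = 0"
        using False by (auto simp: H_coeff I_def monoms_upto_def)
      ultimately show ?thesis by simp
    qed
    ultimately show ?thesis by simp
  qed
qed

text \<open>Composing l with the definition of the group law and reassociating gives l(G) =
  l(\<tau>) + l(\<tau>'); the integrality is drawn from this equation instead of from the
  coefficients of the inverse.\<close>

theorem formal_group_integral:
  assumes "u \<in> J"
  shows "formal_group_of_log J l u \<in> mfps_over A (J <+> J)"
proof -
  let ?h = "comp_inverse J l"
  let ?s = "\<lambda>v. mfps_subst (l v) (\<lambda>w. mfps_var (Inl w)) + mfps_subst (l v) (\<lambda>w. mfps_var (Inr w)) :: ('v + 'v, 'k) mfps"
  let ?G = "formal_group_of_log J l"
  have h: "?h v \<in> mfps_over UNIV J" "?h v \<in> mfps_ord 1" if "v \<in> J" for v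
    using comp_inverse_props(1)[OF J unit_tuple_l] that
    by (auto simp: mfps_tuples_def mfps_ord_1_iff simp del: One_nat_def)
  have s_over: "?s v \<in> mfps_over UNIV (J <+> J)" if "v \<in> J" for v
    using that by (intro mfps_over_UNIV.add_closed mfps_subst_over[OF l_over] mfps_var_over) auto
  have s_ord: "?s v \<in> mfps_ord 1" if "v \<in> J" for v
    using that by (intro mfps_ord_add mfps_subst_ord[OF J] mfps_var_ord l_over unit_tuple_ord[OF unit_tuple_l])
  have G: "?G v = mfps_subst (?h v) ?s" for v
    by (simp add: formal_group_of_log_def)
  have G_over: "?G v \<in> mfps_over UNIV (J <+> J)" if "v \<in> J" for v
    unfolding G using that by (intro mfps_subst_over[OF h(1)] s_over)
  have G_ord: "?G v \<in> mfps_ord 1" if "v \<in> J" for v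
    unfolding G using that by (intro mfps_subst_ord[OF J] s_ord h)
  have "mfps_subst (l v) ?G = ?s v" if v: "v \<in> J" for v
  proof -
    have "mfps_subst (l v) ?G = mfps_subst (mfps_subst (l v) ?h) ?s"
      unfolding G using v by (intro mfps_subst_assoc[OF J s_ord J, symmetric] l_over h)
    also have "\<dots> = ?s v"
      using comp_inverse_props(2)[OF J unit_tuple_l v] mfps_subst_var[OF J s_ord v] by simp
    finally show ?thesis .
  qed
  then have "mfps_coeff (?G u) \<delta> \<in> A" for \<delta>
    using J G_over G_ord assms by (intro integral_of_log_eq[of "J <+> J"]) auto
  then show ?thesis using G_over[OF assms] by (auto simp: mfps_over_def)
qed

end

section \<open>Dwork congruences for powers of a Laurent polynomial\<close>

lemma laurent_poly_expand: "f = (\<Sum>b\<in>Poly_Mapping.keys f. Poly_Mapping.single b (Poly_Mapping.lookup f b))"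
proof (rule poly_mapping_eqI)
  fix k
  have "(\<Sum>b\<in>Poly_Mapping.keys f. Poly_Mapping.lookup (Poly_Mapping.single b (Poly_Mapping.lookup f b)) k) =
    (\<Sum>b\<in>Poly_Mapping.keys f. if b = k then Poly_Mapping.lookup f b else 0)"
    by (intro sum.cong) (auto simp: lookup_single when_def)
  also have "\<dots> = Poly_Mapping.lookup f k" by (simp add: in_keys_iff)
  finally show "Poly_Mapping.lookup f k =
    Poly_Mapping.lookup (\<Sum>b\<in>Poly_Mapping.keys f. Poly_Mapping.single b (Poly_Mapping.lookup f b)) k"
    by (simp add: lookup_sum)
qed

lemma lookup_mult_single:
  fixes f :: "('n::finite, 'a::comm_ring_1) laurent_poly"
  shows "Poly_Mapping.lookup (f * Poly_Mapping.single c a) e = Poly_Mapping.lookup f (e - c) * a"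
proof -
  have "f * Poly_Mapping.single c a =
      (\<Sum>b\<in>Poly_Mapping.keys f. Poly_Mapping.single (b + c) (Poly_Mapping.lookup f b * a))"
    by (subst laurent_poly_expand) (simp add: sum_distrib_right mult_single)
  then have "Poly_Mapping.lookup (f * Poly_Mapping.single c a) e =
      (\<Sum>b\<in>Poly_Mapping.keys f. if b = e - c then Poly_Mapping.lookup f b * a else 0)"
    by (simp only: lookup_sum, intro sum.cong) (auto simp: lookup_single when_def)
  also have "\<dots> = Poly_Mapping.lookup f (e - c) * a" by (simp add: in_keys_iff)
  finally show ?thesis .
qed

lemma single_power:
  fixes b :: "int ^ 'n" and a :: "'a::comm_ring_1"
  shows "Poly_Mapping.single b a ^ q = Poly_Mapping.single (int q *s b) (a ^ q)"
proof (induction q)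
  case (Suc q)
  have "b + int q *s b = int (Suc q) *s b" by (simp add: vec_eq_iff algebra_simps)
  then show ?case using Suc by (simp add: mult_single)
qed (simp flip: single_one)

lemma lookup_of_nat_power_mult:
  fixes f :: "('n::finite, 'a::comm_ring_1) laurent_poly"
  shows "Poly_Mapping.lookup (of_nat p ^ r * f) e = of_nat p ^ r * Poly_Mapping.lookup f e"
proof -
  have "of_nat p ^ r * f = f * Poly_Mapping.single 0 (of_nat (p ^ r))"
    by (simp only: single_of_nat) (simp add: mult.commute)
  then show ?thesis by (simp only: lookup_mult_single) (simp add: mult.commute)
qed

text \<open>The i-th iterate of the lift \<Phi> is written directly, as the case of
  \<open>p^i\<close> and the i-th iterate of \<open>\<sigma>\<close>.\<close>

definition laurent_frob ::
  "nat \<Rightarrow> ('a::comm_ring_1 \<Rightarrow> 'a) \<Rightarrow> ('n::finite, 'a) laurent_poly \<Rightarrow> ('n, 'a) laurent_poly" where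
  "laurent_frob q \<sigma> f =
    (\<Sum>b\<in>Poly_Mapping.keys f. Poly_Mapping.single (int q *s b) (\<sigma> (Poly_Mapping.lookup f b)))"

lemma keys_laurent_frob: "Poly_Mapping.keys (laurent_frob q \<sigma> f) \<subseteq> (\<lambda>b. int q *s b) ` Poly_Mapping.keys f"
proof
  fix c assume "c \<in> Poly_Mapping.keys (laurent_frob q \<sigma> f)"
  then have "(\<Sum>b\<in>Poly_Mapping.keys f. Poly_Mapping.lookup (Poly_Mapping.single (int q *s b) (\<sigma> (Poly_Mapping.lookup f b))) c) \<noteq> 0"
    by (simp add: laurent_frob_def in_keys_iff lookup_sum)
  then obtain b where "b \<in> Poly_Mapping.keys f"
    "Poly_Mapping.lookup (Poly_Mapping.single (int q *s b) (\<sigma> (Poly_Mapping.lookup f b))) c \<noteq> 0"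
    by (rule sum.not_neutral_contains_not_neutral)
  then show "c \<in> (\<lambda>b. int q *s b) ` Poly_Mapping.keys f"
    by (auto simp: lookup_single when_def split: if_splits)
qed

context
  fixes q :: nat and \<sigma> :: "'a::comm_ring_1 \<Rightarrow> 'a"
  assumes \<sigma>: "ring_hom_fun \<sigma>"
begin

lemma laurent_frob_superset:
  assumes "finite B" "Poly_Mapping.keys f \<subseteq> B"
  shows "laurent_frob q \<sigma> f = (\<Sum>b\<in>B. Poly_Mapping.single (int q *s b) (\<sigma> (Poly_Mapping.lookup f b)))"
  unfolding laurent_frob_def using assms
  by (intro sum.mono_neutral_left) (auto simp: in_keys_iff ring_hom_fun_zero[OF \<sigma>])

lemma laurent_frob_single: "laurent_frob q \<sigma> (Poly_Mapping.single b a) = Poly_Mapping.single (int q *s b) (\<sigma> a)"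
  by (subst laurent_frob_superset[of "{b}"]) auto

lemma laurent_frob_add: "laurent_frob q \<sigma> (f + g) = laurent_frob q \<sigma> f + laurent_frob q \<sigma> g"
proof -
  let ?B = "Poly_Mapping.keys f \<union> Poly_Mapping.keys g"
  have "Poly_Mapping.keys (f + g) \<subseteq> ?B" by (rule keys_add)
  then show ?thesis
    by (simp add: laurent_frob_superset[of ?B] lookup_add ring_hom_fun_add[OF \<sigma>] single_add sum.distrib)
qed

lemma laurent_frob_sum: "laurent_frob q \<sigma> (sum g I) = (\<Sum>i\<in>I. laurent_frob q \<sigma> (g i))"
proof (induction I rule: infinite_finite_induct)
  case (insert i I)
  then show ?case by (simp add: laurent_frob_add)
qed (simp_all add: laurent_frob_def)

lemma ring_hom_fun_laurent_frob: "ring_hom_fun (laurent_frob q \<sigma> :: ('n::finite, 'a) laurent_poly \<Rightarrow> _)"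
  unfolding ring_hom_fun_def
proof (intro conjI allI laurent_frob_add)
  show "laurent_frob q \<sigma> (1 :: ('n, 'a) laurent_poly) = 1"
    using laurent_frob_single[of 0 1] by (simp add: ring_hom_fun_one[OF \<sigma>])
  fix f g :: "('n, 'a) laurent_poly"
  let ?f = "\<lambda>b. Poly_Mapping.single b (Poly_Mapping.lookup f b)"
  let ?g = "\<lambda>b. Poly_Mapping.single b (Poly_Mapping.lookup g b)"
  have scale: "int q *s (b + c) = int q *s b + int q *s c" for b c :: "int ^ 'n"
    by (simp add: vec_eq_iff distrib_left)
  have "f * g = (\<Sum>b\<in>Poly_Mapping.keys f. \<Sum>c\<in>Poly_Mapping.keys g. ?f b * ?g c)"
    by (subst laurent_poly_expand[of f], subst laurent_poly_expand[of g]) (rule sum_product)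
  then have "laurent_frob q \<sigma> (f * g) =
      (\<Sum>b\<in>Poly_Mapping.keys f. \<Sum>c\<in>Poly_Mapping.keys g. laurent_frob q \<sigma> (?f b * ?g c))"
    by (simp only: laurent_frob_sum)
  also have "\<dots> = (\<Sum>b\<in>Poly_Mapping.keys f. \<Sum>c\<in>Poly_Mapping.keys g.
      Poly_Mapping.single (int q *s b) (\<sigma> (Poly_Mapping.lookup f b)) *
      Poly_Mapping.single (int q *s c) (\<sigma> (Poly_Mapping.lookup g c)))"
    by (simp add: mult_single laurent_frob_single scale ring_hom_fun_mult[OF \<sigma>])
  also have "\<dots> = laurent_frob q \<sigma> f * laurent_frob q \<sigma> g"
    by (simp add: laurent_frob_def sum_product)
  finally show "laurent_frob q \<sigma> (f * g) = laurent_frob q \<sigma> f * laurent_frob q \<sigma> g" .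
qed

text \<open>The exponent splits as q k v - u = (q w - u) + q (k v - w), with k v - w in the support
  of \<open>F\<close>. When \<open>G\<close> only sees w in J, the product with a lift becomes a
  matrix product over J.\<close>

lemma lookup_mult_laurent_frob:
  fixes F G :: "('n::finite, 'a) laurent_poly"
  assumes "finite J" "\<And>w. Poly_Mapping.lookup G (int q *s w - u) \<noteq> 0 \<Longrightarrow> w \<in> J"
  shows "Poly_Mapping.lookup (G * laurent_frob q \<sigma> F) (int (q * k) *s v - u) =
    (\<Sum>w\<in>J. Poly_Mapping.lookup G (int q *s w - u) * \<sigma> (Poly_Mapping.lookup F (int k *s v - w)))"
proof -
  let ?t = "\<lambda>w. Poly_Mapping.lookup G (int q *s w - u) * \<sigma> (Poly_Mapping.lookup F (int k *s v - w))"
  let ?r = "\<lambda>b. int k *s v - b"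
  let ?B = "?r ` Poly_Mapping.keys F"
  have scale: "int (q * k) *s v - u - int q *s b = int q *s ?r b - u" for b
    by (simp add: vec_eq_iff algebra_simps)
  have "Poly_Mapping.lookup (G * laurent_frob q \<sigma> F) (int (q * k) *s v - u) =
      (\<Sum>b\<in>Poly_Mapping.keys F. Poly_Mapping.lookup G (int (q * k) *s v - u - int q *s b) * \<sigma> (Poly_Mapping.lookup F b))"
    unfolding laurent_frob_def sum_distrib_left lookup_sum lookup_mult_single ..
  also have "\<dots> = (\<Sum>b\<in>Poly_Mapping.keys F. ?t (?r b))"
    unfolding scale by simp
  also have "\<dots> = (\<Sum>w\<in>?B. ?t w)"
    by (rule sum.reindex_cong[of ?r, symmetric]) (auto intro: inj_onI)
  \<comment> \<open>Passage from the support of \<open>F\<close> to J through the union: the indices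
    added carry no coefficient of \<open>F\<close>, those dropped afterwards none of
    \<open>G\<close>.\<close>
  also have "\<dots> = (\<Sum>w\<in>?B \<union> J. ?t w)"
  proof (rule sum.mono_neutral_left)
    show "\<forall>w\<in>?B \<union> J - ?B. ?t w = 0"
    proof
      fix w assume "w \<in> ?B \<union> J - ?B"
      then have "int k *s v - w \<notin> Poly_Mapping.keys F" by force
      then show "?t w = 0" by (simp add: in_keys_iff ring_hom_fun_zero[OF \<sigma>])
    qed
  qed (use assms in auto)
  also have "\<dots> = (\<Sum>w\<in>J. ?t w)"
  proof (rule sum.mono_neutral_right)
    show "\<forall>w\<in>?B \<union> J - J. ?t w = 0"
    proof
      fix w assume "w \<in> ?B \<union> J - J"
      then have "Poly_Mapping.lookup G (int q *s w - u) = 0" using assms(2) by blast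
      then show "?t w = 0" by simp
    qed
  qed (use assms in auto)
  finally show ?thesis .
qed

end

text \<open>The same two congruences as for power series: powers of sums modulo p, then \<sigma>^i
  against the p^i-th power on each coefficient.\<close>

lemma laurent_frob_power_cong:
  fixes g :: "('n::finite, 'a::comm_ring_1) laurent_poly"
  assumes "prime p" "\<And>r. of_nat p dvd \<sigma> r - r ^ p"
  shows "of_nat p dvd g ^ (p ^ i) - laurent_frob (p ^ i) (\<sigma> ^^ i) g"
proof -
  interpret L: subring_set "UNIV :: ('n, 'a) laurent_poly set" by (rule subring_set_UNIV)
  interpret R: subring_set "UNIV :: 'a set" by (rule subring_set_UNIV)
  let ?K = "Poly_Mapping.keys g" and ?g = "Poly_Mapping.lookup g" and ?q = "p ^ i"
  have "of_nat p dvd (\<Sum>b\<in>?K. Poly_Mapping.single b (?g b)) ^ ?q - (\<Sum>b\<in>?K. Poly_Mapping.single b (?g b) ^ ?q)"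
    using L.prime_power_power_sum_cong[OF assms(1), of ?K] by (simp add: pow_multiples_UNIV)
  then have 1: "of_nat p dvd g ^ ?q - (\<Sum>b\<in>?K. Poly_Mapping.single b (?g b) ^ ?q)"
    unfolding laurent_poly_expand[of g, symmetric] .
  have "of_nat p dvd Poly_Mapping.single b (?g b) ^ ?q - Poly_Mapping.single (int ?q *s b) ((\<sigma> ^^ i) (?g b))" for b
  proof -
    have "of_nat p dvd ?g b ^ ?q - (\<sigma> ^^ i) (?g b)"
      using R.frobenius_funpow_cong[of \<sigma> p "?g b" i] assms(2) by (simp add: pow_multiples_UNIV)
    then obtain t where t: "?g b ^ ?q - (\<sigma> ^^ i) (?g b) = of_nat p * t" by (elim dvdE)
    have "Poly_Mapping.single b (?g b) ^ ?q - Poly_Mapping.single (int ?q *s b) ((\<sigma> ^^ i) (?g b)) =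
      Poly_Mapping.single (int ?q *s b) (of_nat p * t)"
      by (simp only: single_power t flip: single_diff)
    also have "\<dots> = of_nat p * Poly_Mapping.single (int ?q *s b) t"
      unfolding single_of_nat[symmetric] mult_single by simp
    finally show ?thesis by simp
  qed
  then have 2: "of_nat p dvd (\<Sum>b\<in>?K. Poly_Mapping.single b (?g b) ^ ?q) - laurent_frob ?q (\<sigma> ^^ i) g"
    unfolding laurent_frob_def sum_subtractf[symmetric] by (intro dvd_sum)
  show ?thesis using dvd_add[OF 1 2] by simp
qed

text \<open>These are the \<open>V\<^sub>i\<close>. In the expansion of f^(p^i - 1) the last summand
  is \<open>V\<^sub>i\<close> itself, as the lift is applied to f^0 = 1, so the defining equation
  can be solved for it.\<close>

function dwork_term ::
  "nat \<Rightarrow> ('a::comm_ring_1 \<Rightarrow> 'a) \<Rightarrow> ('n::finite, 'a) laurent_poly \<Rightarrow> nat \<Rightarrow> ('n, 'a) laurent_poly" where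
  "dwork_term p \<sigma> f i = f ^ (p ^ i - 1) -
    (\<Sum>j\<in>{1..<i}. dwork_term p \<sigma> f j * laurent_frob (p ^ j) (\<sigma> ^^ j) (f ^ (p ^ (i - j) - 1)))"
  by auto
termination by (relation "Wellfounded.measure (\<lambda>(p, \<sigma>, f, i). i)") auto

declare dwork_term.simps [simp del]

section \<open>Congruences between powers of \<open>f\<close>\<close>

context
  fixes p :: nat and \<sigma> :: "'a::comm_ring_1 \<Rightarrow> 'a" and f :: "('n::finite, 'a) laurent_poly"
  assumes p: "prime p" and \<sigma>: "ring_hom_fun \<sigma>" "\<And>r. of_nat p dvd \<sigma> r - r ^ p"
begin

private abbreviation frob where "frob i \<equiv> laurent_frob (p ^ i) (\<sigma> ^^ i)"
private abbreviation V where "V \<equiv> dwork_term p \<sigma> f"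

private lemma frob_hom: "ring_hom_fun (frob i :: ('n, 'a) laurent_poly \<Rightarrow> _)"
  by (intro ring_hom_fun_laurent_frob ring_hom_fun_funpow \<sigma>)

lemma dwork_term_expansion:
  assumes "0 < s"
  shows "f ^ (p ^ s - 1) = (\<Sum>i=1..s. V i * frob i (f ^ (p ^ (s - i) - 1)))"
proof -
  have "{1..s} = insert s {1..<s}" using assms by auto
  then have "(\<Sum>i=1..s. V i * frob i (f ^ (p ^ (s - i) - 1))) =
    V s + (\<Sum>i\<in>{1..<s}. V i * frob i (f ^ (p ^ (s - i) - 1)))"
    by (simp add: ring_hom_fun_one[OF frob_hom])
  then show ?thesis by (simp add: dwork_term.simps[of p \<sigma> f s])
qed

text \<open>The congruence modulo p between g^(p^i) and its lift is raised to the power p^(s-i),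
  which gains s - i further powers of p.\<close>

lemma power_frob_cong:
  fixes g :: "('n, 'a) laurent_poly"
  assumes "i \<le> s"
  shows "of_nat p ^ (1 + (s - i)) dvd g ^ (p ^ s) - frob i (g ^ (p ^ (s - i)))"
proof -
  interpret L: subring_set "UNIV :: ('n, 'a) laurent_poly set" by (rule subring_set_UNIV)
  have "of_nat p dvd g ^ (p ^ i) - frob i g"
    by (intro laurent_frob_power_cong p \<sigma>)
  then have "of_nat p ^ (1 + (s - i)) dvd (g ^ (p ^ i)) ^ (p ^ (s - i)) - (frob i g) ^ (p ^ (s - i))"
    using L.pow_multiples_power_prime_power_cong[of "g ^ (p ^ i)" "frob i g" p 1 "s - i"]
    by (simp add: pow_multiples_UNIV)
  also have "(g ^ (p ^ i)) ^ (p ^ (s - i)) = g ^ (p ^ s)"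
    using assms by (simp flip: power_mult power_add)
  finally show ?thesis by (simp add: ring_hom_fun_power[OF frob_hom])
qed

text \<open>\<open>V i\<close> is exactly the error term of the general congruence for m = p and s =
  i - 1. This lets the divisibility and the congruence be proved in a single induction.\<close>

lemma dwork_term_dvd_of_cong:
  assumes "0 < i" and cong: "of_nat p ^ (i - 1) dvd f ^ (p * p ^ (i - 1) - 1) -
      (\<Sum>j=1..i - 1. V j * frob j (f ^ (p * p ^ (i - 1 - j) - 1)))"
  shows "of_nat p ^ (i - 1) dvd V i"
proof -
  have "(\<Sum>j=1..i - 1. V j * frob j (f ^ (p * p ^ (i - 1 - j) - 1))) =
      (\<Sum>j\<in>{1..<i}. V j * frob j (f ^ (p ^ (i - j) - 1)))"
  proof (rule sum.cong)
    show "{1..i - 1} = {1..<i}" using assms(1) by auto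
    fix j assume "j \<in> {1..<i}"
    then have "p * p ^ (i - 1 - j) = p ^ (i - j)" by (simp flip: power_Suc add: Suc_diff_Suc)
    then show "V j * frob j (f ^ (p * p ^ (i - 1 - j) - 1)) = V j * frob j (f ^ (p ^ (i - j) - 1))" by simp
  qed
  moreover have "p * p ^ (i - 1) = p ^ i" using assms(1) by (simp flip: power_Suc)
  ultimately show ?thesis using cong by (simp add: dwork_term.simps[of p \<sigma> f i])
qed

text \<open>With g = f^(m-1) one has f^(m k - 1) = g^k f^(k-1). Multiplying the exact expansion for
  m = 1 by g^(p^s), the error consists of \<open>V i\<close> times the difference of g^(p^s) and the
  lift of g^(p^(s-i)): together i - 1 and 1 + s - i powers of p. The factor in \<open>V i\<close> is
  the induction hypothesis at i - 1 < s, applied with m = p.\<close>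

lemma dwork_congruence:
  assumes "0 < m"
  shows "of_nat p ^ s dvd f ^ (m * p ^ s - 1) - (\<Sum>i=1..s. V i * frob i (f ^ (m * p ^ (s - i) - 1)))"
  using assms
proof (induction s arbitrary: m rule: less_induct)
  case (less s)
  show ?case
  proof (cases "s = 0")
    case False
    let ?g = "f ^ (m - 1)"
    have p0: "0 < p" using p by (rule prime_gt_0_nat)
    have split: "f ^ (m * k - 1) = ?g ^ k * f ^ (k - 1)" if "0 < k" for k
    proof -
      have "m * k - 1 = (m - 1) * k + (k - 1)"
        using less.prems that by (cases m) (auto simp: algebra_simps)
      then show ?thesis by (simp add: power_add power_mult)
    qed
    have "f ^ (m * p ^ s - 1) - (\<Sum>i=1..s. V i * frob i (f ^ (m * p ^ (s - i) - 1))) =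
      ?g ^ (p ^ s) * (\<Sum>i=1..s. V i * frob i (f ^ (p ^ (s - i) - 1))) -
      (\<Sum>i=1..s. V i * (frob i (?g ^ (p ^ (s - i))) * frob i (f ^ (p ^ (s - i) - 1))))"
      using False p0 dwork_term_expansion[of s] split[of "p ^ s"] split[of "p ^ (s - _)"]
      by (simp only: zero_less_power neq0_conv ring_hom_fun_mult[OF frob_hom])
    also have "\<dots> = (\<Sum>i=1..s. V i * (?g ^ (p ^ s) - frob i (?g ^ (p ^ (s - i)))) * frob i (f ^ (p ^ (s - i) - 1)))"
      unfolding sum_distrib_left sum_subtractf[symmetric] by (intro sum.cong) (auto simp: algebra_simps)
    also have "of_nat p ^ s dvd \<dots>"
    proof (intro dvd_sum)
      fix i assume i: "i \<in> {1..s}"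
      have "of_nat p ^ (i - 1) dvd V i"
        using i by (intro dwork_term_dvd_of_cong less.IH p0) auto
      moreover have "of_nat p ^ (1 + (s - i)) dvd ?g ^ (p ^ s) - frob i (?g ^ (p ^ (s - i)))"
        using i by (intro power_frob_cong) auto
      ultimately have "of_nat p ^ (i - 1) * of_nat p ^ (1 + (s - i)) dvd
          V i * (?g ^ (p ^ s) - frob i (?g ^ (p ^ (s - i))))"
        by (rule mult_dvd_mono)
      moreover have "i - 1 + (1 + (s - i)) = s" using i by auto
      ultimately have "of_nat p ^ s dvd V i * (?g ^ (p ^ s) - frob i (?g ^ (p ^ (s - i))))"
        by (metis power_add)
      then show "of_nat p ^ s dvd V i * (?g ^ (p ^ s) - frob i (?g ^ (p ^ (s - i)))) * frob i (f ^ (p ^ (s - i) - 1))"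
        by (rule dvd_mult2)
    qed
    finally show ?thesis .
  qed simp
qed

lemma dwork_term_dvd: "0 < i \<Longrightarrow> of_nat p ^ (i - 1) dvd V i"
  by (intro dwork_term_dvd_of_cong dwork_congruence prime_gt_0_nat[OF p])

end

section \<open>Newton polytopes\<close>

lemma real_point_simps:
  "real_point (a + b) = real_point a + real_point b"
  "real_point (a - b) = real_point a - real_point b"
  "real_point (k *s a) = of_int k *\<^sub>R real_point a"
  "real_point 0 = 0"
  by (simp_all add: real_point_def vec_eq_iff)

text \<open>The dilate k D is an image, so that for k = 0 and nonempty \<open>D\<close> it is the
  origin, the support of a constant.\<close>

definition supported_in :: "(real ^ 'n) set \<Rightarrow> nat \<Rightarrow> ('n::finite, 'a::zero) laurent_poly \<Rightarrow> bool" where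
  "supported_in D k g \<longleftrightarrow> (\<forall>b\<in>Poly_Mapping.keys g. real_point b \<in> (\<lambda>x. real k *\<^sub>R x) ` D)"

lemma supported_in_diff:
  fixes g h :: "('n::finite, 'a::comm_ring_1) laurent_poly"
  shows "supported_in D k g \<Longrightarrow> supported_in D k h \<Longrightarrow> supported_in D k (g - h)"
  using keys_diff[of g h] by (auto simp: supported_in_def)

lemma supported_in_sum:
  fixes g :: "'i \<Rightarrow> ('n::finite, 'a::comm_ring_1) laurent_poly"
  shows "(\<And>i. i \<in> I \<Longrightarrow> supported_in D k (g i)) \<Longrightarrow> supported_in D k (sum g I)"
  using keys_sum[of g I] unfolding supported_in_def by blast

text \<open>For convex \<open>D\<close> the sum of k D and l D lies in (k + l) D: take the mean of
  the two points with weights k and l. The case k + l = 0, where the weights are undefined, only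
  concerns the origin.\<close>

lemma supported_in_mult:
  fixes g h :: "('n::finite, 'a::comm_ring_1) laurent_poly"
  assumes D: "convex D" and "supported_in D k g" "supported_in D l h"
  shows "supported_in D (k + l) (g * h)"
  unfolding supported_in_def
proof
  fix c assume "c \<in> Poly_Mapping.keys (g * h)"
  then obtain a b where c: "c = a + b" "a \<in> Poly_Mapping.keys g" "b \<in> Poly_Mapping.keys h"
    using keys_mult[of g h] by blast
  then obtain x y where x: "x \<in> D" "real_point a = real k *\<^sub>R x" and y: "y \<in> D" "real_point b = real l *\<^sub>R y"
    using assms(2,3) by (force simp: supported_in_def)
  show "real_point c \<in> (\<lambda>x. real (k + l) *\<^sub>R x) ` D"
  proof (cases "k + l = 0")
    case True
    then show ?thesis using x y c by (auto simp: real_point_simps)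
  next
    case False
    let ?z = "(real k / real (k + l)) *\<^sub>R x + (real l / real (k + l)) *\<^sub>R y"
    have "?z \<in> D" using D x(1) y(1) False
      by (intro convexD) (auto simp: add_divide_distrib[symmetric])
    moreover have "real_point c = real (k + l) *\<^sub>R ?z"
      using False x y c by (simp add: real_point_simps scaleR_add_right del: of_nat_add)
    ultimately show ?thesis by blast
  qed
qed

lemma supported_in_one: "D \<noteq> {} \<Longrightarrow> supported_in D 0 (1 :: ('n::finite, 'a::comm_ring_1) laurent_poly)"
  by (auto simp: supported_in_def real_point_simps)

lemma supported_in_power:
  fixes g :: "('n::finite, 'a::comm_ring_1) laurent_poly"
  assumes "convex D" "D \<noteq> {}" "supported_in D 1 g"
  shows "supported_in D k (g ^ k)"
proof (induction k)
  case 0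
  then show ?case using assms(2) by (simp add: supported_in_one)
next
  case (Suc k)
  then have "supported_in D (1 + k) (g * g ^ k)" by (intro supported_in_mult assms)
  then show ?case by simp
qed

lemma supported_in_laurent_frob:
  fixes g :: "('n::finite, 'a::comm_ring_1) laurent_poly"
  assumes "supported_in D k g"
  shows "supported_in D (q * k) (laurent_frob q \<sigma> g)"
  unfolding supported_in_def
proof
  fix c assume "c \<in> Poly_Mapping.keys (laurent_frob q \<sigma> g)"
  then obtain b where b: "b \<in> Poly_Mapping.keys g" "c = int q *s b"
    using keys_laurent_frob by blast
  then obtain x where "x \<in> D" "real_point b = real k *\<^sub>R x"
    using assms by (force simp: supported_in_def)
  then show "real_point c \<in> (\<lambda>x. real (q * k) *\<^sub>R x) ` D"
    using b by (auto simp: real_point_simps)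
qed

lemma newton_polytope_supports: "supported_in (newton_polytope f) 1 f"
  by (auto simp: supported_in_def newton_polytope_def in_keys_iff intro!: hull_inc)

text \<open>The dilation factors fit: p^i - 1 = (p^j - 1) + p^j (p^(i-j) - 1), so every summand of
  the recursion lies in the same dilate as f^(p^i - 1).\<close>

lemma supported_in_dwork_term:
  fixes f :: "('n::finite, 'a::comm_ring_1) laurent_poly"
  assumes D: "convex D" "D \<noteq> {}" "supported_in D 1 f" and p: "0 < p"
  shows "supported_in D (p ^ i - 1) (dwork_term p \<sigma> f i)"
proof (induction i rule: less_induct)
  case (less i)
  have "supported_in D (p ^ i - 1) (dwork_term p \<sigma> f j * laurent_frob (p ^ j) (\<sigma> ^^ j) (f ^ (p ^ (i - j) - 1)))"
    if j: "j \<in> {1..<i}" for j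
  proof -
    have "p ^ i = p ^ j * p ^ (i - j)" using j by (simp flip: power_add)
    moreover have "1 \<le> p ^ j" "1 \<le> p ^ (i - j)" using p by simp_all
    ultimately have "p ^ i - 1 = (p ^ j - 1) + p ^ j * (p ^ (i - j) - 1)"
      by (simp add: diff_mult_distrib2)
    then show ?thesis
      using j less D by (simp only:) (intro supported_in_mult supported_in_laurent_frob supported_in_power; simp)
  qed
  then show ?case
    unfolding dwork_term.simps[of p \<sigma> f i]
    by (intro supported_in_diff supported_in_power supported_in_sum D)
qed

text \<open>The assumption says q w = u + (q - 1) x with x in \<open>D\<close>, so w is a convex
  combination in which u has the positive weight 1/q. Moving from any point of a convex set towards
  an interior point, by a positive fraction, ends in the interior.\<close>

lemma integral_points_convex_step:
  fixes D :: "(real ^ 'n::finite) set"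
  assumes D: "convex D" and J: "J = integral_points D \<or> J = integral_points (interior D)"
    and u: "u \<in> J" and q: "0 < q" and w: "real_point (int q *s w - u) \<in> (\<lambda>x. real (q - 1) *\<^sub>R x) ` D"
  shows "w \<in> J"
proof -
  obtain x where x: "x \<in> D" "real_point (int q *s w - u) = real (q - 1) *\<^sub>R x" using w by blast
  let ?e = "1 / real q"
  have "real q *\<^sub>R real_point w = real_point u + (real q - 1) *\<^sub>R x"
    using x(2) q by (simp add: real_point_simps of_nat_diff algebra_simps)
  then have "?e *\<^sub>R (real q *\<^sub>R real_point w) = ?e *\<^sub>R (real_point u + (real q - 1) *\<^sub>R x)" by simp
  \<comment> \<open>Written as x shrunk towards u, the shape required by
    \<open>mem_interior_convex_shrink\<close>.\<close>
  then have w_eq: "real_point w = x - ?e *\<^sub>R (x - real_point u)"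
    using q by (simp add: algebra_simps diff_divide_distrib)
  have e: "0 < ?e" "?e \<le> 1" using q by auto
  from J show ?thesis
  proof
    assume J: "J = integral_points D"
    then have "(1 - ?e) *\<^sub>R x + ?e *\<^sub>R real_point u \<in> D"
      using D x(1) u e by (intro convexD) (auto simp: integral_points_def)
    then show ?thesis using J by (simp add: integral_points_def w_eq algebra_simps)
  next
    assume J: "J = integral_points (interior D)"
    then have "x - ?e *\<^sub>R (x - real_point u) \<in> interior D"
      using D x(1) u e by (intro mem_interior_convex_shrink) (auto simp: integral_points_def)
    then show ?thesis using J by (simp add: integral_points_def w_eq)
  qed
qed

lemma finite_integral_points:
  fixes D :: "(real ^ 'n::finite) set"
  assumes "bounded D"
  shows "finite (integral_points D)"
proof -
  obtain B where B: "\<And>x. x \<in> D \<Longrightarrow> norm x \<le> B" using assms by (auto simp: bounded_iff)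
  let ?T = "{- \<lceil>B\<rceil>..\<lceil>B\<rceil>}"
  have "integral_points D \<subseteq> vec_lambda ` (PiE UNIV (\<lambda>_. ?T))"
  proof
    fix u assume "u \<in> integral_points D"
    then have n: "norm (real_point u) \<le> B" using B by (simp add: integral_points_def)
    have "u $ i \<in> ?T" for i
    proof -
      have "\<bar>real_point u $ i\<bar> \<le> norm (real_point u)" by (rule component_le_norm_cart)
      then have "\<bar>real_of_int (u $ i)\<bar> \<le> B" using n by (simp add: real_point_def)
      then have "\<bar>real_of_int (u $ i)\<bar> \<le> of_int \<lceil>B\<rceil>" using le_of_int_ceiling order.trans by blast
      then show ?thesis by (simp add: abs_le_iff)
    qed
    then show "u \<in> vec_lambda ` (PiE UNIV (\<lambda>_. ?T))"
      by (intro image_eqI[of _ _ "vec_nth u"]) (auto simp: PiE_def)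
  qed
  then show ?thesis by (rule finite_subset) (intro finite_imageI finite_PiE; simp)
qed

lemma bounded_newton_polytope: "bounded (newton_polytope f)"
proof -
  have "{u. Poly_Mapping.lookup f u \<noteq> 0} = Poly_Mapping.keys f" by (auto simp: in_keys_iff)
  then show ?thesis
    unfolding newton_polytope_def by (intro bounded_convex_hull finite_imp_bounded) simp
qed

section \<open>Extending the Frobenius endomorphism to \<open>R \<otimes> \<rat>\<close>\<close>

lemma ring_hom_fun_to_tensor_rat: "ring_hom_fun (to_tensor_rat :: 'a::{comm_ring_1,ring_char_0} \<Rightarrow> _)"
  by (simp add: ring_hom_fun_def to_tensor_rat_def tens_one tens_add_left tens_mult)

lemma ring_hom_fun_tens_1: "ring_hom_fun (tens 1 :: rat \<Rightarrow> 'a::{comm_ring_1,ring_char_0} tensor_rat)"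
  by (simp add: ring_hom_fun_def tens_one tens_add_right tens_mult)

definition tensor_recip :: "nat \<Rightarrow> 'a::{comm_ring_1,ring_char_0} tensor_rat" where
  "tensor_recip n = tens 1 (1 / of_nat n)"

lemma of_nat_mult_tensor_recip:
  assumes "0 < n"
  shows "of_nat n * tensor_recip n = (1 :: 'a::{comm_ring_1,ring_char_0} tensor_rat)"
proof -
  have "of_nat n * tensor_recip n = (tens 1 (of_nat n) * tens 1 (1 / of_nat n) :: 'a tensor_rat)"
    by (simp add: tensor_recip_def ring_hom_fun_of_nat[OF ring_hom_fun_tens_1])
  also have "\<dots> = 1" using assms by (simp add: tens_mult tens_one)
  finally show ?thesis .
qed

lemma tens_eq_recip_mult: "tens r (1 / of_nat n) = tensor_recip n * to_tensor_rat r"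
  by (simp add: tensor_recip_def to_tensor_rat_def tens_mult)

lemma to_tensor_rat_localized: "prime p \<Longrightarrow> to_tensor_rat r \<in> localized_at p"
proof -
  assume "prime p"
  then have "1 \<in> rat_localized_at p" by (auto simp: rat_localized_at_def)
  then show ?thesis unfolding to_tensor_rat_def localized_at_def by blast
qed

lemma tensor_recip_localized:
  assumes "prime p" "\<not> p dvd n"
  shows "tensor_recip n \<in> localized_at p"
proof -
  have "n \<noteq> 0" using assms(2) by (auto intro: ccontr)
  then have "tensor_recip n = frac_tensor 1 (int n)"
    by (simp add: tensor_recip_def frac_tensor_eq_tens)
  moreover have "\<not> int p dvd int n" using assms(2) by simp
  ultimately show ?thesis unfolding localized_at_iff[OF assms(1)] by blast
qed

lemma localized_at_cases:
  assumes "x \<in> localized_at p"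
  obtains r n where "0 < n" "\<not> p dvd n" "x = to_tensor_rat r * tensor_recip n"
proof -
  obtain r q where q: "q \<in> rat_localized_at p" "x = tens r q"
    using assms by (auto simp: localized_at_def)
  obtain a m where am: "quotient_of q = (a, m)" by fastforce
  have m: "0 < m" using quotient_of_denom_pos[OF am] .
  then obtain n where n: "m = int n" "0 < n" by (metis zero_less_imp_eq_int)
  have "x = frac_tensor (r * of_int a) m" by (simp add: q(2) tens_def am)
  also have "\<dots> = to_tensor_rat (r * of_int a) * tensor_recip n"
    using m n by (simp add: frac_tensor_eq_tens to_tensor_rat_def tensor_recip_def tens_mult)
  finally have "x = to_tensor_rat (r * of_int a) * tensor_recip n" .
  moreover have "\<not> p dvd n" using q(1) am n by (simp add: rat_localized_at_def)
  ultimately show ?thesis using that n by blast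
qed

lemma subring_set_localized_at:
  assumes "prime p"
  shows "subring_set (localized_at p :: 'a::{comm_ring_1,ring_char_0} tensor_rat set)"
proof
  note hom = ring_hom_fun_to_tensor_rat[where 'a='a]
  show "(1 :: 'a tensor_rat) \<in> localized_at p"
    using to_tensor_rat_localized[OF assms, of "1 :: 'a"] by (simp add: ring_hom_fun_one[OF hom])
  fix x y :: "'a tensor_rat" assume xy: "x \<in> localized_at p" "y \<in> localized_at p"
  show "x * y \<in> localized_at p" by (intro localized_at_closed assms xy)
  have "to_tensor_rat (0 - 1) * y \<in> localized_at p"
    by (intro localized_at_closed assms xy to_tensor_rat_localized)
  then have "- y \<in> localized_at p"
    unfolding ring_hom_fun_diff[OF hom] by (simp add: ring_hom_fun_zero[OF hom] ring_hom_fun_one[OF hom])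
  then show "x - y \<in> localized_at p"
    using localized_at_closed(1)[OF assms xy(1), of "- y"] by simp
qed

lemma pow_multiples_localized:
  fixes x :: "'a::{comm_ring_1,ring_char_0}"
  assumes "prime p" "of_nat p ^ r dvd x"
  shows "to_tensor_rat x \<in> pow_multiples p (localized_at p) r"
proof -
  note hom = ring_hom_fun_to_tensor_rat[where 'a='a]
  obtain t where "x = of_nat p ^ r * t" using assms(2) by (elim dvdE)
  then have "to_tensor_rat x = of_nat p ^ r * to_tensor_rat t"
    by (simp add: ring_hom_fun_mult[OF hom] ring_hom_fun_power[OF hom] ring_hom_fun_of_nat[OF hom])
  then show ?thesis using to_tensor_rat_localized[OF assms(1)] by (auto simp: pow_multiples_def)
qed

text \<open>Fermat's little theorem, read off from the p-th power of a sum of n ones.\<close>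

lemma of_nat_prime_power_dvd:
  assumes "prime p"
  shows "(of_nat p :: 'a::comm_ring_1) dvd of_nat n ^ p - of_nat n"
proof -
  interpret subring_set "UNIV :: 'a set" by (rule subring_set_UNIV)
  show ?thesis
    using prime_power_sum_cong[OF assms, of "{..<n}" "\<lambda>_. 1"] by (simp add: pow_multiples_UNIV)
qed

context
  fixes \<sigma> :: "'a::{comm_ring_1,ring_char_0} \<Rightarrow> 'a"
  assumes \<sigma>: "ring_hom_fun \<sigma>"
begin

text \<open>The universal property gives an additive map; it is multiplicative because every element
  of R tensor Q is a single pure tensor.\<close>

lemma tensor_extension_exists:
  obtains \<tau> where "ring_hom_fun \<tau>" "\<And>r q. \<tau> (tens r q) = tens (\<sigma> r) q"
proof -
  obtain \<tau> where \<tau>: "\<And>x y. \<tau> (x + y) = \<tau> x + \<tau> y" "\<And>r q. \<tau> (tens r q) = tens (\<sigma> r) q"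
  proof -
    have "\<exists>!h. (\<forall>x y. h (x + y) = h x + h y) \<and> (\<forall>r q. h (tens r q) = tens (\<sigma> r) q)"
      by (rule tens_universal) (simp_all only: ring_hom_fun_add[OF \<sigma>] tens_add_left tens_add_right)
    then show ?thesis using that by (elim ex1E) blast
  qed
  have "\<tau> (x * y) = \<tau> x * \<tau> y" for x y
  proof -
    have tens: "\<exists>r q. z = tens r q" for z :: "'a tensor_rat"
    proof (cases z)
      case (1 r m)
      then have "z = tens r (1 / of_int m)" using frac_tensor_eq_tens by blast
      then show ?thesis by blast
    qed
    obtain r q where "x = tens r q" using tens by blast
    moreover obtain s q' where "y = tens s q'" using tens by blast
    ultimately show ?thesis by (simp only: tens_mult \<tau>(2) ring_hom_fun_mult[OF \<sigma>])
  qed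
  moreover have "\<tau> 1 = 1" using \<tau>(2)[of 1 1] by (simp only: tens_one ring_hom_fun_one[OF \<sigma>])
  ultimately have "ring_hom_fun \<tau>" using \<tau>(1) unfolding ring_hom_fun_def by blast
  then show ?thesis using \<tau>(2) by (rule that)
qed

text \<open>Write x = r c with c = 1/n and n prime to p. The extension fixes c, so the error is
  (\<sigma> r - r^p) c + r^p (c - c^p). The first part is the Frobenius congruence on R; in the
  second, c - c^p = (n^p - n) c^(p+1), and Fermat applies.\<close>

lemma tensor_extension_localized:
  assumes \<tau>: "ring_hom_fun \<tau>" "\<And>r q. \<tau> (tens r q) = tens (\<sigma> r) q"
    and p: "prime p" and frob: "\<And>r. of_nat p dvd \<sigma> r - r ^ p" and x: "x \<in> localized_at p"
  shows "\<tau> x \<in> localized_at p" and "\<tau> x - x ^ p \<in> pow_multiples p (localized_at p) 1"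
proof -
  interpret A: subring_set "localized_at p :: 'a tensor_rat set" by (rule subring_set_localized_at[OF p])
  note hom = ring_hom_fun_to_tensor_rat[where 'a='a]
  obtain r n where n: "0 < n" "\<not> p dvd n" and x_eq: "x = to_tensor_rat r * tensor_recip n"
    using localized_at_cases[OF x] .
  let ?c = "tensor_recip n :: 'a tensor_rat"
  have c: "?c \<in> localized_at p" by (rule tensor_recip_localized[OF p n(2)])
  have \<tau>x: "\<tau> x = to_tensor_rat (\<sigma> r) * ?c"
    unfolding x_eq ring_hom_fun_mult[OF \<tau>(1)]
    by (simp add: to_tensor_rat_def tensor_recip_def \<tau>(2) ring_hom_fun_one[OF \<sigma>])
  then show "\<tau> x \<in> localized_at p" by (simp add: A.mult_closed c to_tensor_rat_localized[OF p])
  have "?c - ?c ^ p = to_tensor_rat (of_nat n ^ p - of_nat n) * (?c ^ p * ?c)"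
  proof -
    have "of_nat n ^ p * ?c ^ p = 1"
      by (simp add: of_nat_mult_tensor_recip[OF n(1)] flip: power_mult_distrib)
    moreover have "(of_nat n ^ p - of_nat n) * (?c ^ p * ?c) =
        (of_nat n ^ p * ?c ^ p) * ?c - ?c ^ p * (of_nat n * ?c)"
      by (simp add: algebra_simps)
    ultimately show ?thesis
      by (simp add: of_nat_mult_tensor_recip[OF n(1)] ring_hom_fun_diff[OF hom]
          ring_hom_fun_power[OF hom] ring_hom_fun_of_nat[OF hom])
  qed
  moreover have "\<tau> x - x ^ p = to_tensor_rat (\<sigma> r - r ^ p) * ?c + to_tensor_rat (r ^ p) * (?c - ?c ^ p)"
    unfolding \<tau>x unfolding x_eq power_mult_distrib ring_hom_fun_diff[OF hom] ring_hom_fun_power[OF hom]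
    by (simp add: algebra_simps)
  ultimately have "\<tau> x - x ^ p = to_tensor_rat (\<sigma> r - r ^ p) * ?c +
      to_tensor_rat (r ^ p) * (to_tensor_rat (of_nat n ^ p - of_nat n) * (?c ^ p * ?c))"
    by (simp only:)
  also have "\<dots> \<in> pow_multiples p (localized_at p) 1"
    using frob of_nat_prime_power_dvd[OF p, of n] c
    by (intro A.pow_multiples_add A.pow_multiples_mult_left A.pow_multiples_mult_right
        pow_multiples_localized[OF p] to_tensor_rat_localized[OF p] A.mult_closed A.power_closed) simp_all
  finally show "\<tau> x - x ^ p \<in> pow_multiples p (localized_at p) 1" .
qed

end

lemma funpow_to_tensor_rat:
  fixes \<sigma> :: "'a::{comm_ring_1,ring_char_0} \<Rightarrow> 'a"
  assumes "\<And>r q. \<tau> (tens r q) = tens (\<sigma> r) q"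
  shows "(\<tau> ^^ i) (to_tensor_rat r) = to_tensor_rat ((\<sigma> ^^ i) r)"
  by (induction i) (simp_all add: to_tensor_rat_def assms)

section \<open>Integrality of the formal group\<close>

lemma beta_1: "beta f 1 u v = (if u = v then 1 else 0)"
  by (auto simp: beta_def lookup_one)

section \<open>The logarithm and the coefficient matrices of \<open>f\<close>\<close>

lemma laurent_log_term_ord:
  "(\<Sum>v\<in>J. mfps_const (c v) * mfps_var v ^ m) \<in> (mfps_ord m :: ('v, 'b::comm_ring_1) mfps set)"
  by (intro mfps_ord_sum mfps_ord_mult_left mfps_ord_power_1 mfps_var_ord)

text \<open>The m-th member of the family has order m, so those with m above N are invisible in
  degrees up to N.\<close>

lemma laurent_log_trunc:
  fixes f :: "('n::finite, 'a::{comm_ring_1,ring_char_0}) laurent_poly"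
  shows "laurent_log f J u - (\<Sum>m=1..N. \<Sum>v\<in>J. mfps_const (tensor_recip m * to_tensor_rat (beta f m u v)) * mfps_var v ^ m)
    \<in> mfps_ord (Suc N)"
proof (rule mfps_ordI)
  fix \<alpha> :: "int ^ 'n \<Rightarrow>\<^sub>0 nat" assume \<alpha>: "monom_deg \<alpha> < Suc N"
  let ?F = "\<lambda>m. \<Sum>v\<in>J. mfps_const (tens (beta f m u v) (1 / of_nat m)) * mfps_var v ^ m"
  have "mfps_coeff (laurent_log f J u) \<alpha> = (\<Sum>m | m \<in> {1..} \<and> mfps_coeff (?F m) \<alpha> \<noteq> 0. mfps_coeff (?F m) \<alpha>)"
    unfolding laurent_log_def mfps_sum.rep_eq ..
  also have "\<dots> = (\<Sum>m=1..N. mfps_coeff (?F m) \<alpha>)"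
  proof (rule sum.mono_neutral_left)
    have "m \<le> N" if "mfps_coeff (?F m) \<alpha> \<noteq> 0" for m
    proof (rule ccontr)
      assume "\<not> m \<le> N"
      then have "monom_deg \<alpha> < m" using \<alpha> by simp
      then have "mfps_coeff (?F m) \<alpha> = 0" by (rule mfps_ordD[OF laurent_log_term_ord])
      with that show False by contradiction
    qed
    then show "{m. m \<in> {1..} \<and> mfps_coeff (?F m) \<alpha> \<noteq> 0} \<subseteq> {1..N}" by auto
  qed auto
  finally show "mfps_coeff (laurent_log f J u -
      (\<Sum>m=1..N. \<Sum>v\<in>J. mfps_const (tensor_recip m * to_tensor_rat (beta f m u v)) * mfps_var v ^ m)) \<alpha> = 0"
    by (simp add: tens_eq_recip_mult)
qed

lemma laurent_log_over:
  fixes f :: "('n::finite, 'a::{comm_ring_1,ring_char_0}) laurent_poly"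
  shows "laurent_log f J u \<in> mfps_over UNIV J"
  unfolding mfps_over_iff
proof (intro allI impI)
  fix \<alpha> :: "int ^ 'n \<Rightarrow>\<^sub>0 nat"
  let ?F = "\<lambda>m. \<Sum>v\<in>J. mfps_const (tens (beta f m u v) (1 / of_nat m)) * mfps_var v ^ m"
  assume "mfps_coeff (laurent_log f J u) \<alpha> \<noteq> 0"
  then obtain m where m: "mfps_coeff (?F m) \<alpha> \<noteq> 0"
    unfolding laurent_log_def mfps_sum.rep_eq by (elim sum.not_neutral_contains_not_neutral) auto
  have "?F m \<in> mfps_over UNIV J"
    by (intro mfps_over_UNIV.sum_closed mfps_over_UNIV.mult_closed mfps_over_UNIV.power_closed
        mfps_var_over mfps_const_over)
  then show "Poly_Mapping.keys \<alpha> \<subseteq> J" using m unfolding mfps_over_iff by blast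
qed

text \<open>The coefficient of the polynomial congruence at the exponent m p^s v - u. It shows the
  matrices of the functional equation: entry (u, w) of \<open>\<gamma>\<^sub>i\<close> is the
  coefficient of \<open>V\<^sub>i\<close> at p^i w - u.\<close>

lemma beta_cong:
  fixes f :: "('n::finite, 'a::comm_ring_1) laurent_poly"
  assumes p: "prime p" and \<sigma>: "ring_hom_fun \<sigma>" "\<And>r. of_nat p dvd \<sigma> r - r ^ p"
    and J: "finite J" and m: "0 < m"
    and supp: "\<And>i w. Poly_Mapping.lookup (dwork_term p \<sigma> f i) (int (p ^ i) *s w - u) \<noteq> 0 \<Longrightarrow> w \<in> J"
  shows "of_nat p ^ s dvd beta f (m * p ^ s) u v - (\<Sum>i=1..s. \<Sum>w\<in>J.
    Poly_Mapping.lookup (dwork_term p \<sigma> f i) (int (p ^ i) *s w - u) * (\<sigma> ^^ i) (beta f (m * p ^ (s - i)) w v))"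
proof -
  let ?V = "dwork_term p \<sigma> f" and ?frob = "\<lambda>i. laurent_frob (p ^ i) (\<sigma> ^^ i)"
  let ?e = "int (m * p ^ s) *s v - u"
  obtain E where E: "f ^ (m * p ^ s - 1) - (\<Sum>i=1..s. ?V i * ?frob i (f ^ (m * p ^ (s - i) - 1))) = of_nat p ^ s * E"
    using dwork_congruence[where f=f and s=s, OF p \<sigma> m] by (elim dvdE)
  have "of_nat p ^ s * Poly_Mapping.lookup E ?e =
    Poly_Mapping.lookup (f ^ (m * p ^ s - 1) - (\<Sum>i=1..s. ?V i * ?frob i (f ^ (m * p ^ (s - i) - 1)))) ?e"
    by (simp only: E lookup_of_nat_power_mult)
  also have "\<dots> = beta f (m * p ^ s) u v -
      (\<Sum>i=1..s. Poly_Mapping.lookup (?V i * ?frob i (f ^ (m * p ^ (s - i) - 1))) ?e)"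
    by (simp only: lookup_minus lookup_sum beta_def)
  also have "(\<Sum>i=1..s. Poly_Mapping.lookup (?V i * ?frob i (f ^ (m * p ^ (s - i) - 1))) ?e) =
    (\<Sum>i=1..s. \<Sum>w\<in>J. Poly_Mapping.lookup (?V i) (int (p ^ i) *s w - u) *
      (\<sigma> ^^ i) (beta f (m * p ^ (s - i)) w v))"
  proof (rule sum.cong[OF refl])
    fix i assume "i \<in> {1..s}"
    then have "m * p ^ s = p ^ i * (m * p ^ (s - i))" by (simp flip: power_add add: ac_simps)
    then show "Poly_Mapping.lookup (?V i * ?frob i (f ^ (m * p ^ (s - i) - 1))) ?e =
      (\<Sum>w\<in>J. Poly_Mapping.lookup (?V i) (int (p ^ i) *s w - u) * (\<sigma> ^^ i) (beta f (m * p ^ (s - i)) w v))"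
      unfolding beta_def
      by (simp only:) (rule lookup_mult_laurent_frob[OF ring_hom_fun_funpow[OF \<sigma>(1)] J supp])
  qed
  finally show ?thesis by (rule dvdI[OF sym])
qed

theorem theorem2:
  fixes f :: "('n::finite, 'a::{comm_ring_1,ring_char_0}) laurent_poly"
    and J :: "(int ^ 'n) set" and p :: nat
  assumes char_zero: "inj (to_tensor_rat :: 'a \<Rightarrow> 'a tensor_rat)"
    and J: "J = integral_points (newton_polytope f) \<or>
            J = integral_points (interior (newton_polytope f))"
    and "J \<noteq> {}"
    and "prime p"
    and frobenius: "\<exists>\<sigma> :: 'a \<Rightarrow> 'a. frobenius_endomorphism p \<sigma>"
  shows "\<forall>u\<in>J. laurent_formal_group f J u \<in> mfps_over (localized_at p) (J <+> J)"
proof -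
  obtain \<sigma> :: "'a \<Rightarrow> 'a" where \<sigma>: "ring_hom_fun \<sigma>" "\<And>r. of_nat p dvd \<sigma> r - r ^ p"
    using frobenius by (auto simp: frobenius_endomorphism_def ring_hom_fun_def)
  obtain \<tau> where \<tau>: "ring_hom_fun \<tau>" "\<And>r q. \<tau> (tens r q) = tens (\<sigma> r) q"
    using tensor_extension_exists[OF \<sigma>(1)] by blast
  note hom = ring_hom_fun_to_tensor_rat[where 'a='a]
  let ?D = "newton_polytope f" and ?V = "dwork_term p \<sigma> f"
  let ?\<gamma> = "\<lambda>i u w. Poly_Mapping.lookup (?V i) (int (p ^ i) *s w - u)"
  have p0: "0 < p" using \<open>prime p\<close> by (rule prime_gt_0_nat)
  have convex: "convex ?D" by (simp add: newton_polytope_def convex_convex_hull)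
  have D_ne: "?D \<noteq> {}" using J \<open>J \<noteq> {}\<close> by (auto simp: integral_points_def)
  have fin: "finite J"
    using J finite_integral_points[OF bounded_newton_polytope[of f]]
      finite_integral_points[OF bounded_interior[OF bounded_newton_polytope[of f]]] by auto
  \<comment> \<open>Closure of J under the recursion: \<open>V\<^sub>i\<close> lives on the dilate
    of the polytope by p^i - 1, and the convexity step with q = p^i returns w to J.\<close>
  have supp: "w \<in> J" if "u \<in> J" "?\<gamma> i u w \<noteq> 0" for u w i
  proof -
    have "supported_in ?D (p ^ i - 1) (?V i)"
      by (intro supported_in_dwork_term convex D_ne newton_polytope_supports p0)
    moreover have "int (p ^ i) *s w - u \<in> Poly_Mapping.keys (?V i)"
      using that(2) by (rule in_keys_iff[THEN iffD2])
    ultimately have "real_point (int (p ^ i) *s w - u) \<in> (\<lambda>x. real (p ^ i - 1) *\<^sub>R x) ` ?D"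
      unfolding supported_in_def by (rule bspec)
    moreover have "0 < p ^ i" using p0 by simp
    ultimately show ?thesis by (rule integral_points_convex_step[OF convex J that(1), rotated])
  qed
  \<comment> \<open>The divisibilities are proved inside R and then mapped to R_(p), where \<tau>
    extends \<sigma> and plays the role of Frobenius.\<close>
  interpret functional_equation p "localized_at p" \<tau> tensor_recip J
    "\<lambda>m u v. to_tensor_rat (beta f m u v)" "\<lambda>i u w. to_tensor_rat (?\<gamma> i u w)" "laurent_log f J"
  proof (rule functional_equation.intro)
    fix u w :: "int ^ 'n" and i :: nat assume "0 < i" "u \<in> J" "w \<in> J"
    have "of_nat p ^ (i - 1) dvd ?V i"
      using dwork_term_dvd[OF \<open>prime p\<close> \<sigma> \<open>0 < i\<close>] .
    then obtain E where "?V i = of_nat p ^ (i - 1) * E" by (elim dvdE)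
    then have "of_nat p ^ (i - 1) dvd ?\<gamma> i u w" by (simp only: lookup_of_nat_power_mult dvd_triv_left)
    then show "to_tensor_rat (?\<gamma> i u w) \<in> pow_multiples p (localized_at p) (i - 1)"
      by (rule pow_multiples_localized[OF \<open>prime p\<close>])
  next
    fix m s :: nat and u v :: "int ^ 'n" assume *: "0 < m" "u \<in> J" "v \<in> J"
    have "to_tensor_rat (beta f (m * p ^ s) u v -
        (\<Sum>i=1..s. \<Sum>w\<in>J. ?\<gamma> i u w * (\<sigma> ^^ i) (beta f (m * p ^ (s - i)) w v)))
      \<in> pow_multiples p (localized_at p) s"
      by (intro pow_multiples_localized beta_cong \<open>prime p\<close> \<sigma> fin * supp[OF *(2)])
    then show "to_tensor_rat (beta f (m * p ^ s) u v) - (\<Sum>i=1..s. \<Sum>w\<in>J. to_tensor_rat (?\<gamma> i u w) *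
        (\<tau> ^^ i) (to_tensor_rat (beta f (m * p ^ (s - i)) w v))) \<in> pow_multiples p (localized_at p) s"
      by (simp only: ring_hom_fun_diff[OF hom] ring_hom_fun_sum[OF hom] ring_hom_fun_mult[OF hom]
          funpow_to_tensor_rat[of \<tau> \<sigma>, OF \<tau>(2)])
  next
    fix u :: "int ^ 'n" and N :: nat
    show "laurent_log f J u - (\<Sum>m=1..N. \<Sum>v\<in>J. mfps_const (tensor_recip m * to_tensor_rat (beta f m u v)) *
        mfps_var v ^ m) \<in> mfps_ord (Suc N)"
      by (rule laurent_log_trunc)
  next
    fix u v :: "int ^ 'n"
    show "to_tensor_rat (beta f 1 u v) = (if u = v then 1 else 0)"
      by (simp only: beta_1 ring_hom_fun_one[OF hom] ring_hom_fun_zero[OF hom] split: if_split) simp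
  qed (rule \<open>prime p\<close> \<tau>(1) fin subring_set_localized_at[OF \<open>prime p\<close>] of_nat_mult_tensor_recip
      tensor_extension_localized[OF \<sigma>(1) \<tau> \<open>prime p\<close> \<sigma>(2)] tensor_recip_localized[OF \<open>prime p\<close>]
      to_tensor_rat_localized[OF \<open>prime p\<close>] laurent_log_over; assumption?)+
  show ?thesis
    unfolding laurent_formal_group_def by (intro ballI formal_group_integral)
qed

end
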